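(* Let $\xi_0\in L^2(\mathbb T^2)$ with $\int_{\mathbb T^2}\xi_0\,\mathrm dx=0$ be fixed, let $\xi$ be the unique solution of $\partial_t\xi+(K\ast\xi)\cdot\nabla\xi=\Delta\xi$, $\xi|_{t=0}=\xi_0$, and let $\beta\in(0,\alpha)$, where $\alpha\in(0,1)$. Then for any $z\in C^0([0,T];H^{\beta-1})$ there exists a unique solution $y\in C^0([0,T];H^{\beta-1})$ of $$y_t=-\int_0^tP_{t-s}\big[(K\ast y_s)\cdot\nabla\xi_s+(K\ast\xi_s)\cdot\nabla y_s\big]\,\mathrm ds+z_t .$$ Moreover, the solution map $z\mapsto y=:Sz$ is a linear bounded operator and there exists $C>0$ such that $$\|Sz\|_{C^0H^{\beta-1}}\lesssim\exp\big(C(1+T)\|\xi_0\|_{L^2}^2\big)\,\|z\|_{C^0H^{\beta-1}} .$$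
   Context: $T>0$ fixed, $\mathbb T^2=\mathbb R^2/\mathbb Z^2$, $H^s$ the usual Sobolev spaces on $\mathbb T^2$, $P_t=e^{t\Delta}$. $K$ is the Biot–Savart kernel on $\mathbb T^2$: $K\ast\xi$ is the zero-mean divergence-free vector field whose curl is $\xi$ (for zero-mean $\xi$), extended to distributions by its Fourier multiplier (the zero mode being sent to $0$). Products $V\cdot\nabla f$ with $V$ divergence-free are understood as $\nabla\cdot(Vf)$. $\lesssim$ means inequality up to a multiplicative constant, independent of $z$ and $\xi_0$. $\|y\|_{C^0H^{\beta-1}}=\sup_{t\in[0,T]}\|y_t\|_{H^{\beta-1}}$. *)

theory Defs
  imports "HOL-Analysis.Analysis"
begin

section \<open>Smooth functions and distributions on the torus\<close>

text \<open>
  The torus is the plane \<open>real \<times> real\<close> modulo the lattice of integer points: functions on the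
  torus are 1-periodic functions on the plane, with fundamental domain \<open>unit_square\<close>.
\<close>

type_synonym plane = "real \<times> real"

abbreviation unit_square :: "plane set" where
  "unit_square \<equiv> cbox (0, 0) (1, 1)"

definition periodic :: "(plane \<Rightarrow> real) \<Rightarrow> bool" where
  "periodic f \<longleftrightarrow> (\<forall>x m n. f (x + (of_int m, of_int n)) = f x)"

definition pdiff :: "plane \<Rightarrow> (plane \<Rightarrow> real) \<Rightarrow> plane \<Rightarrow> real" where
  "pdiff b f x = frechet_derivative f (at x) b"

primrec Ck :: "nat \<Rightarrow> (plane \<Rightarrow> real) \<Rightarrow> bool" where
  "Ck 0 f \<longleftrightarrow> continuous_on UNIV f"
| "Ck (Suc n) f \<longleftrightarrow> (\<forall>x. f differentiable (at x)) \<and> (\<forall>b\<in>Basis. Ck n (pdiff b f))"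

text \<open>For periodic \<open>f\<close> the supremum over the unit square is the one over the torus.\<close>

primrec Ck_norm :: "nat \<Rightarrow> (plane \<Rightarrow> real) \<Rightarrow> real" where
  "Ck_norm 0 f = (SUP x\<in>unit_square. \<bar>f x\<bar>)"
| "Ck_norm (Suc n) f = (SUP x\<in>unit_square. \<bar>f x\<bar>) + (\<Sum>b\<in>Basis. Ck_norm n (pdiff b f))"

lemma Ck_continuous: "Ck n f \<Longrightarrow> continuous_on UNIV f"
proof (cases n)
  case (Suc m)
  assume "Ck n f"
  with Suc have "\<forall>x. f differentiable (at x)" by simp
  then show ?thesis
    by (metis continuous_on_eq_continuous_within differentiable_imp_continuous_within)
qed simp

lemma pdiff_add:
  assumes "\<forall>x. f differentiable (at x)" "\<forall>x. g differentiable (at x)"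
  shows "pdiff b (\<lambda>x. f x + g x) = (\<lambda>x. pdiff b f x + pdiff b g x)"
proof
  fix x
  have "((\<lambda>x. f x + g x) has_derivative
      (\<lambda>h. frechet_derivative f (at x) h + frechet_derivative g (at x) h)) (at x)"
    using assms by (intro has_derivative_add) (metis frechet_derivative_works)+
  from frechet_derivative_at[OF this] show "pdiff b (\<lambda>x. f x + g x) x = pdiff b f x + pdiff b g x"
    unfolding pdiff_def by metis
qed

lemma pdiff_cmult:
  assumes "\<forall>x. f differentiable (at x)"
  shows "pdiff b (\<lambda>x. c * f x) = (\<lambda>x. c * pdiff b f x)"
proof
  fix x
  have "((\<lambda>x. c * f x) has_derivative (\<lambda>h. c * frechet_derivative f (at x) h)) (at x)"
    using assms by (intro has_derivative_mult_right) (metis frechet_derivative_works)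
  from frechet_derivative_at[OF this] show "pdiff b (\<lambda>x. c * f x) x = c * pdiff b f x"
    unfolding pdiff_def by metis
qed

lemma Ck_zero: "Ck n (\<lambda>x. 0)"
proof (induction n)
  case (Suc n)
  have "pdiff b (\<lambda>x. 0) = (\<lambda>x. 0)" for b
    using pdiff_cmult[of "\<lambda>x. 0" b 0] by simp
  with Suc show ?case by simp
qed simp

lemma Ck_add: "Ck n f \<Longrightarrow> Ck n g \<Longrightarrow> Ck n (\<lambda>x. f x + g x)"
  by (induction n arbitrary: f g) (auto intro: continuous_intros simp: pdiff_add)

lemma Ck_cmult: "Ck n f \<Longrightarrow> Ck n (\<lambda>x. c * f x)"
  by (induction n arbitrary: f) (auto intro: continuous_intros simp: pdiff_cmult)

typedef torus_test = "{f :: plane \<Rightarrow> real. periodic f \<and> (\<forall>n. Ck n f)}"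
  morphisms test_eval Abs_torus_test
  by (rule exI[of _ "\<lambda>x. 0"]) (simp add: periodic_def Ck_zero)

setup_lifting type_definition_torus_test

instantiation torus_test :: real_vector
begin

lift_definition zero_torus_test :: torus_test is "\<lambda>x. 0"
  by (simp add: periodic_def Ck_zero)

lift_definition plus_torus_test :: "torus_test \<Rightarrow> torus_test \<Rightarrow> torus_test"
  is "\<lambda>f g x. f x + g x"
  by (simp add: periodic_def Ck_add)

lift_definition scaleR_torus_test :: "real \<Rightarrow> torus_test \<Rightarrow> torus_test"
  is "\<lambda>c f x. c * f x"
  by (simp add: periodic_def Ck_cmult)

definition uminus_torus_test :: "torus_test \<Rightarrow> torus_test" where
  "- f = (- 1) *\<^sub>R (f :: torus_test)"

definition minus_torus_test :: "torus_test \<Rightarrow> torus_test \<Rightarrow> torus_test" where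
  "f - g = f + - (g :: torus_test)"

instance
proof
  fix f g h :: torus_test and a b :: real
  show "f + g + h = f + (g + h)" by transfer (simp add: add.assoc)
  show "f + g = g + f" by transfer (simp add: add.commute)
  show "0 + f = f" by transfer simp
  show "- f + f = 0" unfolding uminus_torus_test_def by transfer simp
  show "f - g = f + - g" by (rule minus_torus_test_def)
  show "a *\<^sub>R (f + g) = a *\<^sub>R f + a *\<^sub>R g" by transfer (simp add: distrib_left)
  show "(a + b) *\<^sub>R f = a *\<^sub>R f + b *\<^sub>R f" by transfer (simp add: distrib_right)
  show "a *\<^sub>R b *\<^sub>R f = (a * b) *\<^sub>R f" by transfer (simp add: mult.assoc)
  show "1 *\<^sub>R f = f" by transfer simp
qed

end

lemma sup_abs_nonneg:
  assumes "Ck n f"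
  shows "0 \<le> (SUP x\<in>unit_square. \<bar>f x\<bar>)"
proof -
  have "continuous_on unit_square (\<lambda>x. \<bar>f x\<bar>)"
    using Ck_continuous[OF assms] by (intro continuous_intros) (auto intro: continuous_on_subset)
  then have "bdd_above ((\<lambda>x. \<bar>f x\<bar>) ` unit_square)"
    by (intro bounded_imp_bdd_above compact_imp_bounded compact_continuous_image) auto
  moreover have "(0, 0) \<in> unit_square" by (simp add: cbox_Pair_eq)
  ultimately have "\<bar>f (0, 0)\<bar> \<le> (SUP x\<in>unit_square. \<bar>f x\<bar>)" by (rule cSUP_upper2) auto
  then show ?thesis by linarith
qed

lemma Ck_norm_nonneg: "Ck n f \<Longrightarrow> 0 \<le> Ck_norm n f"
proof (induction n arbitrary: f)
  case (Suc n)
  then show ?case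
    using sup_abs_nonneg[OF Suc.prems] by (auto intro!: add_nonneg_nonneg sum_nonneg)
qed (simp add: sup_abs_nonneg[of 0])

lemma Ck_norm_Suc: "Ck (Suc n) f \<Longrightarrow> Ck_norm n f \<le> Ck_norm (Suc n) f"
proof (induction n arbitrary: f)
  case 0
  then show ?case using Ck_norm_nonneg[of 0] by (auto intro!: sum_nonneg)
next
  case (Suc n)
  have "Ck_norm n (pdiff b f) \<le> Ck_norm (Suc n) (pdiff b f)" if "b \<in> Basis" for b
    using Suc.prems that by (intro Suc.IH) simp
  then show ?case
    unfolding Ck_norm.simps(2)[of "Suc n"] Ck_norm.simps(2)[of n f]
    by (intro add_left_mono sum_mono)
qed

definition test_norm :: "nat \<Rightarrow> torus_test \<Rightarrow> real" where
  "test_norm n \<phi> = Ck_norm n (test_eval \<phi>)"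

lemma Ck_test_eval: "Ck n (test_eval \<phi>)"
  using test_eval[of \<phi>] by blast

lemma test_norm_nonneg: "0 \<le> test_norm n \<phi>"
  unfolding test_norm_def by (rule Ck_norm_nonneg[OF Ck_test_eval])

lemma test_norm_mono: "m \<le> n \<Longrightarrow> test_norm m \<phi> \<le> test_norm n \<phi>"
  unfolding test_norm_def by (rule lift_Suc_mono_le[of "\<lambda>n. Ck_norm n (test_eval \<phi>)"], rule Ck_norm_Suc[OF Ck_test_eval])

text \<open>
  Real distributions on the torus: linear functionals on the smooth functions that are continuous
  for the topology given by the norms \<open>test_norm n\<close>.
\<close>

definition test_continuous :: "(torus_test \<Rightarrow> real) \<Rightarrow> bool" where
  "test_continuous u \<longleftrightarrow> (\<exists>C n. \<forall>\<phi>. \<bar>u \<phi>\<bar> \<le> C * test_norm n \<phi>)"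

lemma test_continuous_zero: "test_continuous (\<lambda>\<phi>. 0)"
  unfolding test_continuous_def by (rule exI[of _ 0]) simp

lemma test_continuous_add:
  assumes "test_continuous u" "test_continuous v"
  shows "test_continuous (\<lambda>\<phi>. u \<phi> + v \<phi>)"
proof -
  obtain C m D n where C: "\<And>\<phi>. \<bar>u \<phi>\<bar> \<le> C * test_norm m \<phi>" and D: "\<And>\<phi>. \<bar>v \<phi>\<bar> \<le> D * test_norm n \<phi>"
    using assms unfolding test_continuous_def by metis
  have "\<bar>u \<phi> + v \<phi>\<bar> \<le> (\<bar>C\<bar> + \<bar>D\<bar>) * test_norm (max m n) \<phi>" for \<phi>
  proof -
    have "C * test_norm m \<phi> \<le> \<bar>C\<bar> * test_norm (max m n) \<phi>"
      by (intro mult_mono) (auto simp: test_norm_nonneg test_norm_mono)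
    moreover have "D * test_norm n \<phi> \<le> \<bar>D\<bar> * test_norm (max m n) \<phi>"
      by (intro mult_mono) (auto simp: test_norm_nonneg test_norm_mono)
    ultimately show ?thesis
      using C[of \<phi>] D[of \<phi>] abs_triangle_ineq[of "u \<phi>" "v \<phi>"] unfolding distrib_right by linarith
  qed
  then show ?thesis unfolding test_continuous_def by (intro exI allI)
qed

lemma test_continuous_cmult:
  assumes "test_continuous u"
  shows "test_continuous (\<lambda>\<phi>. c * u \<phi>)"
proof -
  obtain C n where C: "\<And>\<phi>. \<bar>u \<phi>\<bar> \<le> C * test_norm n \<phi>"
    using assms unfolding test_continuous_def by metis
  have "\<bar>c * u \<phi>\<bar> \<le> (\<bar>c\<bar> * C) * test_norm n \<phi>" for \<phi>
    using mult_left_mono[OF C[of \<phi>], of "\<bar>c\<bar>"] by (simp add: abs_mult mult.assoc)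
  then show ?thesis unfolding test_continuous_def by (intro exI allI)
qed

lemma linear_cmult:
  fixes u :: "'a::real_vector \<Rightarrow> real"
  assumes "linear u"
  shows "linear (\<lambda>x. c * u x)"
  using linear_compose_scale_right[OF assms, of c] by simp

typedef torus_distr = "{u :: torus_test \<Rightarrow> real. linear u \<and> test_continuous u}"
  morphisms pairing Abs_torus_distr
proof
  show "(\<lambda>\<phi>. 0) \<in> {u :: torus_test \<Rightarrow> real. linear u \<and> test_continuous u}"
    using test_continuous_zero linear_zero by blast
qed

instantiation torus_distr :: real_vector
begin

definition zero_torus_distr :: torus_distr where
  "0 = Abs_torus_distr (\<lambda>\<phi>. 0)"

definition plus_torus_distr :: "torus_distr \<Rightarrow> torus_distr \<Rightarrow> torus_distr" where
  "u + v = Abs_torus_distr (\<lambda>\<phi>. pairing u \<phi> + pairing v \<phi>)"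

definition scaleR_torus_distr :: "real \<Rightarrow> torus_distr \<Rightarrow> torus_distr" where
  "c *\<^sub>R u = Abs_torus_distr (\<lambda>\<phi>. c * pairing u \<phi>)"

definition uminus_torus_distr :: "torus_distr \<Rightarrow> torus_distr" where
  "- u = (- 1) *\<^sub>R (u :: torus_distr)"

definition minus_torus_distr :: "torus_distr \<Rightarrow> torus_distr \<Rightarrow> torus_distr" where
  "u - v = u + - (v :: torus_distr)"

lemma linear_pairing: "linear (pairing u)"
  and test_continuous_pairing: "test_continuous (pairing u)"
  using pairing[of u] by auto

lemma pairing_zero: "pairing 0 \<phi> = 0"
  unfolding zero_torus_distr_def
  by (subst Abs_torus_distr_inverse) (auto intro: linear_zero test_continuous_zero)

lemma pairing_add: "pairing (u + v) \<phi> = pairing u \<phi> + pairing v \<phi>"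
  unfolding plus_torus_distr_def
  by (subst Abs_torus_distr_inverse)
    (auto intro: linear_compose_add test_continuous_add linear_pairing test_continuous_pairing)

lemma pairing_scaleR: "pairing (c *\<^sub>R u) \<phi> = c * pairing u \<phi>"
  unfolding scaleR_torus_distr_def
  by (subst Abs_torus_distr_inverse)
    (auto intro: linear_cmult test_continuous_cmult linear_pairing test_continuous_pairing)

lemma torus_distr_eqI: "(\<And>\<phi>. pairing u \<phi> = pairing v \<phi>) \<Longrightarrow> u = v"
  by (metis ext pairing_inject)

instance
proof
  fix u v w :: torus_distr and a b :: real
  note pairing_simps = pairing_zero pairing_add pairing_scaleR
  show "u + v + w = u + (v + w)" by (rule torus_distr_eqI) (simp add: pairing_simps)
  show "u + v = v + u" by (rule torus_distr_eqI) (simp add: pairing_simps)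
  show "0 + u = u" by (rule torus_distr_eqI) (simp add: pairing_simps)
  show "- u + u = 0" by (rule torus_distr_eqI) (simp add: pairing_simps uminus_torus_distr_def)
  show "u - v = u + - v" by (rule minus_torus_distr_def)
  show "a *\<^sub>R (u + v) = a *\<^sub>R u + a *\<^sub>R v"
    by (rule torus_distr_eqI) (simp add: pairing_simps distrib_left)
  show "(a + b) *\<^sub>R u = a *\<^sub>R u + b *\<^sub>R u"
    by (rule torus_distr_eqI) (simp add: pairing_simps distrib_right)
  show "a *\<^sub>R b *\<^sub>R u = (a * b) *\<^sub>R u" by (rule torus_distr_eqI) (simp add: pairing_simps)
  show "1 *\<^sub>R u = u" by (rule torus_distr_eqI) (simp add: pairing_simps)
qed

end

definition distr_of_fun :: "(plane \<Rightarrow> real) \<Rightarrow> torus_distr" where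
  "distr_of_fun f =
     Abs_torus_distr (\<lambda>\<phi>. set_lebesgue_integral lborel unit_square (\<lambda>x. f x * test_eval \<phi> x))"

definition test_diff :: "plane \<Rightarrow> torus_test \<Rightarrow> torus_test" where
  "test_diff b \<phi> = Abs_torus_test (pdiff b (test_eval \<phi>))"

definition distr_diff :: "plane \<Rightarrow> torus_distr \<Rightarrow> torus_distr" where
  "distr_diff b u = Abs_torus_distr (\<lambda>\<phi>. - pairing u (test_diff b \<phi>))"

definition laplacian :: "torus_distr \<Rightarrow> torus_distr" where
  "laplacian u = (\<Sum>b\<in>Basis. distr_diff b (distr_diff b u))"

definition divergence :: "torus_distr \<times> torus_distr \<Rightarrow> torus_distr" where
  "divergence V = distr_diff (1, 0) (fst V) + distr_diff (0, 1) (snd V)"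

section \<open>Fourier coefficients, Sobolev spaces and Fourier multipliers\<close>

type_synonym freq = "int \<times> int"

definition phase :: "freq \<Rightarrow> plane \<Rightarrow> real" where
  "phase k x = 2 * pi * (of_int (fst k) * fst x + of_int (snd k) * snd x)"

definition freq_sq :: "freq \<Rightarrow> real" where
  "freq_sq k = (of_int (fst k))\<^sup>2 + (of_int (snd k))\<^sup>2"

text \<open>The pairing of \<open>u\<close> with \<open>exp (- \<i> * phase k x)\<close>, by real and imaginary part.\<close>

definition fourier :: "torus_distr \<Rightarrow> freq \<Rightarrow> complex" where
  "fourier u k = Complex (pairing u (Abs_torus_test (\<lambda>x. cos (phase k x))))
                         (- pairing u (Abs_torus_test (\<lambda>x. sin (phase k x))))"

text \<open>
  A distribution on the torus is determined by its Fourier coefficients. The description below is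
  meant for families \<open>c\<close> of polynomial growth with \<open>c (- k) = cnj (c k)\<close>, which are exactly the
  families of coefficients of real distributions.
\<close>

definition distr_of_coeffs :: "(freq \<Rightarrow> complex) \<Rightarrow> torus_distr" where
  "distr_of_coeffs c = (THE u. fourier u = c)"

definition Sobolev :: "real \<Rightarrow> torus_distr set" where
  "Sobolev s = {u. (\<lambda>k. (1 + freq_sq k) powr s * (cmod (fourier u k))\<^sup>2) summable_on UNIV}"

definition Sobolev_norm :: "real \<Rightarrow> torus_distr \<Rightarrow> real" where
  "Sobolev_norm s u = sqrt (\<Sum>\<^sub>\<infinity>k. (1 + freq_sq k) powr s * (cmod (fourier u k))\<^sup>2)"

definition fourier_multiplier :: "(freq \<Rightarrow> complex) \<Rightarrow> torus_distr \<Rightarrow> torus_distr" where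
  "fourier_multiplier m u = distr_of_coeffs (\<lambda>k. m k * fourier u k)"

definition heat :: "real \<Rightarrow> torus_distr \<Rightarrow> torus_distr" where
  "heat t = fourier_multiplier (\<lambda>k. of_real (exp (- (4 * pi\<^sup>2 * freq_sq k * t))))"

text \<open>
  The multiplier of the Biot-Savart kernel. At \<open>k = 0\<close> it vanishes, since \<open>x / 0 = 0\<close>. The two
  lemmas say that the resulting field is divergence-free and has the prescribed curl
  \<open>\<partial>\<^sub>1 V\<^sub>2 - \<partial>\<^sub>2 V\<^sub>1\<close>; differentiation in the \<open>j\<close>-th direction has the symbol \<open>2 * pi * \<i> * k\<^sub>j\<close>.
\<close>

definition BS_symbol1 :: "freq \<Rightarrow> complex" where
  "BS_symbol1 k = \<i> * of_int (snd k) / of_real (2 * pi * freq_sq k)"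

definition BS_symbol2 :: "freq \<Rightarrow> complex" where
  "BS_symbol2 k = - \<i> * of_int (fst k) / of_real (2 * pi * freq_sq k)"

lemma BS_symbol_divergence:
  "2 * pi * \<i> * of_int (fst k) * BS_symbol1 k + 2 * pi * \<i> * of_int (snd k) * BS_symbol2 k = 0"
  by (simp add: BS_symbol1_def BS_symbol2_def)

lemma BS_symbol_curl:
  assumes "k \<noteq> 0"
  shows "2 * pi * \<i> * of_int (fst k) * BS_symbol2 k - 2 * pi * \<i> * of_int (snd k) * BS_symbol1 k = 1"
proof -
  have "freq_sq k \<noteq> 0"
    using assms by (auto simp: freq_sq_def prod_eq_iff sum_power2_eq_zero_iff)
  have *: "2 * pi * \<i> * a * (- \<i> * a / (2 * pi * q)) - 2 * pi * \<i> * b * (\<i> * b / (2 * pi * q))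
      = (a\<^sup>2 + b\<^sup>2) / q" if "q \<noteq> 0" for a b q :: complex
    using that by (simp add: field_simps power2_eq_square)
  have "2 * pi * \<i> * of_int (fst k) * BS_symbol2 k - 2 * pi * \<i> * of_int (snd k) * BS_symbol1 k
      = ((of_int (fst k))\<^sup>2 + (of_int (snd k))\<^sup>2) / of_real (freq_sq k)"
    using *[of "of_real (freq_sq k)" "of_int (fst k)" "of_int (snd k)"] \<open>freq_sq k \<noteq> 0\<close>
    by (simp add: BS_symbol1_def BS_symbol2_def)
  also have "\<dots> = of_real (freq_sq k) / of_real (freq_sq k)"
    by (simp add: freq_sq_def)
  also have "\<dots> = 1" using \<open>freq_sq k \<noteq> 0\<close> by simp
  finally show ?thesis .
qed

definition biot_savart :: "torus_distr \<Rightarrow> torus_distr \<times> torus_distr" where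
  "biot_savart u = (fourier_multiplier BS_symbol1 u, fourier_multiplier BS_symbol2 u)"

text \<open>
  The product of two distributions, when the Fourier convolution converges absolutely and has
  polynomial growth. This is so for \<open>f\<close> in \<open>Sobolev r\<close> and \<open>g\<close> in \<open>Sobolev s\<close> with \<open>r + s \<ge> 0\<close>;
  on square integrable functions it is the pointwise product.
\<close>

definition distr_mult :: "torus_distr \<Rightarrow> torus_distr \<Rightarrow> torus_distr" where
  "distr_mult f g = distr_of_coeffs (\<lambda>k. \<Sum>\<^sub>\<infinity>j. fourier f (k - j) * fourier g j)"

text \<open>\<open>V \<cdot> \<nabla>f\<close> for divergence-free \<open>V\<close>, in divergence form.\<close>

definition advect :: "torus_distr \<times> torus_distr \<Rightarrow> torus_distr \<Rightarrow> torus_distr" where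
  "advect V f = divergence (distr_mult (fst V) f, distr_mult (snd V) f)"

section \<open>Function spaces in time\<close>

text \<open>
  Paths are total functions on the reals; outside \<open>{0..T}\<close> they are set to \<open>0\<close>, so that equality of
  paths is equality on \<open>{0..T}\<close>.
\<close>

definition C0_Sobolev :: "real \<Rightarrow> real \<Rightarrow> (real \<Rightarrow> torus_distr) set" where
  "C0_Sobolev T s = {y. (\<forall>t. t \<notin> {0..T} \<longrightarrow> y t = 0) \<and> (\<forall>t\<in>{0..T}. y t \<in> Sobolev s) \<and>
     (\<forall>t\<in>{0..T}. ((\<lambda>r. Sobolev_norm s (y r - y t)) \<longlongrightarrow> 0) (at t within {0..T}))}"

definition C0_norm :: "real \<Rightarrow> real \<Rightarrow> (real \<Rightarrow> torus_distr) \<Rightarrow> real" where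
  "C0_norm T s y = (SUP t\<in>{0..T}. Sobolev_norm s (y t))"

text \<open>The integral of a distribution-valued function, in the weak (Gelfand-Pettis) sense.\<close>

definition has_distr_integral ::
    "(real \<Rightarrow> torus_distr) \<Rightarrow> torus_distr \<Rightarrow> real set \<Rightarrow> bool" where
  "has_distr_integral g I A \<longleftrightarrow>
     (\<forall>\<phi>. set_integrable lborel A (\<lambda>s. pairing (g s) \<phi>) \<and>
          set_lebesgue_integral lborel A (\<lambda>s. pairing (g s) \<phi>) = pairing I \<phi>)"

definition bounded_linear_C0 ::
    "real \<Rightarrow> real \<Rightarrow> ((real \<Rightarrow> torus_distr) \<Rightarrow> real \<Rightarrow> torus_distr) \<Rightarrow> bool" where
  "bounded_linear_C0 T s S \<longleftrightarrow>
     (\<forall>z\<in>C0_Sobolev T s. S z \<in> C0_Sobolev T s) \<and>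
     (\<forall>z\<in>C0_Sobolev T s. \<forall>w\<in>C0_Sobolev T s. S (\<lambda>t. z t + w t) = (\<lambda>t. S z t + S w t)) \<and>
     (\<forall>c. \<forall>z\<in>C0_Sobolev T s. S (\<lambda>t. c *\<^sub>R z t) = (\<lambda>t. c *\<^sub>R S z t)) \<and>
     (\<exists>B. \<forall>z\<in>C0_Sobolev T s. C0_norm T s (S z) \<le> B * C0_norm T s z)"

section \<open>The equations\<close>

definition L2_torus :: "(plane \<Rightarrow> real) \<Rightarrow> bool" where
  "L2_torus f \<longleftrightarrow> periodic f \<and> f \<in> borel_measurable lborel \<and>
     set_integrable lborel unit_square (\<lambda>x. (f x)\<^sup>2)"

definition L2_torus_norm :: "(plane \<Rightarrow> real) \<Rightarrow> real" where
  "L2_torus_norm f = sqrt (set_lebesgue_integral lborel unit_square (\<lambda>x. (f x)\<^sup>2))"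

text \<open>
  Solutions of the two-dimensional Navier-Stokes equation in vorticity form with initial datum in
  the space of square integrable functions, in the usual class \<open>C([0,T]; L\<^sup>2) \<inter> L\<^sup>2([0,T]; H\<^sup>1)\<close>, in
  which they exist and are unique; \<open>Sobolev 0\<close> is the space of square integrable functions. The
  equation holds in the sense of distributions. For paths in \<open>C([0,T]; L\<^sup>2)\<close> all terms are weakly
  continuous in time, so the time derivative exists classically after pairing with a test function.
\<close>

definition vorticity_solution :: "real \<Rightarrow> (plane \<Rightarrow> real) \<Rightarrow> (real \<Rightarrow> torus_distr) \<Rightarrow> bool" where
  "vorticity_solution T \<xi>0 \<xi> \<longleftrightarrow>
     \<xi> \<in> C0_Sobolev T 0 \<and>
     (AE t in lborel. t \<in> {0..T} \<longrightarrow> \<xi> t \<in> Sobolev 1) \<and>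
     set_integrable lborel {0..T} (\<lambda>t. (Sobolev_norm 1 (\<xi> t))\<^sup>2) \<and>
     \<xi> 0 = distr_of_fun \<xi>0 \<and>
     (\<forall>t\<in>{0..T}. \<forall>\<phi>.
        ((\<lambda>r. pairing (\<xi> r) \<phi>) has_real_derivative
           pairing (laplacian (\<xi> t) - advect (biot_savart (\<xi> t)) (\<xi> t)) \<phi>) (at t within {0..T}))"

definition mild_solution ::
    "real \<Rightarrow> (real \<Rightarrow> torus_distr) \<Rightarrow> (real \<Rightarrow> torus_distr) \<Rightarrow> (real \<Rightarrow> torus_distr) \<Rightarrow> bool" where
  "mild_solution T \<xi> z y \<longleftrightarrow>
     (\<forall>t\<in>{0..T}. \<exists>I.
        has_distr_integral
          (\<lambda>s. heat (t - s) (advect (biot_savart (y s)) (\<xi> s) + advect (biot_savart (\<xi> s)) (y s)))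
          I {0..t} \<and>
        y t = - I + z t)"

definition solution_map ::
    "real \<Rightarrow> real \<Rightarrow> (real \<Rightarrow> torus_distr) \<Rightarrow> (real \<Rightarrow> torus_distr) \<Rightarrow> real \<Rightarrow> torus_distr" where
  "solution_map T \<sigma> \<xi> z = (THE y. y \<in> C0_Sobolev T \<sigma> \<and> mild_solution T \<xi> z y)"

end

theory Submission
  imports Defs
begin

text \<open>
  The proof works with Fourier coefficients throughout. A distribution on the torus is the same thing as a
  family of coefficients of polynomial growth with \<open>c (- k) = cnj (c k)\<close> (lemmas \<open>fourier_inject\<close> and
  \<open>tempered_imp_distr\<close>; they rest on the convergence of the Fourier series of a test function in all the norms
  of test functions, \<open>pairing_has_sum\<close>). Under this identification \<open>(K * u) \<cdot> \<nabla>v\<close> becomes the convolution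
  \<open>adv\<close> with the real symbol \<open>(k\<^sub>1 j\<^sub>2 - k\<^sub>2 j\<^sub>1) / |k - j|\<^sup>2\<close>, and the mild equation becomes a family of
  scalar Volterra equations, one for each frequency, coupled by \<open>adv\<close>.

  The equation for \<open>y\<close> is linear, so everything follows from one estimate. Write \<open>\<sigma> = \<beta> - 1\<close> and let \<open>G\<close> be
  one of the products \<open>(K * y) \<xi>\<close>, \<open>(K * \<xi>) y\<close>, whose divergence enters the equation. The first ingredient is
  the product estimate \<open>\<parallel>G\<parallel>\<^sub>\<sigma> \<le> C \<parallel>\<xi>\<parallel>\<^sub>1 \<parallel>y\<parallel>\<^sub>\<sigma>\<close> for \<open>- 1 < \<sigma> \<le> 0\<close> (\<open>bconv_neg_H1\<close>, \<open>bconv_H1_neg\<close>), a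
  Cauchy-Schwarz inequality for convolutions whose kernel has rows bounded in square sum because
  \<open>\<Sum>k. (1 + |k|\<^sup>2) powr - (1 + \<beta>)\<close> is finite. The second is that the heat semigroup gains exactly the one
  derivative lost by the divergence if time is measured in the square mean: by Cauchy-Schwarz in time at
  each frequency (\<open>heat_kernel_L2\<close>), the integral term at time \<open>t\<close> has square norm at most
  \<open>bil_const * \<integral>\<^sub>0\<^sup>t \<parallel>\<xi>\<^sub>s\<parallel>\<^sub>1\<^sup>2 \<parallel>y\<^sub>s\<parallel>\<^sub>\<sigma>\<^sup>2 ds\<close> (\<open>duhamel_hs\<close>). There is no loss of an epsilon in either step, and
  this is why the square of the size of the initial datum, and no higher power, appears in the exponent.

  If the square norm at time \<open>t\<close> is divided by \<open>exp (4 * bil_const * \<integral>\<^sub>0\<^sup>t \<parallel>\<xi>\<parallel>\<^sub>1\<^sup>2)\<close>, the integral term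
  is therefore a contraction with factor one half (\<open>duhamel_weighted\<close>). This gives existence by a Neumann
  series (\<open>solves_exists\<close>), uniqueness, and the bound of the solution by
  \<open>2 * exp (2 * bil_const * \<integral>\<^sub>0\<^sup>T \<parallel>\<xi>\<parallel>\<^sub>1\<^sup>2)\<close> times the norm of \<open>z\<close> (\<open>apriori_bound\<close>).

  It remains to bound \<open>\<integral>\<^sub>0\<^sup>T \<parallel>\<xi>\<parallel>\<^sub>1\<^sup>2\<close> by \<open>(1 + T) \<parallel>\<xi>\<^sub>0\<parallel>\<^sup>2\<close> (\<open>vorticity_H1_bound\<close>). This is the energy
  estimate for the vorticity equation. For a solution that is only known to be in \<open>C L\<^sup>2 \<inter> L\<^sup>2 H\<^sup>1\<close> it is
  obtained by differentiating the square modulus of each coefficient and summing over finite sets of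
  frequencies; the transport term drops out in the limit, because the symbol of \<open>adv\<close> is antisymmetric in
  \<open>k\<close> and \<open>j\<close> (\<open>adv_no_work\<close>). Bessel's inequality bounds the initial energy (\<open>Bessel_L2_torus\<close>).
\<close>

section \<open>Trigonometric test functions\<close>

lemma pdiffI: "(f has_derivative D) (at x) \<Longrightarrow> pdiff b f x = D b"
  unfolding pdiff_def using frechet_derivative_at by metis

lemma bounded_linear_phase: "bounded_linear (phase k)"
proof -
  have "phase k = (\<lambda>x. (2 * pi * of_int (fst k)) * fst x + (2 * pi * of_int (snd k)) * snd x)"
    by (auto simp: phase_def algebra_simps)
  moreover have "bounded_linear (\<lambda>x :: plane. a * fst x + b * snd x)" for a b :: real
    by (intro bounded_linear_add bounded_linear_const_mult bounded_linear_fst bounded_linear_snd)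
  ultimately show ?thesis by simp
qed

lemma phase_has_derivative: "(phase k has_derivative phase k) F"
  by (rule bounded_linear_imp_has_derivative[OF bounded_linear_phase])

lemma continuous_on_phase [continuous_intros]: "continuous_on S f \<Longrightarrow> continuous_on S (\<lambda>x. phase k (f x))"
  by (rule bounded_linear.continuous_on[OF bounded_linear_phase])

lemma trig_has_derivative:
  "((\<lambda>x. cos (phase k x)) has_derivative (\<lambda>h. - (phase k h * sin (phase k x)))) (at x)"
  "((\<lambda>x. sin (phase k x)) has_derivative (\<lambda>h. phase k h * cos (phase k x))) (at x)"
  using has_derivative_cos[OF phase_has_derivative[of k "at x"]] has_derivative_sin[OF phase_has_derivative[of k "at x"]]
  by simp_all

lemma pdiff_cos: "pdiff b (\<lambda>x. cos (phase k x)) = (\<lambda>x. - phase k b * sin (phase k x))"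
  using pdiffI[OF trig_has_derivative(1), where b = b] by (intro ext) (simp only: mult_minus_left)

lemma pdiff_sin: "pdiff b (\<lambda>x. sin (phase k x)) = (\<lambda>x. phase k b * cos (phase k x))"
  using pdiffI[OF trig_has_derivative(2), where b = b] by (intro ext)

lemma trig_differentiable:
  "(\<lambda>x. cos (phase k x)) differentiable (at x)" "(\<lambda>x. sin (phase k x)) differentiable (at x)"
  using trig_has_derivative[of k x] unfolding differentiable_def by blast+

lemma Ck_trig: "Ck n (\<lambda>x. cos (phase k x)) \<and> Ck n (\<lambda>x. sin (phase k x))"
proof (induction n)
  case 0
  show ?case by (auto intro!: continuous_intros)
next
  case (Suc n)
  have "Ck n (\<lambda>x. - phase k b * sin (phase k x))" "Ck n (\<lambda>x. phase k b * cos (phase k x))" for b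
    by (rule Ck_cmult[OF conjunct2[OF Suc]] Ck_cmult[OF conjunct1[OF Suc]])+
  then show ?case
    unfolding Ck.simps pdiff_cos pdiff_sin using trig_differentiable by blast
qed

lemma phase_shift:
  "phase k (x + (of_int m, of_int n)) = phase k x + of_int (2 * (fst k * m + snd k * n)) * pi"
  by (simp add: phase_def algebra_simps)

lemma trig_shift:
  "cos (phase k (x + (of_int m, of_int n))) = cos (phase k x)"
  "sin (phase k (x + (of_int m, of_int n))) = sin (phase k x)"
proof -
  have c: "cos (of_int (2 * j) * pi) = (1::real)" and s: "sin (of_int (2 * j) * pi) = (0::real)" for j
    using cos_int_2pin[of j] sin_int_2pin[of j] by (simp_all only: of_int_mult of_int_numeral mult.assoc mult.commute[of _ pi] mult.left_commute[of 2])
  show "cos (phase k (x + (of_int m, of_int n))) = cos (phase k x)"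
    "sin (phase k (x + (of_int m, of_int n))) = sin (phase k x)"
    unfolding phase_shift cos_add sin_add c s by simp_all
qed

definition cos_test :: "freq \<Rightarrow> torus_test" where
  "cos_test k = Abs_torus_test (\<lambda>x. cos (phase k x))"

definition sin_test :: "freq \<Rightarrow> torus_test" where
  "sin_test k = Abs_torus_test (\<lambda>x. sin (phase k x))"

lemma eval_cos_test: "test_eval (cos_test k) = (\<lambda>x. cos (phase k x))"
  unfolding cos_test_def
  by (rule Abs_torus_test_inverse) (simp only: periodic_def trig_shift Ck_trig mem_Collect_eq simp_thms)

lemma eval_sin_test: "test_eval (sin_test k) = (\<lambda>x. sin (phase k x))"
  unfolding sin_test_def
  by (rule Abs_torus_test_inverse) (simp only: periodic_def trig_shift Ck_trig mem_Collect_eq simp_thms)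

lemma fourier_tests: "fourier u k = Complex (pairing u (cos_test k)) (- pairing u (sin_test k))"
  unfolding fourier_def cos_test_def sin_test_def ..

lemma torus_test_eqI: "(\<And>x. test_eval \<phi> x = test_eval \<psi> x) \<Longrightarrow> \<phi> = \<psi>"
  by (metis ext test_eval_inject)

lemma eval_add: "test_eval (\<phi> + \<psi>) x = test_eval \<phi> x + test_eval \<psi> x"
  by (simp add: plus_torus_test.rep_eq)

lemma eval_scaleR: "test_eval (c *\<^sub>R \<phi>) x = c * test_eval \<phi> x"
  by (simp add: scaleR_torus_test.rep_eq)

lemma eval_uminus: "test_eval (- \<phi>) x = - test_eval \<phi> x"
  unfolding uminus_torus_test_def eval_scaleR by simp

lemma eval_diff: "test_eval (\<phi> - \<psi>) x = test_eval \<phi> x - test_eval \<psi> x"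
  unfolding minus_torus_test_def eval_add eval_uminus by simp

lemma eval_zero: "test_eval 0 x = 0"
  by (simp add: zero_torus_test.rep_eq)

lemma eval_sum: "test_eval (\<Sum>i\<in>I. f i) x = (\<Sum>i\<in>I. test_eval (f i) x)"
  by (induction I rule: infinite_finite_induct) (simp_all add: eval_zero eval_add)

lemma eval_differentiable: "test_eval \<phi> differentiable (at x)"
  using Ck_test_eval[of "Suc 0" \<phi>] unfolding Ck.simps by blast

lemma eval_continuous: "continuous_on S (test_eval \<phi>)"
  using Ck_test_eval[of 0 \<phi>] by (auto intro: continuous_on_subset)

lemma eval_periodic: "test_eval \<phi> (x + (of_int m, of_int n)) = test_eval \<phi> x"
  using test_eval[of \<phi>] unfolding periodic_def by blast

lemma pdiff_periodic:
  assumes "periodic f" "\<And>x. f differentiable (at x)"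
  shows "periodic (pdiff b f)"
  unfolding periodic_def
proof (intro allI)
  fix x m n
  let ?v = "(of_int m, of_int n) :: plane"
  have "(f has_derivative frechet_derivative f (at (x + ?v))) (at (x + ?v))"
    using assms(2) frechet_derivative_works by blast
  then have "((\<lambda>y. f (y + ?v)) has_derivative frechet_derivative f (at (x + ?v))) (at x)"
    by (rule has_derivative_compose[where f = "\<lambda>y. y + ?v", rotated])
      (auto intro!: derivative_eq_intros)
  moreover have "(\<lambda>y. f (y + ?v)) = f"
    using assms(1) by (simp add: periodic_def fun_eq_iff)
  ultimately have "(f has_derivative frechet_derivative f (at (x + ?v))) (at x)" by simp
  then show "pdiff b f (x + ?v) = pdiff b f x"
    using pdiffI[of f _ x b] by (simp add: pdiff_def)
qed

lemma eval_test_diff: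
  assumes "b \<in> Basis"
  shows "test_eval (test_diff b \<phi>) = pdiff b (test_eval \<phi>)"
  unfolding test_diff_def
proof (rule Abs_torus_test_inverse, intro CollectI conjI allI)
  show "periodic (pdiff b (test_eval \<phi>))"
    using test_eval[of \<phi>] by (intro pdiff_periodic eval_differentiable) auto
  show "Ck n (pdiff b (test_eval \<phi>))" for n
    using Ck_test_eval[of "Suc n" \<phi>] assms by auto
qed

lemma test_diff_add:
  "b \<in> Basis \<Longrightarrow> test_diff b (\<phi> + \<psi>) = test_diff b \<phi> + test_diff b \<psi>"
  by (rule torus_test_eqI)
    (simp add: eval_test_diff eval_add plus_torus_test.rep_eq pdiff_add eval_differentiable)

lemma test_diff_scaleR: "b \<in> Basis \<Longrightarrow> test_diff b (c *\<^sub>R \<phi>) = c *\<^sub>R test_diff b \<phi>"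
  by (rule torus_test_eqI)
    (simp add: eval_test_diff eval_scaleR scaleR_torus_test.rep_eq pdiff_cmult eval_differentiable)

lemma linear_test_diff: "b \<in> Basis \<Longrightarrow> linear (test_diff b)"
  by (rule linearI) (simp_all add: test_diff_add test_diff_scaleR)

lemma test_diff_cos: "b \<in> Basis \<Longrightarrow> test_diff b (cos_test k) = (- phase k b) *\<^sub>R sin_test k"
  by (rule torus_test_eqI) (simp add: eval_test_diff eval_scaleR eval_uminus eval_cos_test eval_sin_test pdiff_cos)

lemma test_diff_sin: "b \<in> Basis \<Longrightarrow> test_diff b (sin_test k) = phase k b *\<^sub>R cos_test k"
  by (rule torus_test_eqI) (simp add: eval_test_diff eval_scaleR eval_cos_test eval_sin_test pdiff_sin)

subsection \<open>The norms of test functions\<close>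

definition test_sup :: "torus_test \<Rightarrow> real" where
  "test_sup \<phi> = (SUP x\<in>unit_square. \<bar>test_eval \<phi> x\<bar>)"

lemma square_nonempty: "(0, 0) \<in> unit_square"
  by (simp add: cbox_Pair_eq)

lemma le_test_sup:
  assumes "x \<in> unit_square"
  shows "\<bar>test_eval \<phi> x\<bar> \<le> test_sup \<phi>"
proof -
  have "compact ((\<lambda>x. \<bar>test_eval \<phi> x\<bar>) ` unit_square)"
    by (intro compact_continuous_image continuous_intros eval_continuous compact_cbox)
  then have "bdd_above ((\<lambda>x. \<bar>test_eval \<phi> x\<bar>) ` unit_square)"
    by (intro bounded_imp_bdd_above compact_imp_bounded)
  then show ?thesis unfolding test_sup_def using assms by (rule cSUP_upper[rotated])
qed

lemma test_sup_le: "(\<And>x. x \<in> unit_square \<Longrightarrow> \<bar>test_eval \<phi> x\<bar> \<le> M) \<Longrightarrow> test_sup \<phi> \<le> M"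
  unfolding test_sup_def by (rule cSUP_least) (use square_nonempty in blast)+

lemma test_sup_nonneg: "0 \<le> test_sup \<phi>"
  using le_test_sup[OF square_nonempty, of \<phi>] by linarith

lemma test_norm_0: "test_norm 0 \<phi> = test_sup \<phi>"
  by (simp add: test_norm_def test_sup_def)

lemma test_norm_Suc: "test_norm (Suc n) \<phi> = test_sup \<phi> + (\<Sum>b\<in>Basis. test_norm n (test_diff b \<phi>))"
  by (simp add: test_norm_def test_sup_def eval_test_diff)

lemma test_norm_test_diff: "b \<in> Basis \<Longrightarrow> test_norm n (test_diff b \<phi>) \<le> test_norm (Suc n) \<phi>"
  unfolding test_norm_Suc
  using member_le_sum[of b Basis "\<lambda>b. test_norm n (test_diff b \<phi>)"] test_sup_nonneg[of \<phi>]
  by (simp add: test_norm_nonneg)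

lemma test_norm_scaleR_le: "test_norm n (c *\<^sub>R \<phi>) \<le> \<bar>c\<bar> * test_norm n \<phi>"
proof (induction n arbitrary: \<phi>)
  have sup: "test_sup (c *\<^sub>R \<phi>) \<le> \<bar>c\<bar> * test_sup \<phi>" for \<phi>
    by (intro test_sup_le) (simp add: eval_scaleR abs_mult mult_left_mono le_test_sup)
  {
    case 0
    then show ?case using sup by (simp add: test_norm_0)
  next
    case (Suc n)
    have "(\<Sum>b\<in>Basis. test_norm n (test_diff b (c *\<^sub>R \<phi>))) \<le> (\<Sum>b\<in>Basis. \<bar>c\<bar> * test_norm n (test_diff b \<phi>))"
      by (intro sum_mono) (simp add: test_diff_scaleR Suc.IH)
    with sup[of \<phi>] show ?case
      unfolding test_norm_Suc distrib_left sum_distrib_left by (rule add_mono)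
  }
qed

text \<open>
  Each derivative of a trigonometric function costs one factor of the frequency, hence the
  coefficients of a distribution grow at most polynomially.
\<close>

lemma test_norm_trig:
  defines "w \<equiv> \<lambda>k. \<Sum>b\<in>Basis. \<bar>phase k b\<bar>"
  shows "test_norm n (cos_test k) \<le> (1 + w k) ^ n \<and> test_norm n (sin_test k) \<le> (1 + w k) ^ n"
proof (induction n)
  have sup: "test_sup (cos_test k) \<le> 1" "test_sup (sin_test k) \<le> 1"
    by (intro test_sup_le; simp add: eval_cos_test eval_sin_test)+
  have w: "0 \<le> w k" unfolding w_def by (simp add: sum_nonneg)
  {
    case 0
    then show ?case using sup by (simp add: test_norm_0)
  next
    case (Suc n)
    have "test_norm n (test_diff b \<phi>) \<le> \<bar>phase k b\<bar> * (1 + w k) ^ n"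
      if "b \<in> Basis" "\<phi> \<in> {cos_test k, sin_test k}" for b \<phi>
    proof -
      obtain \<psi> c where "test_diff b \<phi> = c *\<^sub>R \<psi>" "\<bar>c\<bar> = \<bar>phase k b\<bar>" "\<psi> \<in> {cos_test k, sin_test k}"
        using \<open>\<phi> \<in> _\<close> test_diff_cos[OF \<open>b \<in> Basis\<close>] test_diff_sin[OF \<open>b \<in> Basis\<close>]
        by (metis abs_minus_cancel insertCI insertE singletonD)
      moreover have "test_norm n \<psi> \<le> (1 + w k) ^ n"
        using calculation(3) Suc.IH by auto
      ultimately show ?thesis
        using test_norm_scaleR_le[of n c \<psi>] mult_left_mono[of "test_norm n \<psi>" "(1 + w k) ^ n" "\<bar>c\<bar>"]
        by simp
    qed
    then have "(\<Sum>b\<in>Basis. test_norm n (test_diff b \<phi>)) \<le> w k * (1 + w k) ^ n"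
      if "\<phi> \<in> {cos_test k, sin_test k}" for \<phi>
      unfolding w_def sum_distrib_right using that by (intro sum_mono) (simp add: w_def)
    moreover have "1 \<le> (1 + w k) ^ n" using w by simp
    ultimately show ?case
      using sup by (auto simp: test_norm_Suc distrib_right intro!: add_mono order_trans[OF sup(1)] order_trans[OF sup(2)])
  }
qed

lemma Basis_plane: "(Basis :: plane set) = {(1, 0), (0, 1)}"
  by (auto simp: Basis_prod_def)

lemma sum_Basis_plane: "(\<Sum>b\<in>(Basis :: plane set). f b) = f (1, 0) + f (0, 1)"
  by (simp add: Basis_plane)

text \<open>
  The square of the Japanese bracket of the frequency; its powers are the Sobolev weights.
\<close>

definition jap :: "freq \<Rightarrow> real" where
  "jap k = 1 + freq_sq k"

lemma freq_sq_nonneg: "0 \<le> freq_sq k" by (simp add: freq_sq_def)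
lemma jap_ge1: "1 \<le> jap k" by (simp add: jap_def freq_sq_def)
lemma jap_pos: "0 < jap k" using jap_ge1[of k] by linarith

lemma fourier_growth: "\<exists>C N. \<forall>k. cmod (fourier u k) \<le> C * jap k ^ N"
proof -
  obtain C n where C: "\<And>\<phi>. \<bar>pairing u \<phi>\<bar> \<le> C * test_norm n \<phi>"
    using test_continuous_pairing[of u] unfolding test_continuous_def by metis
  \<comment> \<open>One derivative costs at most \<open>1 + 2 * pi * (|k\<^sub>1| + |k\<^sub>2|)\<close>, and \<open>20\<close> is any bound of \<open>2 * pi\<close>.\<close>
  have "cmod (fourier u k) \<le> (2 * \<bar>C\<bar> * 20 ^ n) * jap k ^ n" for k
  proof -
    define w where "w = (\<Sum>b\<in>Basis. \<bar>phase k b\<bar>)"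
    have "\<bar>of_int a\<bar> \<le> (of_int a :: real)\<^sup>2" for a :: int
    proof -
      have "\<bar>a\<bar> * 1 \<le> \<bar>a\<bar> * \<bar>a\<bar>" by (cases "a = 0") (simp, intro mult_left_mono, auto)
      then have "\<bar>a\<bar> \<le> a\<^sup>2" by (simp add: power2_eq_square)
      then show ?thesis by (metis of_int_abs of_int_le_iff of_int_power)
    qed
    then have "\<bar>of_int (fst k)\<bar> + \<bar>of_int (snd k)\<bar> \<le> freq_sq k"
      unfolding freq_sq_def by (intro add_mono)
    moreover have "w = 2 * pi * (\<bar>of_int (fst k)\<bar> + \<bar>of_int (snd k)\<bar>)"
      by (simp add: w_def sum_Basis_plane phase_def abs_mult algebra_simps)
    moreover have "pi < 10" using pi_less_4 by linarith
    ultimately have "w \<le> 20 * freq_sq k"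
      using mult_mono[of "2 * pi" 20 "\<bar>of_int (fst k)\<bar> + \<bar>of_int (snd k)\<bar>" "freq_sq k"] by simp
    then have "1 + w \<le> 20 * jap k" by (simp add: jap_def)
    moreover have "0 \<le> w" by (simp add: w_def sum_nonneg)
    ultimately have w: "(1 + w) ^ n \<le> 20 ^ n * jap k ^ n"
      by (metis add_nonneg_nonneg power_mono power_mult_distrib zero_le_one)
    have p: "\<bar>pairing u \<phi>\<bar> \<le> \<bar>C\<bar> * (20 ^ n * jap k ^ n)" if "test_norm n \<phi> \<le> (1 + w) ^ n" for \<phi>
    proof -
      have "C * test_norm n \<phi> \<le> \<bar>C\<bar> * (20 ^ n * jap k ^ n)"
        using that w by (intro mult_mono) (auto simp: test_norm_nonneg)
      then show ?thesis using C[of \<phi>] by linarith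
    qed
    have "cmod (fourier u k) \<le> \<bar>pairing u (cos_test k)\<bar> + \<bar>pairing u (sin_test k)\<bar>"
      using cmod_le[of "fourier u k"] by (simp add: fourier_tests)
    also have "\<dots> \<le> \<bar>C\<bar> * (20 ^ n * jap k ^ n) + \<bar>C\<bar> * (20 ^ n * jap k ^ n)"
      using test_norm_trig[of n k] by (intro add_mono p) (simp_all add: w_def)
    finally show ?thesis by (simp only: mult_ac mult_2 distrib_right distrib_left)
  qed
  then show ?thesis by blast
qed

lemma phase_uminus: "phase (- k) x = - phase k x"
  by (simp add: phase_def algebra_simps)

lemma pairing_linear: "pairing u (\<phi> + \<psi>) = pairing u \<phi> + pairing u \<psi>"
  "pairing u (c *\<^sub>R \<phi>) = c * pairing u \<phi>" "pairing u (\<phi> - \<psi>) = pairing u \<phi> - pairing u \<psi>"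
  "pairing u (\<Sum>i\<in>I. f i) = (\<Sum>i\<in>I. pairing u (f i))" "pairing u (- \<phi>) = - pairing u \<phi>"
  using linear_pairing[of u] by (simp_all add: linear_add linear_cmul linear_sum linear_diff linear_neg)

lemma trig_test_uminus: "cos_test (- k) = cos_test k" "sin_test (- k) = - sin_test k"
  by (rule torus_test_eqI, simp add: eval_cos_test eval_sin_test eval_uminus phase_uminus)+

lemma fourier_uminus: "fourier u (- k) = cnj (fourier u k)"
  by (simp add: fourier_tests trig_test_uminus pairing_linear complex_eq_iff)

section \<open>Differentiation and Fourier coefficients\<close>

lemma pairing_distr_diff:
  assumes "b \<in> Basis"
  shows "pairing (distr_diff b u) \<phi> = - pairing u (test_diff b \<phi>)"
proof -
  obtain C n where C: "\<And>\<phi>. \<bar>pairing u \<phi>\<bar> \<le> C * test_norm n \<phi>"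
    using test_continuous_pairing[of u] unfolding test_continuous_def by metis
  have "\<bar>- pairing u (test_diff b \<phi>)\<bar> \<le> \<bar>C\<bar> * test_norm (Suc n) \<phi>" for \<phi>
    using C[of "test_diff b \<phi>"] mult_mono[OF abs_ge_self[of C] test_norm_test_diff[OF assms, of n \<phi>]]
    by (simp add: test_norm_nonneg)
  then have "test_continuous (\<lambda>\<phi>. - pairing u (test_diff b \<phi>))"
    unfolding test_continuous_def by blast
  moreover have "linear (\<lambda>\<phi>. - pairing u (test_diff b \<phi>))"
    by (rule linearI) (simp_all add: test_diff_add test_diff_scaleR assms pairing_linear)
  ultimately show ?thesis
    unfolding distr_diff_def by (subst Abs_torus_distr_inverse) auto
qed

lemma fourier_distr_diff:
  assumes "b \<in> Basis"
  shows "fourier (distr_diff b u) k = \<i> * of_real (phase k b) * fourier u k"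
  by (simp add: fourier_tests pairing_distr_diff assms test_diff_cos test_diff_sin pairing_linear
      complex_eq_iff)

lemma fourier_add: "fourier (u + v) k = fourier u k + fourier v k"
  and fourier_scaleR: "fourier (c *\<^sub>R u) k = of_real c * fourier u k"
  and fourier_zero: "fourier 0 k = 0"
  by (simp_all add: fourier_def pairing_add pairing_scaleR pairing_zero complex_eq_iff)

lemma fourier_uminus_distr: "fourier (- u) k = - fourier u k"
  unfolding uminus_torus_distr_def fourier_scaleR by simp

lemma fourier_diff: "fourier (u - v) k = fourier u k - fourier v k"
  unfolding minus_torus_distr_def fourier_add fourier_uminus_distr by simp

lemma fourier_laplacian: "fourier (laplacian u) k = - of_real (4 * pi\<^sup>2 * freq_sq k) * fourier u k"
proof -
  have sq: "\<i> * of_real a * (\<i> * of_real a * z) = - (of_real (a\<^sup>2) * z)" for a z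
    by (simp add: complex_eq_iff power2_eq_square)
  have "fourier (laplacian u) k = - (of_real ((phase k (1, 0))\<^sup>2 + (phase k (0, 1))\<^sup>2) * fourier u k)"
    unfolding laplacian_def sum_Basis_plane fourier_add
    by (simp only: fourier_distr_diff Basis_plane insert_iff sq simp_thms of_real_add distrib_right minus_add_distrib)
  also have "(phase k (1, 0))\<^sup>2 + (phase k (0, 1))\<^sup>2 = 4 * pi\<^sup>2 * freq_sq k"
    by (simp add: phase_def freq_sq_def power_mult_distrib distrib_left)
  finally show ?thesis by simp
qed

lemma fourier_divergence:
  "fourier (divergence (u, v)) k =
     2 * pi * \<i> * of_int (fst k) * fourier u k + 2 * pi * \<i> * of_int (snd k) * fourier v k"
  unfolding divergence_def
  by (simp add: fourier_add fourier_distr_diff Basis_plane phase_def algebra_simps)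

section \<open>Fourier series of test functions\<close>

text \<open>
  Fubini's theorem and the fundamental theorem of calculus in the direction of \<open>b\<close>; the boundary terms cancel
  by periodicity. Applied to products with trigonometric functions this is integration by parts on the torus.
\<close>

lemma integral_Basis_derivative_eq_0:
  assumes "periodic f" and f: "\<And>x. (f has_derivative D x) (at x)"
    and cont: "continuous_on UNIV (\<lambda>x. D x b)" and "b \<in> Basis"
  shows "integral unit_square (\<lambda>x. D x b) = 0"
proof -
  have shift: "f (x + (of_int m, of_int n)) = f x" for x m n
    using assms(1) unfolding periodic_def by blast
  have c: "continuous_on S (\<lambda>x. D x b)" for S using cont continuous_on_subset by blast
  have scale: "D x (h *\<^sub>R v) = h * D x v" for x h v
    using has_derivative_linear[OF f] linear_cmul by fastforce
  from \<open>b \<in> Basis\<close> consider "b = (0, 1)" | "b = (1, 0)" by (auto simp: Basis_plane)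
  then show ?thesis
  proof cases
    case 1
    have "integral (cbox 0 1) (\<lambda>y. D (x, y) b) = 0" for x
    proof -
      have "((\<lambda>y. f (x, y)) has_vector_derivative D (x, y) b) (at y within cbox 0 1)" for y
      proof -
        have "((\<lambda>y. f (x, y)) has_derivative (\<lambda>h. D (x, y) (0, h))) (at y)"
          by (rule has_derivative_compose[OF _ f]) (auto intro!: derivative_eq_intros)
        moreover have "D (x, y) (0, h) = h *\<^sub>R D (x, y) b" for h
          using scale[of "(x, y)" h "(0, 1)"] by (simp add: 1)
        ultimately show ?thesis
          by (simp add: has_vector_derivative_def has_derivative_at_withinI)
      qed
      then have "((\<lambda>y. D (x, y) b) has_integral (f (x, 1) - f (x, 0))) (cbox 0 1)"
        using fundamental_theorem_of_calculus[of 0 1 "\<lambda>y. f (x, y)"] by auto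
      then show ?thesis using shift[of "(x, 0)" 0 1] by (auto dest: integral_unique)
    qed
    then show ?thesis by (simp add: integral_prod_continuous[OF c])
  next
    case 2
    have "integral (cbox 0 1) (\<lambda>x. D (x, y) b) = 0" for y
    proof -
      have "((\<lambda>x. f (x, y)) has_vector_derivative D (x, y) b) (at x within cbox 0 1)" for x
      proof -
        have "((\<lambda>x. f (x, y)) has_derivative (\<lambda>h. D (x, y) (h, 0))) (at x)"
          by (rule has_derivative_compose[OF _ f]) (auto intro!: derivative_eq_intros)
        moreover have "D (x, y) (h, 0) = h *\<^sub>R D (x, y) b" for h
          using scale[of "(x, y)" h "(1, 0)"] by (simp add: 2)
        ultimately show ?thesis
          by (simp add: has_vector_derivative_def has_derivative_at_withinI)
      qed
      then have "((\<lambda>x. D (x, y) b) has_integral (f (1, y) - f (0, y))) (cbox 0 1)"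
        using fundamental_theorem_of_calculus[of 0 1 "\<lambda>x. f (x, y)"] by auto
      then show ?thesis using shift[of "(0, y)" 1 0] by (auto dest: integral_unique)
    qed
    moreover have "continuous_on (cbox (0, 0) (1, 1)) (\<lambda>(x, y). D (x, y) b)"
      using c[of unit_square] by (simp add: split_def)
    ultimately show ?thesis
      using integral_swap_continuous[of 0 0 1 1 "\<lambda>x y. D (x, y) b"]
      by (simp add: integral_prod_continuous[OF c])
  qed
qed

lemma continuous_integrable_square:
  "continuous_on UNIV (f :: plane \<Rightarrow> real) \<Longrightarrow> f integrable_on unit_square"
  by (rule integrable_continuous) (auto intro: continuous_on_subset)

lemma integral_trig:
  "integral unit_square (\<lambda>x. cos (phase k x)) = (if k = 0 then 1 else 0)"
  "integral unit_square (\<lambda>x. sin (phase k x)) = 0"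
proof -
  have "integral unit_square (\<lambda>x. cos (phase k x)) = (if k = 0 then 1 else 0) \<and>
        integral unit_square (\<lambda>x. sin (phase k x)) = 0"
  proof (cases "k = 0")
    case True
    then have "phase k = (\<lambda>x. 0)" by (simp add: phase_def fun_eq_iff)
    with True show ?thesis by (simp add: content_cbox_plus content_Pair)
  next
    case False
    then have "phase k (1, 0) \<noteq> 0 \<or> phase k (0, 1) \<noteq> 0" by (auto simp: phase_def prod_eq_iff)
    then obtain b where b: "b \<in> Basis" "phase k b \<noteq> 0" by (auto simp: Basis_plane)
    have "periodic (\<lambda>x. cos (phase k x))" "periodic (\<lambda>x. sin (phase k x))"
      by (simp_all only: periodic_def trig_shift simp_thms)
    then have "integral unit_square (\<lambda>x. - (phase k b * sin (phase k x))) = 0"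
      "integral unit_square (\<lambda>x. phase k b * cos (phase k x)) = 0"
      using integral_Basis_derivative_eq_0[OF _ trig_has_derivative(1)[of k] _ b(1)]
        integral_Basis_derivative_eq_0[OF _ trig_has_derivative(2)[of k] _ b(1)]
      by (auto simp: continuous_intros simp del: integral_mult_right integral_neg)
    with b(2) False show ?thesis by simp
  qed
  then show "integral unit_square (\<lambda>x. cos (phase k x)) = (if k = 0 then 1 else 0)"
    "integral unit_square (\<lambda>x. sin (phase k x)) = 0" by auto
qed

lemma phase_add: "phase (k + m) x = phase k x + phase m x"
  and phase_diff: "phase (k - m) x = phase k x - phase m x"
  by (simp_all add: phase_def algebra_simps)

lemma trig_mult:
  "cos (phase k x) * cos (phase m x) = 1/2 * cos (phase (k - m) x) + 1/2 * cos (phase (k + m) x)"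
  "sin (phase k x) * sin (phase m x) = 1/2 * cos (phase (k - m) x) + (- 1/2) * cos (phase (k + m) x)"
  "sin (phase k x) * cos (phase m x) = 1/2 * sin (phase (k + m) x) + 1/2 * sin (phase (k - m) x)"
  "cos (phase k x) * sin (phase m x) = 1/2 * sin (phase (k + m) x) + (- 1/2) * sin (phase (k - m) x)"
  unfolding phase_add phase_diff by (simp_all add: cos_add cos_diff sin_add sin_diff field_simps)

lemma integral_lincomb:
  assumes "continuous_on UNIV f" "continuous_on UNIV (g :: plane \<Rightarrow> real)"
  shows "integral unit_square (\<lambda>x. a * f x + b * g x) = a * integral unit_square f + b * integral unit_square g"
  using continuous_integrable_square[OF assms(1)] continuous_integrable_square[OF assms(2)]
  by (subst integral_add) (auto intro: integrable_on_mult_right)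

definition kdelta :: "freq \<Rightarrow> real" where
  "kdelta k = (if k = 0 then 1 else 0)"

lemma trig_orthogonality:
  "integral unit_square (\<lambda>x. cos (phase k x) * cos (phase m x)) = (kdelta (k - m) + kdelta (k + m)) / 2"
  "integral unit_square (\<lambda>x. sin (phase k x) * sin (phase m x)) = (kdelta (k - m) - kdelta (k + m)) / 2"
  "integral unit_square (\<lambda>x. sin (phase k x) * cos (phase m x)) = 0"
  "integral unit_square (\<lambda>x. cos (phase k x) * sin (phase m x)) = 0"
  unfolding trig_mult
  by (subst integral_lincomb; (intro continuous_intros)?; simp add: integral_trig kdelta_def)+

definition test_coeff :: "torus_test \<Rightarrow> freq \<Rightarrow> complex" where
  "test_coeff \<phi> k = Complex (integral unit_square (\<lambda>x. test_eval \<phi> x * cos (phase k x)))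
                           (- integral unit_square (\<lambda>x. test_eval \<phi> x * sin (phase k x)))"

lemma test_coeff_add: "test_coeff (\<phi> + \<psi>) k = test_coeff \<phi> k + test_coeff \<psi> k"
  unfolding test_coeff_def eval_add distrib_right
  by (subst integral_add integral_add; (intro continuous_integrable_square continuous_intros eval_continuous)?)+
    (simp add: complex_eq_iff)

lemma test_coeff_scaleR: "test_coeff (c *\<^sub>R \<phi>) k = of_real c * test_coeff \<phi> k"
  by (simp add: test_coeff_def eval_scaleR complex_eq_iff mult.assoc)

lemma test_coeff_cos: "test_coeff (cos_test m) k = of_real ((kdelta (k - m) + kdelta (k + m)) / 2)"
  using trig_orthogonality[of m k]
  by (simp add: test_coeff_def eval_cos_test complex_eq_iff kdelta_def algebra_simps)

lemma test_coeff_sin: "test_coeff (sin_test m) k = - \<i> * of_real ((kdelta (k - m) - kdelta (k + m)) / 2)"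
  using trig_orthogonality[of m k]
  by (simp add: test_coeff_def eval_sin_test complex_eq_iff kdelta_def algebra_simps)

lemma test_coeff_test_diff:
  assumes "b \<in> Basis"
  shows "test_coeff (test_diff b \<phi>) k = \<i> * of_real (phase k b) * test_coeff \<phi> k"
proof -
  let ?f = "test_eval \<phi>" and ?f' = "test_eval (test_diff b \<phi>)"
  define D where "D x = frechet_derivative ?f (at x)" for x
  have D: "(?f has_derivative D x) (at x)" for x
    unfolding D_def using eval_differentiable frechet_derivative_works by blast
  have Db: "D x b = ?f' x" for x
    unfolding eval_test_diff[OF assms] by (simp add: pdiff_def D_def)
  have per: "periodic (\<lambda>x. ?f x * cos (phase k x))" "periodic (\<lambda>x. ?f x * sin (phase k x))"
    by (simp_all only: periodic_def eval_periodic trig_shift simp_thms)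
  have i: "(\<lambda>x. ?f' x * cos (phase k x)) integrable_on unit_square"
    "(\<lambda>x. ?f' x * sin (phase k x)) integrable_on unit_square"
    "(\<lambda>x. ?f x * cos (phase k x)) integrable_on unit_square"
    "(\<lambda>x. ?f x * sin (phase k x)) integrable_on unit_square"
    by (intro continuous_integrable_square continuous_intros eval_continuous)+
  have "integral unit_square (\<lambda>x. ?f x * (- (phase k b * sin (phase k x))) + D x b * cos (phase k x)) = 0"
    by (rule integral_Basis_derivative_eq_0[OF per(1) has_derivative_mult[OF D trig_has_derivative(1)] _ assms])
      (unfold Db, intro continuous_intros eval_continuous)
  also have "(\<lambda>x. ?f x * (- (phase k b * sin (phase k x))) + D x b * cos (phase k x))
      = (\<lambda>x. ?f' x * cos (phase k x) - phase k b * (?f x * sin (phase k x)))"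
    by (simp add: Db fun_eq_iff)
  finally have 1: "integral unit_square (\<lambda>x. ?f' x * cos (phase k x))
      = phase k b * integral unit_square (\<lambda>x. ?f x * sin (phase k x))"
    by (subst (asm) integral_diff) (use i in \<open>auto intro!: integrable_on_mult_right\<close>)
  have "integral unit_square (\<lambda>x. ?f x * (phase k b * cos (phase k x)) + D x b * sin (phase k x)) = 0"
    by (rule integral_Basis_derivative_eq_0[OF per(2) has_derivative_mult[OF D trig_has_derivative(2)] _ assms])
      (unfold Db, intro continuous_intros eval_continuous)
  also have "(\<lambda>x. ?f x * (phase k b * cos (phase k x)) + D x b * sin (phase k x))
      = (\<lambda>x. ?f' x * sin (phase k x) + phase k b * (?f x * cos (phase k x)))"
    by (simp add: Db fun_eq_iff)
  finally have 2: "integral unit_square (\<lambda>x. ?f' x * sin (phase k x))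
      = - (phase k b * integral unit_square (\<lambda>x. ?f x * cos (phase k x)))"
    by (subst (asm) integral_add) (use i in \<open>auto intro!: integrable_on_mult_right\<close>)
  show ?thesis unfolding test_coeff_def 1 2 by (simp add: complex_eq_iff)
qed

lemma cmod_test_coeff_le: "cmod (test_coeff \<phi> k) \<le> 2 * test_sup \<phi>"
proof -
  have "\<bar>integral unit_square (\<lambda>x. test_eval \<phi> x * t x)\<bar> \<le> test_sup \<phi>"
    if "\<And>x. \<bar>t x\<bar> \<le> 1" "continuous_on UNIV t" for t :: "plane \<Rightarrow> real"
  proof -
    have "norm (integral unit_square (\<lambda>x. test_eval \<phi> x * t x)) \<le> test_sup \<phi> * Henstock_Kurzweil_Integration.content unit_square"
    proof (rule integrable_bound)
      show "norm (test_eval \<phi> x * t x) \<le> test_sup \<phi>" if "x \<in> unit_square" for x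
        using mult_mono[OF le_test_sup[OF that, of \<phi>] \<open>\<bar>t x\<bar> \<le> 1\<close>] by (simp add: abs_mult test_sup_nonneg)
      show "(\<lambda>x. test_eval \<phi> x * t x) integrable_on unit_square"
        using that by (intro continuous_integrable_square continuous_intros eval_continuous)
    qed (rule test_sup_nonneg)
    then show ?thesis by (simp add: content_Pair)
  qed
  from this[of "\<lambda>x. cos (phase k x)"] this[of "\<lambda>x. sin (phase k x)"]
  show ?thesis
    using cmod_le[of "test_coeff \<phi> k"] by (simp add: test_coeff_def continuous_intros)
qed

lemma cmod_test_coeff_phase: "b \<in> Basis \<Longrightarrow> \<bar>phase k b\<bar> ^ n * cmod (test_coeff \<phi> k) \<le> 2 * test_norm n \<phi>"
proof (induction n arbitrary: \<phi>)
  case 0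
  then show ?case using cmod_test_coeff_le by (simp add: test_norm_0)
next
  case (Suc n)
  have "\<bar>phase k b\<bar> ^ Suc n * cmod (test_coeff \<phi> k) = \<bar>phase k b\<bar> ^ n * cmod (test_coeff (test_diff b \<phi>) k)"
    by (simp add: test_coeff_test_diff Suc.prems norm_mult)
  also have "\<dots> \<le> 2 * test_norm n (test_diff b \<phi>)" by (rule Suc.IH[OF Suc.prems])
  also have "\<dots> \<le> 2 * test_norm (Suc n) \<phi>" using test_norm_test_diff[OF Suc.prems] by simp
  finally show ?case .
qed

lemma jap_power_le: "jap k ^ n \<le> 3 ^ n * (1 + \<bar>phase k (1, 0)\<bar> ^ (2 * n) + \<bar>phase k (0, 1)\<bar> ^ (2 * n))"
proof -
  define a b where "a = (phase k (1, 0))\<^sup>2" and "b = (phase k (0, 1))\<^sup>2"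
  have "(of_int i)\<^sup>2 \<le> (2 * pi * of_int i)\<^sup>2" for i :: int
  proof -
    have "1 * (of_int i)\<^sup>2 \<le> (2 * pi)\<^sup>2 * (of_int i :: real)\<^sup>2"
      using pi_ge_two by (intro mult_right_mono one_le_power) auto
    then show ?thesis by (simp add: power_mult_distrib)
  qed
  then have "jap k \<le> 1 + a + b"
    unfolding jap_def freq_sq_def a_def b_def phase_def by (simp add: add_mono)
  also have "\<dots> \<le> 3 * max 1 (max a b)" by linarith
  finally have "jap k ^ n \<le> (3 * max 1 (max a b)) ^ n"
    using jap_pos[of k] by (intro power_mono) auto
  also have "\<dots> = 3 ^ n * max 1 (max a b) ^ n" by (simp add: power_mult_distrib)
  also have "max 1 (max a b) ^ n \<le> 1 + a ^ n + b ^ n"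
  proof -
    have "0 \<le> a ^ n" "0 \<le> b ^ n" by (simp_all add: a_def b_def)
    then show ?thesis by (auto simp: max_def)
  qed
  finally show ?thesis by (simp add: a_def b_def power_mult power_even_abs)
qed

text \<open>
  Each derivative multiplies the coefficient by a frequency, so that \<open>2 * n\<close> derivatives in the two coordinate
  directions control the power \<open>n\<close> of \<open>1 + |k|\<^sup>2\<close>. This decay pays for the polynomial growth of the
  coefficients of a distribution.
\<close>

lemma test_coeff_decay: "jap k ^ n * cmod (test_coeff \<phi> k) \<le> 6 * 3 ^ n * test_norm (2 * n) \<phi>"
proof -
  let ?c = "cmod (test_coeff \<phi> k)"
  have "jap k ^ n * ?c \<le> 3 ^ n * (1 + \<bar>phase k (1, 0)\<bar> ^ (2 * n) + \<bar>phase k (0, 1)\<bar> ^ (2 * n)) * ?c"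
    by (intro mult_right_mono jap_power_le) auto
  also have "\<dots> = 3 ^ n * (?c + \<bar>phase k (1, 0)\<bar> ^ (2 * n) * ?c + \<bar>phase k (0, 1)\<bar> ^ (2 * n) * ?c)"
    by (simp add: algebra_simps)
  also have "\<dots> \<le> 3 ^ n * (2 * test_norm (2 * n) \<phi> + 2 * test_norm (2 * n) \<phi> + 2 * test_norm (2 * n) \<phi>)"
  proof (intro mult_left_mono add_mono)
    show "?c \<le> 2 * test_norm (2 * n) \<phi>"
      using cmod_test_coeff_phase[of "(1, 0)" k 0 \<phi>] test_norm_mono[of 0 "2 * n" \<phi>] by (simp add: Basis_plane)
    show "\<bar>phase k (1, 0)\<bar> ^ (2 * n) * ?c \<le> 2 * test_norm (2 * n) \<phi>"
      "\<bar>phase k (0, 1)\<bar> ^ (2 * n) * ?c \<le> 2 * test_norm (2 * n) \<phi>"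
      by (intro cmod_test_coeff_phase; simp add: Basis_plane)+
  qed auto
  finally show ?thesis by simp
qed

subsection \<open>Summability over frequencies\<close>

lemma summable_int_powr:
  assumes "1 < r"
  shows "(\<lambda>m :: int. (1 + (of_int m)\<^sup>2 :: real) powr (- (r / 2))) summable_on UNIV"
proof -
  let ?f = "\<lambda>m :: int. (1 + (of_int m)\<^sup>2) powr (- (r / 2)) :: real"
  have "summable (\<lambda>n. real n powr (- r))"
    using assms by (simp add: summable_real_powr_iff)
  then have "summable (\<lambda>n. ?f (int n))"
  proof (rule summable_comparison_test'[where N = 1])
    fix n :: nat assume "1 \<le> n"
    have "?f (int n) \<le> ((real n)\<^sup>2) powr (- (r / 2))"
      using assms \<open>1 \<le> n\<close> by (intro powr_mono2') auto
    also have "\<dots> = real n powr (- r)"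
      using \<open>1 \<le> n\<close> by (simp add: powr_powr flip: powr_numeral)
    finally show "norm (?f (int n)) \<le> real n powr (- r)" by simp
  qed
  then have nat: "(\<lambda>n. ?f (int n)) summable_on UNIV"
    by (intro summable_nonneg_imp_summable_on) auto
  have "?f summable_on (range int)"
    using nat by (subst summable_on_reindex) (auto simp: o_def)
  moreover have "?f summable_on (range (\<lambda>n. - int n))"
    using nat by (subst summable_on_reindex) (auto simp: o_def inj_on_def)
  ultimately have "?f summable_on (range int \<union> range (\<lambda>n. - int n))"
    by (rule summable_on_union)
  moreover have "range int \<union> range (\<lambda>n. - int n) = UNIV"
  proof (rule UNIV_eq_I[symmetric])
    fix m :: int
    show "m \<in> range int \<union> range (\<lambda>n. - int n)" by (cases m rule: int_cases2) auto
  qed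
  ultimately show ?thesis by simp
qed

text \<open>
  The plane lattice is two-dimensional, hence the critical exponent \<open>1\<close> of the weight \<open>1 + |k|\<^sup>2\<close>.
\<close>

lemma summable_jap_powr:
  assumes "1 < r"
  shows "(\<lambda>k. jap k powr (- r)) summable_on UNIV"
proof -
  let ?f = "\<lambda>m :: int. (1 + (of_int m)\<^sup>2) powr (- (r / 2)) :: real"
  have "(\<lambda>(m, n). ?f m * ?f n) summable_on (UNIV \<times> UNIV)"
  proof (rule summable_on_SigmaI[where g = "\<lambda>m. ?f m * infsum ?f UNIV"])
    note f = summable_int_powr[OF assms]
    show "((\<lambda>n. case (m, n) of (m, n) \<Rightarrow> ?f m * ?f n) has_sum ?f m * infsum ?f UNIV) UNIV" for m
      using has_sum_cmult_right[OF has_sum_infsum[OF f], of "?f m"] by simp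
    show "(\<lambda>m. ?f m * infsum ?f UNIV) summable_on UNIV"
      by (rule summable_on_cmult_left[OF f])
  qed auto
  then have "(\<lambda>k. ?f (fst k) * ?f (snd k)) summable_on UNIV"
    by (simp add: split_def)
  then show ?thesis
  proof (rule summable_on_comparison_test)
    fix k :: freq
    let ?a = "(of_int (fst k))\<^sup>2 :: real" and ?b = "(of_int (snd k))\<^sup>2 :: real"
    have "jap k powr (- r) = ((jap k)\<^sup>2) powr (- (r / 2))"
      using jap_pos[of k] by (simp add: powr_powr flip: powr_numeral)
    also have "\<dots> \<le> ((1 + ?a) * (1 + ?b)) powr (- (r / 2))"
    proof (rule powr_mono2')
      have "0 \<le> ?a * ?b" by simp
      then have "(1 + ?a) * (1 + ?b) \<le> (1 + ?a + ?b) * (1 + ?a + ?b)"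
        by (intro mult_mono) auto
      then show "(1 + ?a) * (1 + ?b) \<le> (jap k)\<^sup>2"
        by (simp add: jap_def freq_sq_def power2_eq_square add.assoc)
    qed (use assms in \<open>auto simp: add_pos_nonneg\<close>)
    also have "\<dots> = ?f (fst k) * ?f (snd k)" by (simp add: powr_mult)
    finally show "jap k powr (- r) \<le> ?f (fst k) * ?f (snd k)" .
  qed auto
qed

lemma summable_jap_inverse_square: "(\<lambda>k. 1 / (jap k)\<^sup>2) summable_on UNIV"
  using summable_jap_powr[of 2] jap_pos by (simp add: powr_minus_divide less_imp_le)

lemma jap_test_coeff_le:
  "jap k ^ n * cmod (test_coeff \<phi> k) \<le> 6 * 3 ^ (n + 2) * test_norm (2 * (n + 2)) \<phi> * (1 / (jap k)\<^sup>2)"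
  using test_coeff_decay[of k "n + 2" \<phi>] jap_pos[of k]
  by (simp add: field_simps power_add power2_eq_square)

lemma summable_test_coeff: "(\<lambda>k. jap k ^ n * cmod (test_coeff \<phi> k)) summable_on UNIV"
  by (rule summable_on_comparison_test[OF summable_on_cmult_right[OF summable_jap_inverse_square]])
    (use jap_test_coeff_le jap_pos in \<open>auto simp: less_imp_le\<close>)

section \<open>Distributions and their Fourier coefficients\<close>

inductive trig_poly :: "(plane \<Rightarrow> real) \<Rightarrow> bool" where
  cos: "trig_poly (\<lambda>x. cos (phase k x))"
| sin: "trig_poly (\<lambda>x. sin (phase k x))"
| lincomb: "trig_poly f \<Longrightarrow> trig_poly g \<Longrightarrow> trig_poly (\<lambda>x. a * f x + b * g x)"

lemma trig_poly_scale: "trig_poly f \<Longrightarrow> trig_poly (\<lambda>x. a * f x)"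
  using trig_poly.lincomb[of f f a 0] by simp

lemma trig_poly_add: "trig_poly f \<Longrightarrow> trig_poly g \<Longrightarrow> trig_poly (\<lambda>x. f x + g x)"
  using trig_poly.lincomb[of f g 1 1] by simp

lemma trig_poly_const: "trig_poly (\<lambda>x. c)"
  using trig_poly_scale[OF trig_poly.cos[of 0], of c] by (simp add: phase_def)

text \<open>
  The product-to-sum formulas make the trigonometric polynomials an algebra.
\<close>

lemma trig_poly_mult: "trig_poly f \<Longrightarrow> trig_poly g \<Longrightarrow> trig_poly (\<lambda>x. f x * g x)"
proof (induction rule: trig_poly.induct)
  case (cos k)
  from cos.prems show ?case
  proof (induction rule: trig_poly.induct)
    case (lincomb f g a b)
    then show ?case
      using trig_poly.lincomb[OF lincomb.IH, of a b] by (simp add: algebra_simps)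
  qed (simp_all only: trig_mult trig_poly.intros)
next
  case (sin k)
  from sin.prems show ?case
  proof (induction rule: trig_poly.induct)
    case (lincomb f g a b)
    then show ?case
      using trig_poly.lincomb[OF lincomb.IH, of a b] by (simp add: algebra_simps)
  qed (simp_all only: trig_mult trig_poly.intros)
next
  case (lincomb f h a b)
  then show ?case
    using trig_poly.lincomb[OF lincomb.IH[OF lincomb.prems], of a b] by (simp add: algebra_simps)
qed

lemma trig_poly_continuous: "trig_poly f \<Longrightarrow> continuous_on S f"
  by (induction rule: trig_poly.induct) (auto intro!: continuous_intros)

text \<open>The torus as a compact subset of a Euclidean space, where polynomials are dense.\<close>

definition torus_map :: "plane \<Rightarrow> complex \<times> complex" where
  "torus_map x = (cis (2 * pi * fst x), cis (2 * pi * snd x))"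

lemma continuous_on_torus_map: "continuous_on S torus_map"
  unfolding torus_map_def by (intro continuous_intros)

lemma cis_2pi_eqD: "cis (2 * pi * a) = cis (2 * pi * b) \<Longrightarrow> \<exists>n :: int. a = b + of_int n"
proof -
  assume "cis (2 * pi * a) = cis (2 * pi * b)"
  then have "sin (2 * pi * a) = sin (2 * pi * b) \<and> cos (2 * pi * a) = cos (2 * pi * b)"
    by (simp add: complex_eq_iff)
  then obtain n :: int where "2 * pi * a = 2 * pi * b + 2 * pi * of_int n"
    using sin_cos_eq_iff[of "2 * pi * a" "2 * pi * b"] by auto
  then have "2 * pi * (a - b - of_int n) = 0" by (simp add: algebra_simps)
  then have "a = b + of_int n" by simp
  then show ?thesis ..
qed

lemma real_polynomial_torus_map: "real_polynomial_function h \<Longrightarrow> trig_poly (\<lambda>x. h (torus_map x))"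
proof (induction rule: real_polynomial_function.induct)
  case (linear h)
  interpret bounded_linear h by fact
  have "torus_map x = cos (phase (1, 0) x) *\<^sub>R (1, 0) + sin (phase (1, 0) x) *\<^sub>R (\<i>, 0)
      + (cos (phase (0, 1) x) *\<^sub>R (0, 1) + sin (phase (0, 1) x) *\<^sub>R (0, \<i>))" for x
    by (simp add: torus_map_def phase_def complex_eq_iff)
  then have "h (torus_map x) = (h (1, 0) * cos (phase (1, 0) x) + h (\<i>, 0) * sin (phase (1, 0) x))
      + (h (0, 1) * cos (phase (0, 1) x) + h (0, \<i>) * sin (phase (0, 1) x))" for x
    by (simp add: add scaleR del: add_Pair scaleR_Pair)
  then show ?case
    by (simp only:) (intro trig_poly_add trig_poly.lincomb trig_poly.sin trig_poly.cos)
qed (auto intro: trig_poly_const trig_poly_add trig_poly_mult)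

text \<open>
  A periodic function factors through \<open>torus_map\<close>. The factor is continuous, because \<open>torus_map\<close> maps
  the closed subsets of the compact square to closed sets, and the Weierstrass theorem applies to it;
  polynomials in the four coordinates of the image are trigonometric polynomials.
\<close>

lemma trig_poly_approx:
  assumes f: "continuous_on UNIV f" "periodic f" and "0 < e"
  shows "\<exists>h. trig_poly h \<and> (\<forall>x\<in>unit_square. \<bar>f x - h x\<bar> < e)"
proof -
  define S where "S = torus_map ` unit_square"
  have fiber: "f x = f y" if "torus_map x = torus_map y" for x y
  proof -
    from that obtain m n where "fst x = fst y + of_int m" "snd x = snd y + of_int n"
      unfolding torus_map_def prod.inject using cis_2pi_eqD by meson
    then have "x = y + (of_int m, of_int n)" by (simp add: prod_eq_iff)
    then show ?thesis using f(2) unfolding periodic_def by blast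
  qed
  define g where "g s = f (SOME x. x \<in> unit_square \<and> torus_map x = s)" for s
  have g: "g (torus_map x) = f x" if "x \<in> unit_square" for x
    unfolding g_def by (rule fiber) (use someI[of "\<lambda>y. y \<in> unit_square \<and> torus_map y = torus_map x" x] that in blast)
  have compact: "compact S"
    unfolding S_def by (intro compact_continuous_image continuous_on_torus_map compact_cbox)
  have "continuous_on S g"
    unfolding continuous_on_closed_vimage[OF compact_imp_closed[OF compact]]
  proof (intro allI impI)
    fix B :: "real set" assume "closed B"
    have "g -` B \<inter> S = torus_map ` (f -` B \<inter> unit_square)"
      using g by (auto simp: S_def)
    moreover have "closed (f -` B)"
      using \<open>closed B\<close> f(1) by (rule closed_vimage)
    then have "compact (torus_map ` (f -` B \<inter> unit_square))"
      by (intro compact_continuous_image continuous_on_torus_map closed_Int_compact compact_cbox)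
    ultimately show "closed (g -` B \<inter> S)" by (simp add: compact_imp_closed)
  qed
  then obtain p where p: "real_polynomial_function p" "\<And>s. s \<in> S \<Longrightarrow> \<bar>g s - p s\<bar> < e"
    using Stone_Weierstrass_real_polynomial_function[OF compact _ \<open>0 < e\<close>] by metis
  show ?thesis
  proof (intro exI conjI ballI)
    show "trig_poly (\<lambda>x. p (torus_map x))" by (rule real_polynomial_torus_map[OF p(1)])
    show "\<bar>f x - p (torus_map x)\<bar> < e" if "x \<in> unit_square" for x
      using p(2)[of "torus_map x"] g[OF that] that by (simp add: S_def)
  qed
qed

text \<open>
  The function is orthogonal to all trigonometric polynomials, hence to a uniform approximation of
  itself; so its square integral is arbitrarily small.
\<close>

lemma fourier_uniqueness_continuous:
  assumes f: "continuous_on UNIV f" "periodic f"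
    and cos0: "\<And>k. integral unit_square (\<lambda>x. f x * cos (phase k x)) = 0"
    and sin0: "\<And>k. integral unit_square (\<lambda>x. f x * sin (phase k x)) = 0"
    and x: "x \<in> unit_square"
  shows "f x = 0"
proof -
  have orth: "integral unit_square (\<lambda>x. f x * h x) = 0" if "trig_poly h" for h
    using that
  proof (induction rule: trig_poly.induct)
    case (lincomb g h a b)
    have "integral unit_square (\<lambda>x. a * (f x * g x) + b * (f x * h x)) = 0"
      using trig_poly_continuous[OF lincomb(1)] trig_poly_continuous[OF lincomb(2)] f(1) lincomb.IH
      by (subst integral_lincomb) (auto intro!: continuous_intros)
    then show ?case by (simp add: algebra_simps)
  qed (simp_all add: cos0 sin0)
  have "compact (f ` unit_square)"
    using f(1) by (intro compact_continuous_image) (auto intro: continuous_on_subset)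
  then have "\<exists>M>0. \<forall>y\<in>f ` unit_square. norm y \<le> M"
    by (simp only: compact_imp_bounded flip: bounded_pos)
  then obtain M where "0 < M" and M': "\<forall>y\<in>f ` unit_square. norm y \<le> M"
    by (elim exE conjE)
  then have M: "\<bar>f x\<bar> \<le> M" if "x \<in> unit_square" for x
    using bspec[OF M' imageI[OF that]] by (simp only: real_norm_def)
  have int: "(\<lambda>x. f x * f x) integrable_on unit_square"
    using f(1) by (intro continuous_integrable_square continuous_intros)
  have "integral unit_square (\<lambda>x. f x * f x) \<le> e" if "0 < e" for e
  proof -
    have "0 < e / M" using that \<open>0 < M\<close> by simp
    from trig_poly_approx[OF f this]
    obtain h where h: "trig_poly h" "\<forall>x\<in>unit_square. \<bar>f x - h x\<bar> < e / M"
      by (elim exE conjE)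
    have ih: "(\<lambda>x. f x * h x) integrable_on unit_square"
      by (intro continuous_integrable_square continuous_on_mult f(1) trig_poly_continuous h(1))
    have "integral unit_square (\<lambda>x. f x * f x) = integral unit_square (\<lambda>x. f x * f x - f x * h x)"
      using integral_diff[OF int ih] orth[OF h(1)] by simp
    also have "\<dots> \<le> integral unit_square (\<lambda>x. e)"
    proof (rule integral_le)
      show "f x * f x - f x * h x \<le> e" if "x \<in> unit_square" for x
      proof -
        have "f x * (f x - h x) \<le> M * (e / M)"
          using mult_mono[OF M[OF that] less_imp_le[OF bspec[OF h(2) that]]] \<open>0 < M\<close>
            abs_ge_self[of "f x * (f x - h x)"] by (simp add: abs_mult)
        then show ?thesis using \<open>0 < M\<close> by (simp add: right_diff_distrib)
      qed
    qed (use int ih in \<open>auto intro: integrable_diff\<close>)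
    finally show ?thesis by (simp add: content_Pair)
  qed
  then have "integral unit_square (\<lambda>x. f x * f x) \<le> 0" by (rule field_le_epsilon) simp
  moreover have "0 \<le> integral unit_square (\<lambda>x. f x * f x)"
    by (intro integral_nonneg int) simp
  ultimately have "integral unit_square (\<lambda>x. f x * f x) = 0" by simp
  moreover have "box (0, 0) (1, 1) \<noteq> ({} :: plane set)" by (simp add: box_ne_empty Basis_plane)
  moreover have "continuous_on unit_square (\<lambda>x. f x * f x)"
    using f(1) by (intro continuous_intros) (auto intro: continuous_on_subset)
  ultimately have "f x * f x = 0"
    using has_integral_0_cbox_imp_0[OF _ _ _ _ x, of "\<lambda>x. f x * f x"] integrable_integral[OF int] by simp
  then show ?thesis by simp
qed

text \<open>
  The real form of \<open>test_coeff \<phi> k * cis (phase k x)\<close>: the imaginary parts of the terms for \<open>k\<close> and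
  \<open>- k\<close> cancel in the Fourier series.
\<close>

definition fourier_term :: "torus_test \<Rightarrow> freq \<Rightarrow> torus_test" where
  "fourier_term \<phi> k = Re (test_coeff \<phi> k) *\<^sub>R cos_test k - Im (test_coeff \<phi> k) *\<^sub>R sin_test k"

lemma eval_fourier_term:
  "test_eval (fourier_term \<phi> k) x = Re (test_coeff \<phi> k) * cos (phase k x) - Im (test_coeff \<phi> k) * sin (phase k x)"
  by (simp add: fourier_term_def eval_diff eval_scaleR eval_cos_test eval_sin_test)

lemma eval_fourier_term_Re: "test_eval (fourier_term \<phi> k) x = Re (test_coeff \<phi> k * cis (phase k x))"
  by (simp add: eval_fourier_term)

lemma abs_eval_fourier_term: "\<bar>test_eval (fourier_term \<phi> k) x\<bar> \<le> cmod (test_coeff \<phi> k)"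
  unfolding eval_fourier_term_Re using abs_Re_le_cmod[of "test_coeff \<phi> k * cis (phase k x)"]
  by (simp add: norm_mult)

lemma test_diff_fourier_term:
  assumes "b \<in> Basis"
  shows "test_diff b (fourier_term \<phi> k) = fourier_term (test_diff b \<phi>) k"
proof -
  have "test_diff b (fourier_term \<phi> k)
     = Re (test_coeff \<phi> k) *\<^sub>R test_diff b (cos_test k) - Im (test_coeff \<phi> k) *\<^sub>R test_diff b (sin_test k)"
    unfolding fourier_term_def using linear_test_diff[OF assms]
    by (simp add: linear_diff test_diff_scaleR[OF assms])
  then show ?thesis
    unfolding fourier_term_def
    by (simp add: test_diff_cos test_diff_sin test_coeff_test_diff assms mult.commute)
qed

lemma test_coeff_uminus: "test_coeff \<phi> (- k) = cnj (test_coeff \<phi> k)"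
  by (simp add: test_coeff_def phase_uminus complex_eq_iff)

lemma has_sum_kdelta:
  "((\<lambda>k. f k * kdelta (k - m)) has_sum f m) UNIV" "((\<lambda>k. f k * kdelta (k + m)) has_sum f (- m)) UNIV"
  using has_sum_finite_neutralI[of "{m}" UNIV "\<lambda>k. f k * kdelta (k - m)" "f m"]
    has_sum_finite_neutralI[of "{- m}" UNIV "\<lambda>k. f k * kdelta (k + m)" "f (- m)"]
  by (auto simp: kdelta_def eq_neg_iff_add_eq_0)

text \<open>
  The coefficients are absolutely summable, so the series converges uniformly to a continuous periodic
  function. It has the same coefficients as \<open>\<phi>\<close>, and continuous functions are determined by theirs.
\<close>

lemma fourier_series_uniform:
  "uniform_limit unit_square (\<lambda>F x. \<Sum>k\<in>F. test_eval (fourier_term \<phi> k) x) (test_eval \<phi>)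
     (finite_subsets_at_top UNIV)"
proof -
  let ?T = "\<lambda>k x. test_eval (fourier_term \<phi> k) x" and ?A = "finite_subsets_at_top (UNIV :: freq set)"
  define S where "S x = (\<Sum>\<^sub>\<infinity>k. ?T k x)" for x
  have sum: "(\<lambda>k. cmod (test_coeff \<phi> k)) summable_on UNIV"
    using summable_test_coeff[of 0 \<phi>] by simp
  have sT: "(\<lambda>k. ?T k x) summable_on UNIV" for x
    by (rule abs_summable_summable, rule summable_on_comparison_test[OF sum])
      (simp_all add: abs_eval_fourier_term)
  have unif: "uniform_limit UNIV (\<lambda>F x. \<Sum>k\<in>F. ?T k x) S ?A"
    unfolding S_def by (rule Weierstrass_m_test_general[OF _ sum]) (simp add: abs_eval_fourier_term)
  have contS: "continuous_on UNIV S"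
    by (rule uniform_limit_theorem[OF _ unif])
      (auto intro!: always_eventually continuous_intros eval_continuous)
  have perS: "periodic S"
    by (simp only: S_def periodic_def eval_periodic simp_thms)
  have coeff: "integral unit_square (\<lambda>x. S x * t x) = c"
    if t: "\<And>x. \<bar>t x\<bar> \<le> 1" "continuous_on UNIV t"
      and c: "((\<lambda>k. integral unit_square (\<lambda>x. ?T k x * t x)) has_sum c) UNIV" for t c
  proof -
    have "uniform_limit UNIV (\<lambda>F x. \<Sum>k\<in>F. ?T k x * t x) (\<lambda>x. \<Sum>\<^sub>\<infinity>k. ?T k x * t x) ?A"
    proof (rule Weierstrass_m_test_general[OF _ sum])
      show "norm (?T k x * t x) \<le> cmod (test_coeff \<phi> k)" for k x
        using mult_mono[OF abs_eval_fourier_term t(1), of \<phi> k x x] by (simp add: abs_mult)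
    qed
    then have "uniform_limit unit_square (\<lambda>F x. \<Sum>k\<in>F. ?T k x * t x) (\<lambda>x. S x * t x) ?A"
      using sT by (subst (asm) infsum_cmult_left) (auto simp: S_def intro: uniform_limit_on_subset)
    then obtain I J where I: "\<And>F. ((\<lambda>x. \<Sum>k\<in>F. ?T k x * t x) has_integral I F) unit_square"
      and J: "((\<lambda>x. S x * t x) has_integral J) unit_square" and lim: "(I \<longlongrightarrow> J) ?A"
      by (rule uniform_limit_integral_cbox)
        (use t in \<open>auto intro!: continuous_intros eval_continuous intro: continuous_on_subset\<close>)
    have "I F = (\<Sum>k\<in>F. integral unit_square (\<lambda>x. ?T k x * t x))" if "finite F" for F
      using integral_unique[OF I[of F]] that t
      by (subst (asm) integral_sum) (auto intro!: continuous_integrable_square continuous_intros eval_continuous)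
    then have "((\<lambda>F. \<Sum>k\<in>F. integral unit_square (\<lambda>x. ?T k x * t x)) \<longlongrightarrow> J) ?A"
      by (intro Lim_transform_eventually[OF lim] eventually_finite_subsets_at_top_weakI) auto
    then have "J = c"
      using c tendsto_unique[of ?A] unfolding has_sum_def by auto
    with J show ?thesis by (simp add: integral_unique)
  qed
  have Tcos: "integral unit_square (\<lambda>x. ?T k x * cos (phase m x))
      = Re (test_coeff \<phi> k) / 2 * kdelta (k - m) + Re (test_coeff \<phi> k) / 2 * kdelta (k + m)" for k m
  proof -
    have "(\<lambda>x. ?T k x * cos (phase m x)) = (\<lambda>x. Re (test_coeff \<phi> k) * (cos (phase k x) * cos (phase m x))
       + (- Im (test_coeff \<phi> k)) * (sin (phase k x) * cos (phase m x)))"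
      by (simp add: eval_fourier_term fun_eq_iff algebra_simps)
    then show ?thesis
      by (simp only:) (subst integral_lincomb, auto intro!: continuous_intros simp: trig_orthogonality field_simps)
  qed
  have Tsin: "integral unit_square (\<lambda>x. ?T k x * sin (phase m x))
      = - Im (test_coeff \<phi> k) / 2 * kdelta (k - m) + Im (test_coeff \<phi> k) / 2 * kdelta (k + m)" for k m
  proof -
    have "(\<lambda>x. ?T k x * sin (phase m x)) = (\<lambda>x. Re (test_coeff \<phi> k) * (cos (phase k x) * sin (phase m x))
       + (- Im (test_coeff \<phi> k)) * (sin (phase k x) * sin (phase m x)))"
      by (simp add: eval_fourier_term fun_eq_iff algebra_simps)
    then show ?thesis
      by (simp only:) (subst integral_lincomb, auto intro!: continuous_intros simp: trig_orthogonality field_simps)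
  qed
  have "S x = test_eval \<phi> x" if "x \<in> unit_square" for x
  proof -
    have i: "(\<lambda>x. S x * t x) integrable_on unit_square" "(\<lambda>x. test_eval \<phi> x * t x) integrable_on unit_square"
      if "continuous_on UNIV t" for t
      by (intro continuous_integrable_square continuous_intros contS eval_continuous that)+
    have "(\<lambda>x. S x - test_eval \<phi> x) x = 0"
    proof (rule fourier_uniqueness_continuous[OF _ _ _ _ that])
      show "continuous_on UNIV (\<lambda>x. S x - test_eval \<phi> x)"
        by (intro continuous_intros contS eval_continuous)
      show "periodic (\<lambda>x. S x - test_eval \<phi> x)"
        using perS by (simp only: periodic_def eval_periodic simp_thms)
      fix m
      have "((\<lambda>k. integral unit_square (\<lambda>x. ?T k x * cos (phase m x))) has_sum
          Re (test_coeff \<phi> m) / 2 + Re (test_coeff \<phi> (- m)) / 2) UNIV"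
        unfolding Tcos by (intro has_sum_add has_sum_kdelta)
      then have "integral unit_square (\<lambda>x. S x * cos (phase m x)) = Re (test_coeff \<phi> m)"
        by (subst coeff) (auto intro!: continuous_intros simp: test_coeff_uminus)
      then show "integral unit_square (\<lambda>x. (S x - test_eval \<phi> x) * cos (phase m x)) = 0"
        unfolding left_diff_distrib
        by (subst integral_diff) (auto intro!: i continuous_intros simp: test_coeff_def)
      have "((\<lambda>k. integral unit_square (\<lambda>x. ?T k x * sin (phase m x))) has_sum
          - Im (test_coeff \<phi> m) / 2 + Im (test_coeff \<phi> (- m)) / 2) UNIV"
        unfolding Tsin by (intro has_sum_add has_sum_kdelta)
      then have "integral unit_square (\<lambda>x. S x * sin (phase m x)) = - Im (test_coeff \<phi> m)"
        by (subst coeff) (auto intro!: continuous_intros simp: test_coeff_uminus)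
      then show "integral unit_square (\<lambda>x. (S x - test_eval \<phi> x) * sin (phase m x)) = 0"
        unfolding left_diff_distrib
        by (subst integral_diff) (auto intro!: i continuous_intros simp: test_coeff_def)
    qed
    then show ?thesis by simp
  qed
  then show ?thesis
    using uniform_limit_cong'[of unit_square "\<lambda>F x. \<Sum>k\<in>F. ?T k x" "\<lambda>F x. \<Sum>k\<in>F. ?T k x" S "test_eval \<phi>" ?A]
      uniform_limit_on_subset[OF unif, of unit_square] by simp
qed

text \<open>
  Differentiation commutes with taking partial sums, so the uniform convergence for all derivatives of
  \<open>\<phi>\<close> is the convergence in all the norms.
\<close>

lemma fourier_series_test_norm:
  "((\<lambda>F. test_norm n (\<phi> - (\<Sum>k\<in>F. fourier_term \<phi> k))) \<longlongrightarrow> 0) (finite_subsets_at_top UNIV)"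
proof (induction n arbitrary: \<phi>)
  have sup: "((\<lambda>F. test_sup (\<phi> - (\<Sum>k\<in>F. fourier_term \<phi> k))) \<longlongrightarrow> 0) (finite_subsets_at_top UNIV)" for \<phi>
  proof (rule tendstoI)
    fix e :: real assume "0 < e"
    then have "\<forall>\<^sub>F F in finite_subsets_at_top UNIV. \<forall>x\<in>unit_square.
        dist (\<Sum>k\<in>F. test_eval (fourier_term \<phi> k) x) (test_eval \<phi> x) < e / 2"
      by (intro uniform_limitD[OF fourier_series_uniform]) simp
    then show "\<forall>\<^sub>F F in finite_subsets_at_top UNIV. dist (test_sup (\<phi> - (\<Sum>k\<in>F. fourier_term \<phi> k))) 0 < e"
    proof eventually_elim
      case (elim F)
      then have "test_sup (\<phi> - (\<Sum>k\<in>F. fourier_term \<phi> k)) \<le> e / 2"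
        by (intro test_sup_le) (auto simp: eval_diff eval_sum dist_real_def abs_minus_commute less_imp_le)
      with \<open>0 < e\<close> show ?case by (simp add: dist_real_def test_sup_nonneg)
    qed
  qed
  {
    case 0
    then show ?case using sup by (simp add: test_norm_0)
  next
    case (Suc n)
    have "test_diff b (\<phi> - (\<Sum>k\<in>F. fourier_term \<phi> k)) = test_diff b \<phi> - (\<Sum>k\<in>F. fourier_term (test_diff b \<phi>) k)"
      if "b \<in> Basis" for b F
      using linear_test_diff[OF that] by (simp add: linear_diff linear_sum test_diff_fourier_term[OF that])
    then have "((\<lambda>F. test_sup (\<phi> - (\<Sum>k\<in>F. fourier_term \<phi> k))
        + (\<Sum>b\<in>Basis. test_norm n (test_diff b (\<phi> - (\<Sum>k\<in>F. fourier_term \<phi> k))))) \<longlongrightarrow> 0 + (\<Sum>b\<in>(Basis :: plane set). 0))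
        (finite_subsets_at_top UNIV)"
      by (intro tendsto_add tendsto_sum sup) (simp add: Suc.IH)
    then show ?case unfolding test_norm_Suc by simp
  }
qed

text \<open>
  Fourier series of a test function converges in all the norms of the test functions, so a
  distribution may be applied to it term by term.
\<close>

lemma pairing_has_sum:
  "((\<lambda>k. Re (fourier u k * cnj (test_coeff \<phi> k))) has_sum pairing u \<phi>) UNIV"
proof -
  obtain C n where C: "\<And>\<phi>. \<bar>pairing u \<phi>\<bar> \<le> C * test_norm n \<phi>"
    using test_continuous_pairing[of u] unfolding test_continuous_def by metis
  have "((\<lambda>F. pairing u (\<phi> - (\<Sum>k\<in>F. fourier_term \<phi> k))) \<longlongrightarrow> 0) (finite_subsets_at_top UNIV)"
  proof (rule Lim_null_comparison)
    show "((\<lambda>F. C * test_norm n (\<phi> - (\<Sum>k\<in>F. fourier_term \<phi> k))) \<longlongrightarrow> 0) (finite_subsets_at_top UNIV)"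
      using tendsto_mult_left[OF fourier_series_test_norm, of C n \<phi>] by simp
  qed (auto simp: C)
  then have "((\<lambda>F. pairing u \<phi> - (\<Sum>k\<in>F. pairing u (fourier_term \<phi> k))) \<longlongrightarrow> 0) (finite_subsets_at_top UNIV)"
    by (simp add: pairing_linear)
  then have "((\<lambda>F. pairing u \<phi> - (pairing u \<phi> - (\<Sum>k\<in>F. pairing u (fourier_term \<phi> k)))) \<longlongrightarrow> pairing u \<phi> - 0)
      (finite_subsets_at_top UNIV)"
    by (intro tendsto_diff tendsto_const)
  moreover have "pairing u (fourier_term \<phi> k) = Re (fourier u k * cnj (test_coeff \<phi> k))" for k
    by (simp add: fourier_term_def pairing_linear fourier_tests algebra_simps)
  ultimately show ?thesis unfolding has_sum_def by simp
qed

lemma fourier_inject: "fourier u = fourier v \<Longrightarrow> u = v"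
  using pairing_has_sum[of u] pairing_has_sum[of v]
  by (intro torus_distr_eqI) (metis has_sum_unique)

text \<open>The coefficient families of real distributions.\<close>

definition tempered :: "(freq \<Rightarrow> complex) \<Rightarrow> bool" where
  "tempered c \<longleftrightarrow> (\<exists>C N. \<forall>k. cmod (c k) \<le> C * jap k ^ N) \<and> (\<forall>k. c (- k) = cnj (c k))"

text \<open>
  The distribution is defined by Parseval's formula. Its coefficient at \<open>m\<close> collects one half of \<open>c m\<close>
  and one half of the conjugate of \<open>c (- m)\<close>, as \<open>cos_test m\<close> and \<open>sin_test m\<close> contain both frequencies.
\<close>

lemma tempered_imp_distr:
  assumes "tempered c"
  shows "\<exists>u. fourier u = c"
proof -
  obtain C N where growth: "\<And>k. cmod (c k) \<le> C * jap k ^ N" and sym: "\<And>k. c (- k) = cnj (c k)"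
    using assms unfolding tempered_def by blast
  define f where "f \<phi> k = Re (c k * cnj (test_coeff \<phi> k))" for \<phi> k
  define p where "p \<phi> = (\<Sum>\<^sub>\<infinity>k. f \<phi> k)" for \<phi>
  have f_le: "\<bar>f \<phi> k\<bar> \<le> C * (jap k ^ N * cmod (test_coeff \<phi> k))" for \<phi> k
    using abs_Re_le_cmod[of "c k * cnj (test_coeff \<phi> k)"] mult_right_mono[OF growth, of "cmod (test_coeff \<phi> k)" k]
    by (simp add: f_def norm_mult mult.assoc)
  have abs: "(\<lambda>k. norm (f \<phi> k)) summable_on UNIV" for \<phi>
    by (rule summable_on_comparison_test[OF summable_on_cmult_right[OF summable_test_coeff, of C N \<phi>]])
      (use f_le in auto)
  then have sum: "f \<phi> summable_on UNIV" for \<phi>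
    by (rule abs_summable_summable)
  have "linear p"
  proof (rule linearI)
    show "p (\<phi> + \<psi>) = p \<phi> + p \<psi>" for \<phi> \<psi>
      unfolding p_def by (subst infsum_add[OF sum sum, symmetric])
        (rule infsum_cong, simp add: f_def test_coeff_add algebra_simps)
    show "p (a *\<^sub>R \<phi>) = a *\<^sub>R p \<phi>" for a \<phi>
      unfolding p_def by (simp add: infsum_cmult_right[OF sum, symmetric])
        (rule infsum_cong, simp add: f_def test_coeff_scaleR algebra_simps)
  qed
  moreover have "test_continuous p"
  proof -
    define D where "D = \<bar>C\<bar> * (6 * 3 ^ (N + 2)) * (\<Sum>\<^sub>\<infinity>k. 1 / (jap k)\<^sup>2)"
    have "\<bar>p \<phi>\<bar> \<le> D * test_norm (2 * (N + 2)) \<phi>" for \<phi>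
    proof -
      have "\<bar>f \<phi> k\<bar> \<le> (\<bar>C\<bar> * (6 * 3 ^ (N + 2) * test_norm (2 * (N + 2)) \<phi>)) * (1 / (jap k)\<^sup>2)" for k
      proof -
        have "\<bar>f \<phi> k\<bar> \<le> \<bar>C\<bar> * (jap k ^ N * cmod (test_coeff \<phi> k))"
          using jap_pos[of k] by (intro order_trans[OF f_le mult_right_mono[OF abs_ge_self]]) simp
        also have "\<dots> \<le> \<bar>C\<bar> * (6 * 3 ^ (N + 2) * test_norm (2 * (N + 2)) \<phi> * (1 / (jap k)\<^sup>2))"
          by (intro mult_left_mono jap_test_coeff_le) auto
        finally show ?thesis by (simp only: mult.assoc)
      qed
      then have "(\<Sum>\<^sub>\<infinity>k. norm (f \<phi> k)) \<le> (\<Sum>\<^sub>\<infinity>k. (\<bar>C\<bar> * (6 * 3 ^ (N + 2) * test_norm (2 * (N + 2)) \<phi>)) * (1 / (jap k)\<^sup>2))"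
        by (intro infsum_mono abs summable_on_cmult_right summable_jap_inverse_square) simp
      also have "\<dots> = D * test_norm (2 * (N + 2)) \<phi>"
        by (subst infsum_cmult_right[OF summable_jap_inverse_square]) (simp add: D_def)
      finally show ?thesis
        using norm_infsum_bound[of "f \<phi>" UNIV] abs[of \<phi>] by (simp add: p_def)
    qed
    then show ?thesis unfolding test_continuous_def by blast
  qed
  ultimately have p: "pairing (Abs_torus_distr p) = p"
    by (intro Abs_torus_distr_inverse) simp
  have "fourier (Abs_torus_distr p) m = c m" for m
  proof -
    have "((\<lambda>k. Re (c k) / 2 * kdelta (k - m) + Re (c k) / 2 * kdelta (k + m)) has_sum
        Re (c m) / 2 + Re (c (- m)) / 2) UNIV"
      by (intro has_sum_add has_sum_kdelta)
    moreover have "(\<lambda>k. Re (c k) / 2 * kdelta (k - m) + Re (c k) / 2 * kdelta (k + m)) = f (cos_test m)"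
      by (simp add: f_def test_coeff_cos fun_eq_iff algebra_simps add_divide_distrib)
    ultimately have 1: "p (cos_test m) = Re (c m)"
      unfolding p_def by (simp add: infsumI sym)
    have "((\<lambda>k. - Im (c k) / 2 * kdelta (k - m) + Im (c k) / 2 * kdelta (k + m)) has_sum
        - Im (c m) / 2 + Im (c (- m)) / 2) UNIV"
      by (intro has_sum_add has_sum_kdelta)
    moreover have "(\<lambda>k. - Im (c k) / 2 * kdelta (k - m) + Im (c k) / 2 * kdelta (k + m)) = f (sin_test m)"
      by (simp add: f_def test_coeff_sin fun_eq_iff algebra_simps diff_divide_distrib)
    ultimately have 2: "p (sin_test m) = - Im (c m)"
      unfolding p_def by (simp add: infsumI sym)
    show ?thesis unfolding fourier_tests p 1 2 by (simp add: complex_eq_iff)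
  qed
  then show ?thesis by blast
qed

lemma fourier_distr_of_coeffs: "tempered c \<Longrightarrow> fourier (distr_of_coeffs c) = c"
  unfolding distr_of_coeffs_def
  by (rule theI') (use tempered_imp_distr fourier_inject in metis)

section \<open>Weighted square-summable families\<close>

lemma infsum_square_Cauchy_Schwarz:
  fixes a b :: "'a \<Rightarrow> real"
  assumes a: "(\<lambda>j. (a j)\<^sup>2) summable_on UNIV" and b: "(\<lambda>j. (b j)\<^sup>2) summable_on UNIV"
  shows "(\<lambda>j. \<bar>a j * b j\<bar>) summable_on UNIV"
    and "(\<Sum>\<^sub>\<infinity>j. \<bar>a j * b j\<bar>) \<le> sqrt (\<Sum>\<^sub>\<infinity>j. (a j)\<^sup>2) * sqrt (\<Sum>\<^sub>\<infinity>j. (b j)\<^sup>2)"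
proof -
  have fin: "(\<Sum>j\<in>F. \<bar>a j * b j\<bar>) \<le> sqrt (\<Sum>\<^sub>\<infinity>j. (a j)\<^sup>2) * sqrt (\<Sum>\<^sub>\<infinity>j. (b j)\<^sup>2)" if "finite F" for F
  proof -
    have "(\<Sum>j\<in>F. \<bar>a j * b j\<bar>) \<le> L2_set a F * L2_set b F"
      using L2_set_mult_ineq[of a b F] by (simp add: abs_mult)
    also have "\<dots> \<le> sqrt (\<Sum>\<^sub>\<infinity>j. (a j)\<^sup>2) * sqrt (\<Sum>\<^sub>\<infinity>j. (b j)\<^sup>2)"
      unfolding L2_set_def using that a b
      by (intro mult_mono real_sqrt_le_mono finite_sum_le_infsum) (auto intro: sum_nonneg infsum_nonneg)
    finally show ?thesis .
  qed
  show sum: "(\<lambda>j. \<bar>a j * b j\<bar>) summable_on UNIV"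
    by (rule nonneg_bdd_above_summable_on) (auto intro!: bdd_aboveI2 fin)
  show "(\<Sum>\<^sub>\<infinity>j. \<bar>a j * b j\<bar>) \<le> sqrt (\<Sum>\<^sub>\<infinity>j. (a j)\<^sup>2) * sqrt (\<Sum>\<^sub>\<infinity>j. (b j)\<^sup>2)"
    by (rule infsum_le_finite_sums[OF sum]) (rule fin)
qed

text \<open>
  The spaces \<open>Sobolev s\<close> in terms of coefficients. The families below need not be those of a real
  distribution, which spares all the estimates the symmetry condition; \<open>wt s c\<close> is the square-summable
  family whose norm is \<open>hnorm s c\<close>.
\<close>

definition hs :: "real \<Rightarrow> (freq \<Rightarrow> complex) \<Rightarrow> bool" where
  "hs s c \<longleftrightarrow> (\<lambda>k. jap k powr s * (cmod (c k))\<^sup>2) summable_on UNIV"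

definition hnorm :: "real \<Rightarrow> (freq \<Rightarrow> complex) \<Rightarrow> real" where
  "hnorm s c = sqrt (\<Sum>\<^sub>\<infinity>k. jap k powr s * (cmod (c k))\<^sup>2)"

definition wt :: "real \<Rightarrow> (freq \<Rightarrow> complex) \<Rightarrow> freq \<Rightarrow> real" where
  "wt s c k = jap k powr (s / 2) * cmod (c k)"

lemma Sobolev_hs: "u \<in> Sobolev s \<longleftrightarrow> hs s (fourier u)"
  by (simp add: Sobolev_def hs_def jap_def)

lemma Sobolev_norm_hnorm: "Sobolev_norm s u = hnorm s (fourier u)"
  by (simp add: Sobolev_norm_def hnorm_def jap_def)

lemma wt_square: "(wt s c k)\<^sup>2 = jap k powr s * (cmod (c k))\<^sup>2"
  using jap_pos[of k] by (simp add: wt_def power_mult_distrib powr_power)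

lemma wt_nonneg: "0 \<le> wt s c k" by (simp add: wt_def)

lemma hs_wt: "hs s c \<longleftrightarrow> (\<lambda>k. (wt s c k)\<^sup>2) summable_on UNIV"
  by (simp add: hs_def wt_square)

lemma hnorm_wt: "hnorm s c = sqrt (\<Sum>\<^sub>\<infinity>k. (wt s c k)\<^sup>2)"
  by (simp add: hnorm_def wt_square)

lemma hnorm_nonneg: "0 \<le> hnorm s c"
  unfolding hnorm_wt by (simp add: infsum_nonneg)

lemma hnorm_square: "(hnorm s c)\<^sup>2 = (\<Sum>\<^sub>\<infinity>k. (wt s c k)\<^sup>2)"
  unfolding hnorm_wt by (simp add: infsum_nonneg)

lemma hs_sum_le: "hs s c \<Longrightarrow> finite F \<Longrightarrow> (\<Sum>k\<in>F. (wt s c k)\<^sup>2) \<le> (hnorm s c)\<^sup>2"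
  unfolding hnorm_square hs_wt by (intro finite_sum_le_infsum) auto

lemma hs_L2_set_le: "hs s c \<Longrightarrow> finite F \<Longrightarrow> L2_set (wt s c) F \<le> hnorm s c"
  unfolding L2_set_def using hs_sum_le[of s c F] hnorm_nonneg[of s c]
  by (simp add: real_le_lsqrt sum_nonneg)

text \<open>
  Norms are computed on finite sets of frequencies; this and the next lemma pass to the limit.
\<close>

lemma hs_boundI:
  assumes "0 \<le> r" "\<And>F. finite F \<Longrightarrow> (\<Sum>k\<in>F. (wt s c k)\<^sup>2) \<le> r"
  shows "hs s c" "(hnorm s c)\<^sup>2 \<le> r"
proof -
  show hs: "hs s c"
    unfolding hs_wt by (rule nonneg_bdd_above_summable_on) (auto intro!: bdd_aboveI2 assms(2))
  then show "(hnorm s c)\<^sup>2 \<le> r"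
    unfolding hnorm_square hs_wt by (rule infsum_le_finite_sums) (rule assms(2))
qed

lemma hs_L2_setI:
  assumes "0 \<le> r" "\<And>F. finite F \<Longrightarrow> L2_set (wt s c) F \<le> r"
  shows "hs s c" "hnorm s c \<le> r"
proof -
  have "(\<Sum>k\<in>F. (wt s c k)\<^sup>2) \<le> r\<^sup>2" if "finite F" for F
    using assms(2)[OF that] unfolding L2_set_def by (rule sqrt_le_D)
  from hs_boundI[OF _ this] show "hs s c" "hnorm s c \<le> r"
    by (simp_all add: power2_le_imp_le[OF _ assms(1)])
qed

lemma wt_le_hnorm: "hs s c \<Longrightarrow> wt s c k \<le> hnorm s c"
  using hs_L2_set_le[of s c "{k}"] by (simp add: wt_nonneg)

lemma L2_wt_add: "L2_set (wt s (\<lambda>k. c k + d k)) F \<le> L2_set (wt s c) F + L2_set (wt s d) F"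
proof -
  have "L2_set (wt s (\<lambda>k. c k + d k)) F \<le> L2_set (\<lambda>k. wt s c k + wt s d k) F"
    by (intro L2_set_mono) (auto simp: wt_def norm_triangle_ineq mult_left_mono simp flip: distrib_left)
  also have "\<dots> \<le> L2_set (wt s c) F + L2_set (wt s d) F" by (rule L2_set_triangle_ineq)
  finally show ?thesis .
qed

lemma hs_add: "hs s c \<Longrightarrow> hs s d \<Longrightarrow> hs s (\<lambda>k. c k + d k)"
  and hnorm_add: "hs s c \<Longrightarrow> hs s d \<Longrightarrow> hnorm s (\<lambda>k. c k + d k) \<le> hnorm s c + hnorm s d"
proof -
  have *: "L2_set (wt s (\<lambda>k. c k + d k)) F \<le> hnorm s c + hnorm s d" if "hs s c" "hs s d" "finite F" for F
    using L2_wt_add[of s c d F] hs_L2_set_le[of s c F] hs_L2_set_le[of s d F] that by linarith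
  show "hs s c \<Longrightarrow> hs s d \<Longrightarrow> hs s (\<lambda>k. c k + d k)"
    "hs s c \<Longrightarrow> hs s d \<Longrightarrow> hnorm s (\<lambda>k. c k + d k) \<le> hnorm s c + hnorm s d"
    by (rule hs_L2_setI[OF _ *]; simp add: hnorm_nonneg)+
qed

lemma wt_scale: "wt s (\<lambda>k. a * c k) k = cmod a * wt s c k"
  by (simp add: wt_def norm_mult)

lemma hs_scale: "hs s c \<Longrightarrow> hs s (\<lambda>k. a * c k)"
  unfolding hs_wt wt_scale power_mult_distrib by (rule summable_on_cmult_right)

lemma hnorm_scale: "hs s c \<Longrightarrow> hnorm s (\<lambda>k. a * c k) = cmod a * hnorm s c"
  unfolding hnorm_wt wt_scale power_mult_distrib hs_wt
  by (simp add: infsum_cmult_right real_sqrt_mult)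

lemma wt_uminus: "wt s (\<lambda>k. - c k) = wt s c" by (simp add: wt_def fun_eq_iff)

lemma hs_uminus: "hs s (\<lambda>k. - c k) \<longleftrightarrow> hs s c" and hnorm_uminus: "hnorm s (\<lambda>k. - c k) = hnorm s c"
  by (simp_all add: hs_wt hnorm_wt wt_uminus)

lemma hs_diff: "hs s c \<Longrightarrow> hs s d \<Longrightarrow> hs s (\<lambda>k. c k - d k)"
  using hs_add[of s c "\<lambda>k. - d k"] by (simp add: hs_uminus)

lemma hnorm_diff: "hs s c \<Longrightarrow> hs s d \<Longrightarrow> hnorm s (\<lambda>k. c k - d k) \<le> hnorm s c + hnorm s d"
  using hnorm_add[of s c "\<lambda>k. - d k"] by (simp add: hs_uminus hnorm_uminus)

lemma hs_zero: "hs s (\<lambda>k. 0)" and hnorm_zero: "hnorm s (\<lambda>k. 0) = 0"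
  by (simp_all add: hs_wt hnorm_wt wt_def)

lemma hnorm_diff_ge: "hs s c \<Longrightarrow> hs s d \<Longrightarrow> \<bar>hnorm s c - hnorm s d\<bar> \<le> hnorm s (\<lambda>k. c k - d k)"
  using hnorm_add[of s "\<lambda>k. c k - d k" d] hnorm_add[of s "\<lambda>k. d k - c k" c]
    hs_diff[of s c d] hs_diff[of s d c] hnorm_uminus[of s "\<lambda>k. d k - c k"] by simp

lemma hs_mono: "s \<le> s' \<Longrightarrow> hs s' c \<Longrightarrow> hs s c"
  unfolding hs_def using jap_ge1
  by (rule_tac summable_on_comparison_test) (auto intro!: mult_right_mono powr_mono)

subsection \<open>Bilinear estimates\<close>

text \<open>
  Peetre's inequality.
\<close>

lemma jap_le_mult: "jap j \<le> 2 * jap k * jap (k - j)"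
proof -
  have sq: "(a :: real)\<^sup>2 \<le> 2 * b\<^sup>2 + 2 * (b - a)\<^sup>2" for a b
    using zero_le_power2[of "a - 2 * b"] by (simp add: power2_eq_square algebra_simps)
  have "freq_sq j \<le> 2 * freq_sq k + 2 * freq_sq (k - j)"
    using sq[of "of_int (fst j)" "of_int (fst k)"] sq[of "of_int (snd j)" "of_int (snd k)"]
    by (simp add: freq_sq_def)
  moreover have "0 \<le> freq_sq k * freq_sq (k - j)" by (simp add: freq_sq_nonneg)
  moreover have "2 * (1 + a) * (1 + b) = 2 + 2 * a + 2 * b + 2 * (a * b)" for a b :: real
    by (simp add: algebra_simps)
  ultimately show ?thesis unfolding jap_def by simp
qed

lemma bij_shear: "bij_betw (\<lambda>(k, j). (k - j, j)) (UNIV :: (freq \<times> freq) set) UNIV"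
  by (rule bij_betw_byWitness[where f' = "\<lambda>(m, j). (m + j, j)"]) auto

lemma bij_reflect: "bij_betw (\<lambda>j :: freq. k - j) UNIV UNIV"
  by (rule bij_betw_byWitness[where f' = "\<lambda>j. k - j"]) auto

lemma square_convolution:
  fixes A B :: "freq \<Rightarrow> real"
  assumes A: "(\<lambda>j. (A j)\<^sup>2) summable_on UNIV" and B: "(\<lambda>j. (B j)\<^sup>2) summable_on UNIV"
  shows "(\<lambda>j. (A (k - j) * B j)\<^sup>2) summable_on UNIV"
    and "finite F \<Longrightarrow> (\<Sum>k\<in>F. \<Sum>\<^sub>\<infinity>j. (A (k - j) * B j)\<^sup>2) \<le> (\<Sum>\<^sub>\<infinity>j. (A j)\<^sup>2) * (\<Sum>\<^sub>\<infinity>j. (B j)\<^sup>2)"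
proof -
  let ?P = "\<lambda>p. (A (fst p))\<^sup>2 * (B (snd p))\<^sup>2" and ?Q = "\<lambda>k j. (A (k - j) * B j)\<^sup>2"
  have "((\<lambda>p. ?P p) has_sum (\<Sum>\<^sub>\<infinity>j. (A j)\<^sup>2) * (\<Sum>\<^sub>\<infinity>j. (B j)\<^sup>2)) (UNIV \<times> UNIV)"
  proof (rule has_sum_SigmaI)
    show "((\<lambda>j. ?P (m, j)) has_sum (A m)\<^sup>2 * (\<Sum>\<^sub>\<infinity>j. (B j)\<^sup>2)) UNIV" for m
      using has_sum_cmult_right[OF has_sum_infsum[OF B], of "(A m)\<^sup>2"] by simp
    show "((\<lambda>m. (A m)\<^sup>2 * (\<Sum>\<^sub>\<infinity>j. (B j)\<^sup>2)) has_sum (\<Sum>\<^sub>\<infinity>j. (A j)\<^sup>2) * (\<Sum>\<^sub>\<infinity>j. (B j)\<^sup>2)) UNIV"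
      using has_sum_cmult_left[OF has_sum_infsum[OF A]] by simp
    show "?P summable_on UNIV \<times> UNIV"
    proof (rule summable_on_SigmaI)
      show "((\<lambda>j. ?P (m, j)) has_sum (A m)\<^sup>2 * (\<Sum>\<^sub>\<infinity>j. (B j)\<^sup>2)) UNIV" for m
        using has_sum_cmult_right[OF has_sum_infsum[OF B], of "(A m)\<^sup>2"] by simp
      show "(\<lambda>m. (A m)\<^sup>2 * (\<Sum>\<^sub>\<infinity>j. (B j)\<^sup>2)) summable_on UNIV"
        by (rule summable_on_cmult_left[OF A])
    qed auto
  qed
  then have "((\<lambda>p. ?P ((\<lambda>(k, j). (k - j, j)) p)) has_sum (\<Sum>\<^sub>\<infinity>j. (A j)\<^sup>2) * (\<Sum>\<^sub>\<infinity>j. (B j)\<^sup>2)) UNIV"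
    using has_sum_reindex_bij_betw[OF bij_shear, of ?P] by (simp only: UNIV_Times_UNIV)
  then have Q: "((\<lambda>(k, j). ?Q k j) has_sum (\<Sum>\<^sub>\<infinity>j. (A j)\<^sup>2) * (\<Sum>\<^sub>\<infinity>j. (B j)\<^sup>2)) (UNIV \<times> UNIV)"
    by (simp add: split_def power_mult_distrib)
  then have sQ: "(\<lambda>(k, j). ?Q k j) summable_on (UNIV \<times> UNIV)" by (rule has_sum_imp_summable)
  show 1: "(\<lambda>j. ?Q k j) summable_on UNIV" for k
    using summable_on_SigmaD1[OF sQ, of k] by simp
  have "((\<lambda>k. \<Sum>\<^sub>\<infinity>j. ?Q k j) has_sum (\<Sum>\<^sub>\<infinity>j. (A j)\<^sup>2) * (\<Sum>\<^sub>\<infinity>j. (B j)\<^sup>2)) UNIV"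
    by (rule has_sum_SigmaD[OF Q]) (simp add: 1)
  then show "finite F \<Longrightarrow> (\<Sum>k\<in>F. \<Sum>\<^sub>\<infinity>j. ?Q k j) \<le> (\<Sum>\<^sub>\<infinity>j. (A j)\<^sup>2) * (\<Sum>\<^sub>\<infinity>j. (B j)\<^sup>2)"
    by (rule finite_sum_le_has_sum) (auto intro!: infsum_nonneg)
qed

text \<open>
  Cauchy-Schwarz in \<open>j\<close> for each fixed \<open>k\<close>: a kernel whose rows are bounded in square sum defines a
  bounded bilinear form of convolution type.
\<close>

lemma kernel_bilinear_bound:
  fixes A B :: "freq \<Rightarrow> real"
  assumes A: "(\<lambda>j. (A j)\<^sup>2) summable_on UNIV" and B: "(\<lambda>j. (B j)\<^sup>2) summable_on UNIV"
    and W: "\<And>k. (\<lambda>j. (W k j)\<^sup>2) summable_on UNIV" "\<And>k. (\<Sum>\<^sub>\<infinity>j. (W k j)\<^sup>2) \<le> M"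
  shows "(\<lambda>j. \<bar>W k j * (A (k - j) * B j)\<bar>) summable_on UNIV"
    and "finite F \<Longrightarrow> (\<Sum>k\<in>F. (\<Sum>\<^sub>\<infinity>j. \<bar>W k j * (A (k - j) * B j)\<bar>)\<^sup>2) \<le> M * ((\<Sum>\<^sub>\<infinity>j. (A j)\<^sup>2) * (\<Sum>\<^sub>\<infinity>j. (B j)\<^sup>2))"
proof -
  note conv = square_convolution[OF A B]
  show "(\<lambda>j. \<bar>W k j * (A (k - j) * B j)\<bar>) summable_on UNIV" for k
    by (rule infsum_square_Cauchy_Schwarz[OF W(1) conv(1)])
  have M: "0 \<le> M" using W(2)[of 0] infsum_nonneg[of UNIV "\<lambda>j. (W 0 j)\<^sup>2"] by simp
  have "(\<Sum>\<^sub>\<infinity>j. \<bar>W k j * (A (k - j) * B j)\<bar>)\<^sup>2 \<le> M * (\<Sum>\<^sub>\<infinity>j. (A (k - j) * B j)\<^sup>2)" for k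
  proof -
    have "(\<Sum>\<^sub>\<infinity>j. \<bar>W k j * (A (k - j) * B j)\<bar>)\<^sup>2
      \<le> (sqrt (\<Sum>\<^sub>\<infinity>j. (W k j)\<^sup>2) * sqrt (\<Sum>\<^sub>\<infinity>j. (A (k - j) * B j)\<^sup>2))\<^sup>2"
      by (intro power_mono infsum_square_Cauchy_Schwarz W conv infsum_nonneg) auto
    also have "\<dots> = (\<Sum>\<^sub>\<infinity>j. (W k j)\<^sup>2) * (\<Sum>\<^sub>\<infinity>j. (A (k - j) * B j)\<^sup>2)"
      by (simp add: power_mult_distrib infsum_nonneg)
    also have "\<dots> \<le> M * (\<Sum>\<^sub>\<infinity>j. (A (k - j) * B j)\<^sup>2)"
      by (intro mult_right_mono W infsum_nonneg) auto
    finally show ?thesis .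
  qed
  then have "(\<Sum>k\<in>F. (\<Sum>\<^sub>\<infinity>j. \<bar>W k j * (A (k - j) * B j)\<bar>)\<^sup>2) \<le> M * (\<Sum>k\<in>F. \<Sum>\<^sub>\<infinity>j. (A (k - j) * B j)\<^sup>2)"
    by (simp add: sum_distrib_left sum_mono)
  also assume "finite F"
  then have "M * (\<Sum>k\<in>F. \<Sum>\<^sub>\<infinity>j. (A (k - j) * B j)\<^sup>2) \<le> M * ((\<Sum>\<^sub>\<infinity>j. (A j)\<^sup>2) * (\<Sum>\<^sub>\<infinity>j. (B j)\<^sup>2))"
    by (intro mult_left_mono conv M)
  finally show "(\<Sum>k\<in>F. (\<Sum>\<^sub>\<infinity>j. \<bar>W k j * (A (k - j) * B j)\<bar>)\<^sup>2) \<le> M * ((\<Sum>\<^sub>\<infinity>j. (A j)\<^sup>2) * (\<Sum>\<^sub>\<infinity>j. (B j)\<^sup>2))" .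
qed

text \<open>
  The size of a term of the convolution of \<open>K * x\<close> with \<open>y\<close>, as the Biot-Savart symbol at the frequency
  \<open>k - j\<close> is bounded by the inverse square root of \<open>jap (k - j)\<close>. All bounds of the nonlinearity are bounds
  of this convolution of nonnegative families.
\<close>

definition bterm :: "(freq \<Rightarrow> complex) \<Rightarrow> (freq \<Rightarrow> complex) \<Rightarrow> freq \<Rightarrow> freq \<Rightarrow> real" where
  "bterm x y k j = jap (k - j) powr (- 1 / 2) * cmod (x (k - j)) * cmod (y j)"

definition bconv :: "(freq \<Rightarrow> complex) \<Rightarrow> (freq \<Rightarrow> complex) \<Rightarrow> freq \<Rightarrow> real" where
  "bconv x y k = (\<Sum>\<^sub>\<infinity>j. bterm x y k j)"

definition bsummable :: "(freq \<Rightarrow> complex) \<Rightarrow> (freq \<Rightarrow> complex) \<Rightarrow> bool" where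
  "bsummable x y \<longleftrightarrow> (\<forall>k. bterm x y k summable_on UNIV)"

lemma bterm_nonneg: "0 \<le> bterm x y k j" by (simp add: bterm_def)

lemma bconv_nonneg: "0 \<le> bconv x y k"
  unfolding bconv_def by (simp add: infsum_nonneg bterm_nonneg)

lemma bconv_pointwise:
  assumes "hs s x" "hs r y" and M: "0 \<le> M" "\<And>j. bterm x y k j \<le> M * (wt s x (k - j) * wt r y j)"
  shows "bterm x y k summable_on UNIV" "bconv x y k \<le> M * (hnorm s x * hnorm r y)"
proof -
  have x: "(\<lambda>j. (wt s x (k - j))\<^sup>2) summable_on UNIV" "(\<Sum>\<^sub>\<infinity>j. (wt s x (k - j))\<^sup>2) = (\<Sum>\<^sub>\<infinity>j. (wt s x j)\<^sup>2)"
    using assms(1) summable_on_reindex_bij_betw[OF bij_reflect[of k], of "\<lambda>j. (wt s x j)\<^sup>2"]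
      infsum_reindex_bij_betw[OF bij_reflect[of k], of "\<lambda>j. (wt s x j)\<^sup>2"] by (simp_all add: hs_wt)
  have y: "(\<lambda>j. (wt r y j)\<^sup>2) summable_on UNIV" using assms(2) by (simp add: hs_wt)
  note cs = infsum_square_Cauchy_Schwarz[OF x(1) y]
  have abs: "\<bar>wt s x (k - j) * wt r y j\<bar> = wt s x (k - j) * wt r y j" for j by (simp add: wt_nonneg)
  note sum = summable_on_cmult_right[OF cs(1)[unfolded abs], of M]
  show b: "bterm x y k summable_on UNIV"
    by (rule summable_on_comparison_test[OF sum]) (auto simp: M bterm_nonneg)
  have "bconv x y k \<le> (\<Sum>\<^sub>\<infinity>j. M * (wt s x (k - j) * wt r y j))"
    unfolding bconv_def by (intro infsum_mono b sum M)
  also have "\<dots> = M * (\<Sum>\<^sub>\<infinity>j. wt s x (k - j) * wt r y j)"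
    by (rule infsum_cmult_right) (use cs(1) in \<open>simp add: abs\<close>)
  also have "\<dots> \<le> M * (hnorm s x * hnorm r y)"
    using cs(2) M(1) by (intro mult_left_mono) (simp_all add: abs hnorm_wt x(2))
  finally show "bconv x y k \<le> M * (hnorm s x * hnorm r y)" .
qed

lemma powr_half_jap: "jap k powr (1 / 2) = sqrt (jap k)"
  using jap_pos[of k] by (simp add: powr_half_sqrt)

lemma cmod_eq_wt: "cmod (c k) = jap k powr (- s / 2) * wt s c k"
  using jap_pos[of k] by (simp add: wt_def powr_minus divide_simps)

text \<open>
  The two following estimates hold at every time, where \<open>\<xi>\<close> is only known to be square integrable. They
  show that the products are distributions, with coefficients that grow at most like \<open>jap k\<close>.
\<close>

lemma bconv_neg_L2:
  assumes s: "- 1 \<le> s" "s \<le> 0" and x: "hs s x" and y: "hs 0 y"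
  shows "bterm x y k summable_on UNIV" "bconv x y k \<le> hnorm s x * hnorm 0 y"
proof -
  have "bterm x y k j \<le> 1 * (wt s x (k - j) * wt 0 y j)" for j
    unfolding bterm_def wt_def using s jap_ge1[of "k - j"] jap_ge1[of j]
    by (auto intro!: mult_right_mono powr_mono simp: less_le_trans[OF zero_less_one jap_ge1])
  from bconv_pointwise[OF x y _ this]
  show "bterm x y k summable_on UNIV" "bconv x y k \<le> hnorm s x * hnorm 0 y" by simp_all
qed

lemma bconv_L2_neg:
  assumes s: "- 1 \<le> s" "s \<le> 0" and x: "hs 0 x" and y: "hs s y"
  shows "bterm x y k summable_on UNIV" "bconv x y k \<le> 2 * jap k * (hnorm 0 x * hnorm s y)"
proof -
  have "bterm x y k j \<le> (2 * jap k) * (wt 0 x (k - j) * wt s y j)" for j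
  proof -
    have "jap (k - j) powr (- 1 / 2) \<le> 2 * jap k * jap j powr (s / 2)"
    proof -
      have "jap j powr (- (s / 2)) \<le> jap j powr (1 / 2)"
        using s jap_ge1 by (intro powr_mono) auto
      also have "\<dots> \<le> (2 * jap k * jap (k - j)) powr (1 / 2)"
        using jap_pos[of j] by (intro powr_mono2 jap_le_mult) auto
      also have "\<dots> = (2 * jap k) powr (1 / 2) * jap (k - j) powr (1 / 2)"
        using jap_pos[of k] jap_pos[of "k - j"] by (simp add: powr_mult)
      also have "\<dots> \<le> (2 * jap k) powr 1 * jap (k - j) powr (1 / 2)"
        using jap_ge1[of k] by (intro mult_right_mono powr_mono) auto
      finally have "jap j powr (- (s / 2)) \<le> 2 * jap k * jap (k - j) powr (1 / 2)"
        using jap_pos[of k] by simp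
      then show ?thesis
        using jap_pos[of j] jap_pos[of "k - j"] by (simp add: powr_minus divide_simps mult_ac)
    qed
    then have "jap (k - j) powr (- 1 / 2) * (cmod (x (k - j)) * cmod (y j))
        \<le> 2 * jap k * jap j powr (s / 2) * (cmod (x (k - j)) * cmod (y j))"
      by (rule mult_right_mono) simp
    then show ?thesis
      using jap_pos[of "k - j"] by (simp add: bterm_def wt_def mult_ac)
  qed
  from bconv_pointwise[OF x y _ this]
  show "bterm x y k summable_on UNIV" "bconv x y k \<le> 2 * jap k * (hnorm 0 x * hnorm s y)"
    using jap_pos[of k] by simp_all
qed

lemma jap_powr_square: "(jap k powr a)\<^sup>2 = jap k powr (2 * a)"
  by (simp add: power2_eq_square flip: powr_add)

definition kernel_const :: "real \<Rightarrow> real" where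
  "kernel_const s = 2 * (\<Sum>\<^sub>\<infinity>k. jap k powr (- (2 + s)))"

lemma kernel_const_nonneg: "0 \<le> kernel_const s"
  by (simp add: kernel_const_def infsum_nonneg)

lemma summable_reflect: "-1 < s \<Longrightarrow> (\<lambda>j. jap (k - j) powr (- (2 + s))) summable_on UNIV"
  "-1 < s \<Longrightarrow> (\<Sum>\<^sub>\<infinity>j. jap (k - j) powr (- (2 + s))) = kernel_const s / 2"
  using summable_on_reindex_bij_betw[OF bij_reflect[of k], of "\<lambda>j. jap j powr (- (2 + s))"]
    infsum_reindex_bij_betw[OF bij_reflect[of k], of "\<lambda>j. jap j powr (- (2 + s))"]
    summable_jap_powr[of "2 + s"]
  by (simp_all add: kernel_const_def)

text \<open>
  The shape in which \<open>kernel_bilinear_bound\<close> is applied: all Sobolev weights are moved into the kernel \<open>W\<close>.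
\<close>

lemma bconv_kernel:
  assumes x: "hs r x" and y: "hs r' y"
    and W: "\<And>k j. 0 \<le> W k j" "\<And>k. (\<lambda>j. (W k j)\<^sup>2) summable_on UNIV" "\<And>k. (\<Sum>\<^sub>\<infinity>j. (W k j)\<^sup>2) \<le> M"
    and eq: "\<And>k j. jap k powr (s / 2) * bterm x y k j = W k j * (wt r x (k - j) * wt r' y j)"
  shows "bsummable x y"
    and "finite F \<Longrightarrow> (\<Sum>k\<in>F. (jap k powr (s / 2) * bconv x y k)\<^sup>2) \<le> M * ((hnorm r x)\<^sup>2 * (hnorm r' y)\<^sup>2)"
proof -
  note kb = kernel_bilinear_bound[where W = W, OF x[unfolded hs_wt] y[unfolded hs_wt] W(2,3)]
  have abs: "\<bar>W k j * (wt r x (k - j) * wt r' y j)\<bar> = jap k powr (s / 2) * bterm x y k j" for k j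
    by (simp add: W wt_nonneg eq)
  have *: "bterm x y k summable_on UNIV" for k
    using summable_on_cmult_right[OF kb(1)[where k = k, unfolded abs], of "jap k powr (- s / 2)"] jap_pos[of k]
    by (simp add: powr_minus divide_simps flip: mult.assoc)
  then show "bsummable x y" by (simp add: bsummable_def)
  have "jap k powr (s / 2) * bconv x y k = (\<Sum>\<^sub>\<infinity>j. \<bar>W k j * (wt r x (k - j) * wt r' y j)\<bar>)" for k
    unfolding bconv_def abs by (rule infsum_cmult_right[symmetric]) (rule *)
  then show "finite F \<Longrightarrow> (\<Sum>k\<in>F. (jap k powr (s / 2) * bconv x y k)\<^sup>2) \<le> M * ((hnorm r x)\<^sup>2 * (hnorm r' y)\<^sup>2)"
    using kb(2)[of F] by (simp add: hnorm_square)
qed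

text \<open>
  The estimate of \<open>(K * x) y\<close> for \<open>x\<close> in \<open>H\<^sup>s\<close>, so that \<open>K * x\<close> has \<open>1 + s > 0\<close> derivatives, and \<open>y\<close> in
  \<open>H\<^sup>1\<close>. The square of the kernel is at most \<open>jap (k - j) powr - (1 + s) / jap j\<close>, hence at most the power
  \<open>- (2 + s)\<close> of the smaller of the two weights, and this is summable in two dimensions.
\<close>

lemma bconv_neg_H1:
  assumes s: "- 1 < s" "s \<le> 0" and x: "hs s x" and y: "hs 1 y"
  shows "bsummable x y"
    "finite F \<Longrightarrow> (\<Sum>k\<in>F. (jap k powr (s / 2) * bconv x y k)\<^sup>2) \<le> kernel_const s * ((hnorm s x)\<^sup>2 * (hnorm 1 y)\<^sup>2)"
proof -
  define W where "W k j = jap k powr (s / 2) * jap (k - j) powr (- (1 + s) / 2) * jap j powr (- 1 / 2)" for k j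
  have le: "(W k j)\<^sup>2 \<le> jap (k - j) powr (- (2 + s)) + jap j powr (- (2 + s))" for k j
  proof -
    have "(W k j)\<^sup>2 = jap k powr s * (jap (k - j) powr (- (1 + s)) * jap j powr (- 1))"
      by (simp only: W_def power_mult_distrib jap_powr_square mult.assoc) (simp add: diff_divide_distrib)
    also have "\<dots> \<le> 1 * (jap (k - j) powr (- (1 + s)) * jap j powr (- 1))"
      using s jap_ge1[of k] powr_mono[of s 0 "jap k"] by (intro mult_right_mono) auto
    also have "jap (k - j) powr (- (1 + s)) * jap j powr (- 1) \<le> jap (k - j) powr (- (2 + s)) + jap j powr (- (2 + s))"
    proof (cases "jap j \<le> jap (k - j)")
      case True
      then have "jap (k - j) powr (- (1 + s)) * jap j powr (- 1) \<le> jap j powr (- (1 + s)) * jap j powr (- 1)"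
        using s jap_pos by (intro mult_right_mono powr_mono2') auto
      also have "\<dots> = jap j powr (- (2 + s))"
        by (simp only: powr_add[symmetric]) (rule arg_cong, simp)
      finally show ?thesis by (simp add: add_increasing)
    next
      case False
      then have "jap (k - j) powr (- (1 + s)) * jap j powr (- 1) \<le> jap (k - j) powr (- (1 + s)) * jap (k - j) powr (- 1)"
        using s jap_pos by (intro mult_left_mono powr_mono2') auto
      also have "\<dots> = jap (k - j) powr (- (2 + s))"
        by (simp only: powr_add[symmetric]) (rule arg_cong, simp)
      finally show ?thesis by (simp add: add_increasing2)
    qed
    finally show ?thesis by simp
  qed
  have sum: "(\<lambda>j. jap (k - j) powr (- (2 + s)) + jap j powr (- (2 + s))) summable_on UNIV"
    "(\<Sum>\<^sub>\<infinity>j. jap (k - j) powr (- (2 + s)) + jap j powr (- (2 + s))) = kernel_const s" for k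
    using summable_reflect[OF s(1), of k] summable_jap_powr[of "2 + s"] s
    by (auto intro!: summable_on_add simp: infsum_add kernel_const_def)
  have W: "(\<lambda>j. (W k j)\<^sup>2) summable_on UNIV" for k
    by (rule summable_on_comparison_test[OF sum(1)[of k]]) (simp_all only: le zero_le_power2)
  have Ws: "(\<Sum>\<^sub>\<infinity>j. (W k j)\<^sup>2) \<le> kernel_const s" for k
    using infsum_mono[OF W sum(1) le] by (simp only: sum(2))
  have eq: "jap k powr (s / 2) * bterm x y k j = W k j * (wt s x (k - j) * wt 1 y j)" for k j
  proof -
    have "jap (k - j) powr (- (1 + s) / 2) * jap (k - j) powr (s / 2) = jap (k - j) powr (- 1 / 2)"
      by (simp add: field_simps flip: powr_add)
    moreover have "jap j powr (- 1 / 2) * jap j powr (1 / 2) = 1"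
      using jap_pos[of j] by (simp flip: powr_add)
    moreover have "W k j * (wt s x (k - j) * wt 1 y j) = jap k powr (s / 2)
        * (jap (k - j) powr (- (1 + s) / 2) * jap (k - j) powr (s / 2)) * cmod (x (k - j))
        * ((jap j powr (- 1 / 2) * jap j powr (1 / 2)) * cmod (y j))"
      by (simp only: W_def wt_def mult_ac)
    ultimately show ?thesis by (simp add: bterm_def mult.assoc)
  qed
  have nn: "0 \<le> W k j" for k j by (simp add: W_def)
  show "bsummable x y"
    "finite F \<Longrightarrow> (\<Sum>k\<in>F. (jap k powr (s / 2) * bconv x y k)\<^sup>2) \<le> kernel_const s * ((hnorm s x)\<^sup>2 * (hnorm 1 y)\<^sup>2)"
    using bconv_kernel[where W = W and M = "kernel_const s" and s = s, OF x y nn W Ws eq] by simp_all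
qed

text \<open>
  The estimate of \<open>(K * x) y\<close> for \<open>x\<close> in \<open>H\<^sup>1\<close>, so that \<open>K * x\<close> has two derivatives, and \<open>y\<close> in \<open>H\<^sup>s\<close>. Peetre's
  inequality moves the weight \<open>s\<close> from \<open>j\<close> to \<open>k\<close> at the cost of \<open>- s\<close> of the two derivatives; again the
  power \<open>- (2 + s)\<close> of the weight remains. The case \<open>s = 0\<close> is used in the energy estimate.
\<close>

lemma bconv_H1_neg:
  assumes s: "- 1 < s" "s \<le> 0" and x: "hs 1 x" and y: "hs s y"
  shows "bsummable x y"
    "finite F \<Longrightarrow> (\<Sum>k\<in>F. (jap k powr (s / 2) * bconv x y k)\<^sup>2) \<le> kernel_const s * ((hnorm 1 x)\<^sup>2 * (hnorm s y)\<^sup>2)"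
proof -
  define W where "W k j = jap k powr (s / 2) * jap (k - j) powr (- 1) * jap j powr (- s / 2)" for k j
  have le: "(W k j)\<^sup>2 \<le> 2 * jap (k - j) powr (- (2 + s))" for k j
  proof -
    have "(W k j)\<^sup>2 = jap k powr s * jap (k - j) powr (- 2) * jap j powr (- s)"
      by (simp only: W_def power_mult_distrib jap_powr_square) simp
    also have "\<dots> \<le> jap k powr s * jap (k - j) powr (- 2) * (2 * jap k * jap (k - j)) powr (- s)"
      using s jap_pos[of j] by (intro mult_left_mono powr_mono2 jap_le_mult) auto
    also have "\<dots> = 2 powr (- s) * (jap k powr s * jap k powr (- s)) * (jap (k - j) powr (- 2) * jap (k - j) powr (- s))"
      using jap_pos[of k] jap_pos[of "k - j"] by (simp add: powr_mult)
    also have "\<dots> = 2 powr (- s) * jap (k - j) powr (- (2 + s))"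
      using jap_pos[of k] by (simp flip: powr_add)
    also have "\<dots> \<le> 2 * jap (k - j) powr (- (2 + s))"
      using s powr_mono[of "- s" 1 2] by (intro mult_right_mono) auto
    finally show ?thesis .
  qed
  have sum: "(\<lambda>j. 2 * jap (k - j) powr (- (2 + s))) summable_on UNIV"
    "(\<Sum>\<^sub>\<infinity>j. 2 * jap (k - j) powr (- (2 + s))) = kernel_const s" for k
    using summable_reflect[OF s(1), of k]
    by (auto intro!: summable_on_cmult_right simp: infsum_cmult_right)
  have W: "(\<lambda>j. (W k j)\<^sup>2) summable_on UNIV" for k
    by (rule summable_on_comparison_test[OF sum(1)[of k]]) (simp_all only: le zero_le_power2)
  have Ws: "(\<Sum>\<^sub>\<infinity>j. (W k j)\<^sup>2) \<le> kernel_const s" for k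
    using infsum_mono[OF W sum(1) le] by (simp only: sum(2))
  have eq: "jap k powr (s / 2) * bterm x y k j = W k j * (wt 1 x (k - j) * wt s y j)" for k j
  proof -
    have "jap (k - j) powr (- 1) * jap (k - j) powr (1 / 2) = jap (k - j) powr (- 1 / 2)"
      by (simp only: powr_add[symmetric]) (rule arg_cong, simp)
    moreover have "jap j powr (- s / 2) * jap j powr (s / 2) = 1"
      using jap_pos[of j] by (simp flip: powr_add)
    moreover have "W k j * (wt 1 x (k - j) * wt s y j) = jap k powr (s / 2)
        * (jap (k - j) powr (- 1) * jap (k - j) powr (1 / 2)) * cmod (x (k - j))
        * ((jap j powr (- s / 2) * jap j powr (s / 2)) * cmod (y j))"
      by (simp only: W_def wt_def mult_ac)
    ultimately show ?thesis by (simp add: bterm_def mult.assoc)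
  qed
  have nn: "0 \<le> W k j" for k j by (simp add: W_def)
  show "bsummable x y"
    "finite F \<Longrightarrow> (\<Sum>k\<in>F. (jap k powr (s / 2) * bconv x y k)\<^sup>2) \<le> kernel_const s * ((hnorm 1 x)\<^sup>2 * (hnorm s y)\<^sup>2)"
    using bconv_kernel[where W = W and M = "kernel_const s" and s = s, OF x y nn W Ws eq] by simp_all
qed

section \<open>The transport nonlinearity in Fourier variables\<close>

text \<open>
  The symbol of \<open>(K * x) \<cdot> \<nabla>y\<close>, in divergence form: the factor \<open>2 \<pi> \<i> k\<close> of the divergence times the symbol
  of the Biot-Savart kernel at \<open>k - j\<close>. The denominator vanishes together with the numerator at \<open>j = k\<close>, where
  the value is \<open>0\<close>.
\<close>

definition adv_symbol :: "freq \<Rightarrow> freq \<Rightarrow> real" where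
  "adv_symbol k j = (of_int (fst k) * of_int (snd j) - of_int (snd k) * of_int (fst j)) / freq_sq (k - j)"

definition adv :: "(freq \<Rightarrow> complex) \<Rightarrow> (freq \<Rightarrow> complex) \<Rightarrow> freq \<Rightarrow> complex" where
  "adv x y k = (\<Sum>\<^sub>\<infinity>j. of_real (adv_symbol k j) * (x (k - j) * y j))"

lemma inverse_sqrt_freq_sq_le: "1 / sqrt (freq_sq m) \<le> 2 * jap m powr (- 1 / 2)"
proof (cases "m = 0")
  case False
  then have "fst m \<noteq> 0 \<or> snd m \<noteq> 0" by (simp add: prod_eq_iff)
  then have "(1 :: int) \<le> (fst m)\<^sup>2 + (snd m)\<^sup>2"
    by (metis add_le_same_cancel1 int_one_le_iff_zero_less not_sum_power2_lt_zero sum_power2_gt_zero_iff)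
  then have "(1 :: real) \<le> freq_sq m"
    unfolding freq_sq_def by (metis of_int_1 of_int_add of_int_le_iff of_int_power)
  then have "jap m \<le> 4 * freq_sq m" by (simp add: jap_def)
  then have "sqrt (jap m) \<le> 2 * sqrt (freq_sq m)"
    using real_sqrt_le_mono[of "jap m" "4 * freq_sq m"] by (simp add: real_sqrt_mult)
  moreover have "0 < sqrt (freq_sq m)" using \<open>1 \<le> freq_sq m\<close> by simp
  ultimately show ?thesis
    using jap_pos[of m] powr_half_jap[of m] by (simp add: powr_minus divide_simps mult.commute)
qed (simp add: freq_sq_def)

text \<open>
  The numerator is the determinant of \<open>k\<close> and \<open>j\<close>, which is that of \<open>k\<close> and \<open>j - k\<close>; so it is at most the
  product of the lengths of \<open>k\<close> and \<open>k - j\<close>. The factor \<open>|k|\<close> is the derivative taken by the divergence.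
\<close>

lemma adv_symbol_le: "\<bar>adv_symbol k j\<bar> \<le> 2 * sqrt (freq_sq k) * jap (k - j) powr (- 1 / 2)"
proof -
  let ?m = "k - j"
  let ?k1 = "of_int (fst k) :: real" and ?k2 = "of_int (snd k) :: real"
  let ?m1 = "of_int (fst ?m) :: real" and ?m2 = "of_int (snd ?m) :: real"
  have num: "?k1 * of_int (snd j) - ?k2 * of_int (fst j) = ?k2 * ?m1 - ?k1 * ?m2"
    by (simp add: algebra_simps)
  have "(?k2 * ?m1 - ?k1 * ?m2)\<^sup>2 \<le> freq_sq k * freq_sq ?m"
    using zero_le_power2[of "?k1 * ?m1 + ?k2 * ?m2"]
    by (simp add: freq_sq_def power2_eq_square algebra_simps del: fst_diff snd_diff of_int_diff)
  then have "\<bar>?k2 * ?m1 - ?k1 * ?m2\<bar> \<le> sqrt (freq_sq k) * sqrt (freq_sq ?m)"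
    by (metis real_sqrt_abs real_sqrt_le_mono real_sqrt_mult)
  then have "\<bar>adv_symbol k j\<bar> \<le> sqrt (freq_sq k) * sqrt (freq_sq ?m) / freq_sq ?m"
    unfolding adv_symbol_def num abs_divide using freq_sq_nonneg[of ?m] by (simp add: divide_right_mono)
  also have "\<dots> = sqrt (freq_sq k) * (1 / sqrt (freq_sq ?m))"
    using sqrt_divide_self_eq[OF freq_sq_nonneg[of ?m]] by (simp add: divide_inverse mult.assoc)
  also have "\<dots> \<le> sqrt (freq_sq k) * (2 * jap ?m powr (- 1 / 2))"
    using freq_sq_nonneg by (intro mult_left_mono inverse_sqrt_freq_sq_le) auto
  finally show ?thesis by simp
qed

lemma adv_term_le:
  "cmod (of_real (adv_symbol k j) * (x (k - j) * y j)) \<le> 2 * sqrt (freq_sq k) * bterm x y k j"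
  using mult_right_mono[OF adv_symbol_le[of k j], of "cmod (x (k - j)) * cmod (y j)"]
  by (simp add: norm_mult bterm_def mult.assoc)

lemma adv_abs_summable:
  assumes "bterm x y k summable_on UNIV"
  shows "(\<lambda>j. cmod (of_real (adv_symbol k j) * (x (k - j) * y j))) summable_on UNIV"
  by (rule summable_on_comparison_test[OF summable_on_cmult_right[OF assms, of "2 * sqrt (freq_sq k)"]])
    (simp_all only: adv_term_le norm_ge_zero)

lemma adv_le:
  assumes "bterm x y k summable_on UNIV"
  shows "cmod (adv x y k) \<le> 2 * sqrt (freq_sq k) * bconv x y k"
proof -
  have "cmod (adv x y k) \<le> (\<Sum>\<^sub>\<infinity>j. cmod (of_real (adv_symbol k j) * (x (k - j) * y j)))"
    unfolding adv_def by (intro norm_infsum_bound adv_abs_summable assms)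
  also have "\<dots> \<le> (\<Sum>\<^sub>\<infinity>j. 2 * sqrt (freq_sq k) * bterm x y k j)"
    by (intro infsum_mono adv_abs_summable assms summable_on_cmult_right adv_term_le)
  also have "\<dots> = 2 * sqrt (freq_sq k) * bconv x y k"
    unfolding bconv_def by (rule infsum_cmult_right) (rule assms)
  finally show ?thesis .
qed

lemma adv_zero_freq: "adv x y 0 = 0"
  by (simp add: adv_def adv_symbol_def)

lemma adv_summable:
  assumes "bterm x y k summable_on UNIV"
  shows "(\<lambda>j. of_real (adv_symbol k j) * (x (k - j) * y j)) summable_on UNIV"
  by (rule abs_summable_summable) (rule adv_abs_summable[OF assms])

lemma infsum_reflect_freq: "(\<Sum>\<^sub>\<infinity>j :: freq. f (- j)) = (\<Sum>\<^sub>\<infinity>j. f j)"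
  by (rule infsum_reindex_bij_betw[of uminus]) (rule bij_betw_byWitness[where f' = uminus]; auto)

lemma adv_uminus:
  assumes "\<And>k. x (- k) = cnj (x k)" "\<And>k. y (- k) = cnj (y k)"
  shows "adv x y (- k) = cnj (adv x y k)"
proof -
  have "freq_sq (- k - - j) = freq_sq (k - j)" for j by (simp add: freq_sq_def power2_commute)
  then have *: "adv_symbol (- k) (- j) = adv_symbol k j" for j by (simp add: adv_symbol_def)
  have x: "x (- k - - j) = cnj (x (k - j))" for j
    using assms(1)[of "k - j"] by simp
  have "adv x y (- k) = (\<Sum>\<^sub>\<infinity>j. of_real (adv_symbol (- k) (- j)) * (x (- k - - j) * y (- j)))"
    unfolding adv_def by (rule infsum_reflect_freq[symmetric])
  also have "\<dots> = (\<Sum>\<^sub>\<infinity>j. cnj (of_real (adv_symbol k j) * (x (k - j) * y j)))"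
    by (simp only: * x assms(2) complex_cnj_mult complex_cnj_complex_of_real)
  also have "\<dots> = cnj (adv x y k)" unfolding adv_def by (rule infsum_cnj)
  finally show ?thesis .
qed

subsection \<open>Multipliers, products and advection of distributions\<close>

lemma fourier_bounded_multiplier:
  assumes "\<And>k. cmod (m k) \<le> B" "\<And>k. m (- k) = cnj (m k)"
  shows "fourier (fourier_multiplier m u) k = m k * fourier u k"
proof -
  obtain C N where C: "\<And>k. cmod (fourier u k) \<le> C * jap k ^ N"
    using fourier_growth by blast
  have "cmod (m k * fourier u k) \<le> (B * C) * jap k ^ N" for k
    using mult_mono[OF assms(1) C] order_trans[OF norm_ge_zero assms(1)] by (simp add: norm_mult mult.assoc)
  then have "tempered (\<lambda>k. m k * fourier u k)"
    unfolding tempered_def assms(2) fourier_uminus complex_cnj_mult by blast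
  then show ?thesis unfolding fourier_multiplier_def by (simp add: fourier_distr_of_coeffs)
qed

lemma freq_sq_uminus: "freq_sq (- k) = freq_sq k" by (simp add: freq_sq_def)

lemma fourier_heat:
  assumes "0 \<le> t"
  shows "fourier (heat t u) k = of_real (exp (- (4 * pi\<^sup>2 * freq_sq k * t))) * fourier u k"
  unfolding heat_def
  by (rule fourier_bounded_multiplier[where B = 1])
    (use assms freq_sq_nonneg in \<open>auto simp: freq_sq_uminus\<close>)

lemma BS_symbol_le:
  "cmod (BS_symbol1 k) \<le> jap k powr (- 1 / 2)" "cmod (BS_symbol2 k) \<le> jap k powr (- 1 / 2)"
proof -
  have *: "\<bar>of_int i\<bar> / (2 * pi * freq_sq k) \<le> jap k powr (- 1 / 2)"
    if "(of_int i)\<^sup>2 \<le> freq_sq k" for i :: int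
  proof -
    have "\<bar>of_int i\<bar> \<le> sqrt (freq_sq k)"
      using real_sqrt_le_mono[OF that] by simp
    then have "\<bar>of_int i\<bar> / (2 * pi * freq_sq k) \<le> sqrt (freq_sq k) / (2 * pi * freq_sq k)"
      using freq_sq_nonneg[of k] by (intro divide_right_mono) auto
    also have "\<dots> = (1 / (2 * pi)) * (1 / sqrt (freq_sq k))"
    proof -
      have "sqrt (freq_sq k) / (2 * pi * freq_sq k) = (1 / (2 * pi)) * (sqrt (freq_sq k) / freq_sq k)"
        by simp
      then show ?thesis
        by (simp only: sqrt_divide_self_eq[OF freq_sq_nonneg] inverse_eq_divide)
    qed
    also have "\<dots> \<le> (1 / (2 * pi)) * (2 * jap k powr (- 1 / 2))"
      by (intro mult_left_mono inverse_sqrt_freq_sq_le) auto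
    also have "\<dots> = (1 / pi) * jap k powr (- 1 / 2)" by simp
    also have "\<dots> \<le> 1 * jap k powr (- 1 / 2)"
      using pi_ge_two by (intro mult_right_mono) (auto simp: field_simps)
    finally show ?thesis by simp
  qed
  have le: "(of_int (fst k))\<^sup>2 \<le> freq_sq k" "(of_int (snd k))\<^sup>2 \<le> freq_sq k"
    by (simp_all add: freq_sq_def)
  have "cmod (BS_symbol1 k) = \<bar>of_int (snd k)\<bar> / (2 * pi * freq_sq k)"
    "cmod (BS_symbol2 k) = \<bar>of_int (fst k)\<bar> / (2 * pi * freq_sq k)"
    by (simp_all add: BS_symbol1_def BS_symbol2_def norm_divide norm_mult freq_sq_nonneg)
  then show "cmod (BS_symbol1 k) \<le> jap k powr (- 1 / 2)" "cmod (BS_symbol2 k) \<le> jap k powr (- 1 / 2)"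
    using *[OF le(1)] *[OF le(2)] by simp_all
qed

lemma BS_symbol_uminus: "BS_symbol1 (- k) = cnj (BS_symbol1 k)" "BS_symbol2 (- k) = cnj (BS_symbol2 k)"
  by (simp_all add: BS_symbol1_def BS_symbol2_def freq_sq_uminus)

lemma fourier_biot_savart:
  "fourier (fst (biot_savart u)) k = BS_symbol1 k * fourier u k"
  "fourier (snd (biot_savart u)) k = BS_symbol2 k * fourier u k"
proof -
  have "jap k powr (- 1 / 2) \<le> 1" for k
    using powr_mono[of "- 1 / 2" 0 "jap k"] jap_ge1[of k] jap_pos[of k] by simp
  then show "fourier (fst (biot_savart u)) k = BS_symbol1 k * fourier u k"
    "fourier (snd (biot_savart u)) k = BS_symbol2 k * fourier u k"
    unfolding biot_savart_def fst_conv snd_conv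
    by (intro fourier_bounded_multiplier[where B = 1] BS_symbol_uminus order_trans[OF BS_symbol_le(1)]
        order_trans[OF BS_symbol_le(2)]; simp)+
qed

lemma fourier_distr_mult:
  assumes "\<And>k. cmod (\<Sum>\<^sub>\<infinity>j. fourier f (k - j) * fourier g j) \<le> C * jap k ^ N"
  shows "fourier (distr_mult f g) k = (\<Sum>\<^sub>\<infinity>j. fourier f (k - j) * fourier g j)"
proof -
  have "(\<Sum>\<^sub>\<infinity>j. fourier f (- k - j) * fourier g j) = cnj (\<Sum>\<^sub>\<infinity>j. fourier f (k - j) * fourier g j)" for k
  proof -
    have "(\<Sum>\<^sub>\<infinity>j. fourier f (- k - j) * fourier g j) = (\<Sum>\<^sub>\<infinity>j. fourier f (- k - - j) * fourier g (- j))"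
      by (rule infsum_reflect_freq[symmetric])
    also have "\<dots> = (\<Sum>\<^sub>\<infinity>j. cnj (fourier f (k - j) * fourier g j))"
      by (rule infsum_cong) (metis complex_cnj_mult fourier_uminus minus_diff_commute diff_minus_eq_add minus_diff_eq uminus_add_conv_diff)
    also have "\<dots> = cnj (\<Sum>\<^sub>\<infinity>j. fourier f (k - j) * fourier g j)" by (rule infsum_cnj)
    finally show ?thesis .
  qed
  with assms have "tempered (\<lambda>k. \<Sum>\<^sub>\<infinity>j. fourier f (k - j) * fourier g j)"
    unfolding tempered_def by blast
  then show ?thesis unfolding distr_mult_def by (simp add: fourier_distr_of_coeffs)
qed

lemma adv_symbol_BS:
  "2 * pi * \<i> * of_int (fst k) * BS_symbol1 (k - j) + 2 * pi * \<i> * of_int (snd k) * BS_symbol2 (k - j)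
     = of_real (adv_symbol k j)"
proof -
  have *: "2 * pi * \<i> * of_real a * (\<i> * of_real b / of_real (2 * pi * q)) + 2 * pi * \<i> * of_real c * (- \<i> * of_real d / of_real (2 * pi * q))
     = of_real ((c * d - a * b) / q)" for a b c d q :: real
    by (cases "q = 0") (simp_all add: field_simps complex_eq_iff power2_eq_square)
  have "of_int (snd k) * of_int (fst (k - j)) - of_int (fst k) * of_int (snd (k - j))
      = (of_int (fst k) * of_int (snd j) - of_int (snd k) * of_int (fst j) :: real)"
    by (simp add: algebra_simps)
  then show ?thesis
    using *[of "of_int (fst k)" "of_int (snd (k - j))" "freq_sq (k - j)" "of_int (snd k)" "of_int (fst (k - j))"]
    unfolding BS_symbol1_def BS_symbol2_def adv_symbol_def by (simp only: of_real_of_int_eq)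
qed

lemma fourier_advect:
  assumes sum: "bsummable (fourier u) (fourier v)"
    and growth: "\<And>k. bconv (fourier u) (fourier v) k \<le> C * jap k ^ N"
  shows "fourier (advect (biot_savart u) v) k = adv (fourier u) (fourier v) k"
proof -
  let ?t = "\<lambda>B k j. (B (k - j) * fourier u (k - j)) * fourier v j"
  have le: "cmod (?t B k j) \<le> bterm (fourier u) (fourier v) k j" if "\<And>k. cmod (B k) \<le> jap k powr (- 1 / 2)" for B k j
    unfolding bterm_def norm_mult using that[of "k - j"] by (intro mult_right_mono) auto
  have b: "bterm (fourier u) (fourier v) k summable_on UNIV" for k
    using sum unfolding bsummable_def by blast
  have abs: "(\<lambda>j. cmod (?t B k j)) summable_on UNIV" if "\<And>k. cmod (B k) \<le> jap k powr (- 1 / 2)" for B k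
    by (rule summable_on_comparison_test[OF b[of k]]) (simp_all only: le[OF that] norm_ge_zero)
  have conv: "cmod (\<Sum>\<^sub>\<infinity>j. ?t B k j) \<le> C * jap k ^ N" if "\<And>k. cmod (B k) \<le> jap k powr (- 1 / 2)" for B k
  proof -
    have "cmod (\<Sum>\<^sub>\<infinity>j. ?t B k j) \<le> (\<Sum>\<^sub>\<infinity>j. cmod (?t B k j))"
      by (intro norm_infsum_bound abs that)
    also have "\<dots> \<le> bconv (fourier u) (fourier v) k"
      unfolding bconv_def by (intro infsum_mono abs that b le)
    also have "\<dots> \<le> C * jap k ^ N" by (rule growth)
    finally show ?thesis .
  qed
  have m1: "fourier (distr_mult (fst (biot_savart u)) v) k = (\<Sum>\<^sub>\<infinity>j. ?t BS_symbol1 k j)"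
    by (subst fourier_distr_mult[where C = C and N = N]) (simp_all only: fourier_biot_savart conv[OF BS_symbol_le(1)])
  have m2: "fourier (distr_mult (snd (biot_savart u)) v) k = (\<Sum>\<^sub>\<infinity>j. ?t BS_symbol2 k j)"
    by (subst fourier_distr_mult[where C = C and N = N]) (simp_all only: fourier_biot_savart conv[OF BS_symbol_le(2)])
  have s1: "?t BS_symbol1 k summable_on UNIV" and s2: "?t BS_symbol2 k summable_on UNIV"
    by (rule abs_summable_summable, rule abs, rule BS_symbol_le)+
  have "fourier (advect (biot_savart u) v) k
      = (\<Sum>\<^sub>\<infinity>j. 2 * pi * \<i> * of_int (fst k) * ?t BS_symbol1 k j) + (\<Sum>\<^sub>\<infinity>j. 2 * pi * \<i> * of_int (snd k) * ?t BS_symbol2 k j)"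
    unfolding advect_def fourier_divergence m1 m2 infsum_cmult_right[OF s1] infsum_cmult_right[OF s2] ..
  also have "\<dots> = (\<Sum>\<^sub>\<infinity>j. 2 * pi * \<i> * of_int (fst k) * ?t BS_symbol1 k j + 2 * pi * \<i> * of_int (snd k) * ?t BS_symbol2 k j)"
    by (intro infsum_add[symmetric] summable_on_cmult_right s1 s2)
  also have "\<dots> = adv (fourier u) (fourier v) k"
    unfolding adv_def adv_symbol_BS[symmetric] by (rule infsum_cong) (simp add: algebra_simps)
  finally show ?thesis .
qed

lemma fourier_advect_neg_L2:
  assumes s: "- 1 \<le> s" "s \<le> 0" and u: "hs s (fourier u)" and v: "hs 0 (fourier v)"
  shows "fourier (advect (biot_savart u) v) k = adv (fourier u) (fourier v) k"
  using bconv_neg_L2[OF s u v]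
  by (intro fourier_advect[where C = "hnorm s (fourier u) * hnorm 0 (fourier v)" and N = 0])
    (auto simp: bsummable_def)

lemma fourier_advect_L2_neg:
  assumes s: "- 1 \<le> s" "s \<le> 0" and u: "hs 0 (fourier u)" and v: "hs s (fourier v)"
  shows "fourier (advect (biot_savart u) v) k = adv (fourier u) (fourier v) k"
  using bconv_L2_neg[OF s u v]
  by (intro fourier_advect[where C = "2 * (hnorm 0 (fourier u) * hnorm s (fourier v))" and N = 1])
    (auto simp: bsummable_def mult_ac)

subsection \<open>Transport by a divergence-free field does no work\<close>

lemma freq_sq_le_jap: "sqrt (freq_sq k) \<le> jap k powr (1 / 2)"
  unfolding powr_half_jap by (simp add: jap_def)

lemma adv_work_bound:
  assumes x: "hs 1 x" and "finite F"
  shows "(\<Sum>k\<in>F. cmod (x k) * (2 * sqrt (freq_sq k) * bconv x x k))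
    \<le> 2 * sqrt (kernel_const 0) * ((hnorm 1 x)\<^sup>2 * hnorm 0 x)"
proof -
  have x0: "hs 0 x" using hs_mono[OF _ x, of 0] by simp
  have "(\<Sum>k\<in>F. cmod (x k) * (2 * sqrt (freq_sq k) * bconv x x k)) \<le> (\<Sum>k\<in>F. 2 * (\<bar>wt 1 x k\<bar> * \<bar>bconv x x k\<bar>))"
  proof (intro sum_mono)
    fix k
    have "cmod (x k) * sqrt (freq_sq k) \<le> wt 1 x k"
      using mult_left_mono[OF freq_sq_le_jap[of k] norm_ge_zero[of "x k"]] by (simp add: wt_def mult.commute)
    from mult_right_mono[OF this bconv_nonneg[of x x k]]
    show "cmod (x k) * (2 * sqrt (freq_sq k) * bconv x x k) \<le> 2 * (\<bar>wt 1 x k\<bar> * \<bar>bconv x x k\<bar>)"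
      by (simp add: wt_nonneg bconv_nonneg mult_ac)
  qed
  also have "\<dots> \<le> 2 * (L2_set (wt 1 x) F * L2_set (bconv x x) F)"
    unfolding sum_distrib_left[symmetric] by (intro mult_left_mono L2_set_mult_ineq) auto
  also have "\<dots> \<le> 2 * (hnorm 1 x * (sqrt (kernel_const 0) * (hnorm 1 x * hnorm 0 x)))"
  proof (intro mult_left_mono mult_mono hs_L2_set_le x \<open>finite F\<close>)
    have "(\<Sum>k\<in>F. (bconv x x k)\<^sup>2) \<le> kernel_const 0 * ((hnorm 1 x)\<^sup>2 * (hnorm 0 x)\<^sup>2)"
      using bconv_H1_neg(2)[OF _ _ x x0 \<open>finite F\<close>] jap_pos by (simp add: less_imp_neq[symmetric])
    then have "L2_set (bconv x x) F \<le> sqrt (kernel_const 0 * ((hnorm 1 x)\<^sup>2 * (hnorm 0 x)\<^sup>2))"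
      unfolding L2_set_def by (rule real_sqrt_le_mono)
    then show "L2_set (bconv x x) F \<le> sqrt (kernel_const 0) * (hnorm 1 x * hnorm 0 x)"
      by (simp add: real_sqrt_mult hnorm_nonneg)
  qed (auto simp: hnorm_nonneg)
  also have "\<dots> = 2 * sqrt (kernel_const 0) * ((hnorm 1 x)\<^sup>2 * hnorm 0 x)"
    by (simp add: power2_eq_square)
  finally show ?thesis .
qed

text \<open>
  The symbol is antisymmetric in its two frequencies, because the field is divergence-free; as the
  coefficients are those of a real function, the terms for \<open>(k, j)\<close> and \<open>(j, k)\<close> have opposite real
  parts. The double sum converges absolutely as soon as \<open>x\<close> is in \<open>H\<^sup>1\<close>.
\<close>

lemma adv_no_work:
  assumes x: "hs 1 x" and sym: "\<And>k. x (- k) = cnj (x k)"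
  shows "((\<lambda>k. Re (cnj (x k) * adv x x k)) has_sum 0) UNIV"
proof -
  have x0: "hs 0 x" using hs_mono[OF _ x, of 0] by simp
  have b: "bterm x x k summable_on UNIV" for k
    using bconv_H1_neg(1)[of 0, OF _ _ x x0, unfolded bsummable_def] by (metis less_eq_real_def zero_less_one neg_less_0_iff_less)
  define T where "T k j = cnj (x k) * (of_real (adv_symbol k j) * (x (k - j) * x j))" for k j
  have T_le: "norm (Re (T k j)) \<le> cmod (x k) * (2 * sqrt (freq_sq k) * bterm x x k j)" for k j
  proof -
    have "cmod (T k j) \<le> cmod (x k) * (2 * sqrt (freq_sq k) * bterm x x k j)"
      unfolding T_def norm_mult[of "cnj (x k)"] complex_mod_cnj by (intro mult_left_mono adv_term_le) auto
    then show ?thesis using abs_Re_le_cmod[of "T k j"] by (simp only: real_norm_def)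
  qed
  have "(\<lambda>k. cmod (x k) * (2 * sqrt (freq_sq k) * bconv x x k)) summable_on UNIV"
    by (rule nonneg_bdd_above_summable_on)
      (auto intro!: bdd_aboveI2 adv_work_bound[OF x] mult_nonneg_nonneg freq_sq_nonneg bconv_nonneg)
  then have "(\<lambda>(k, j). cmod (x k) * (2 * sqrt (freq_sq k) * bterm x x k j)) summable_on (UNIV \<times> UNIV)"
    by (intro summable_on_SigmaI[where g = "\<lambda>k. cmod (x k) * (2 * sqrt (freq_sq k) * bconv x x k)"])
      (auto simp: bconv_def bterm_nonneg freq_sq_nonneg intro!: has_sum_cmult_right has_sum_infsum b)
  then have "(\<lambda>p. norm (case p of (k, j) \<Rightarrow> Re (T k j))) summable_on (UNIV \<times> UNIV)"
    by (rule summable_on_comparison_test) (simp_all only: split_def T_le norm_ge_zero)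
  then have sT: "(\<lambda>(k, j). Re (T k j)) summable_on (UNIV \<times> UNIV)"
    by (rule abs_summable_summable)
  have anti': "T j k = - cnj (T k j)" for k j
  proof -
    have "freq_sq (j - k) = freq_sq (k - j)" by (simp add: freq_sq_def power2_commute)
    then have "adv_symbol j k = - adv_symbol k j"
      by (simp add: adv_symbol_def divide_simps algebra_simps)
    moreover have "x (j - k) = cnj (x (k - j))" using sym[of "k - j"] by simp
    ultimately show ?thesis by (simp add: T_def mult_ac)
  qed
  have anti: "Re (T j k) = - Re (T k j)" for k j by (subst anti') simp
  have "(\<Sum>\<^sub>\<infinity>k. \<Sum>\<^sub>\<infinity>j. Re (T k j)) = (\<Sum>\<^sub>\<infinity>k. \<Sum>\<^sub>\<infinity>j. Re (T j k))"
    by (rule infsum_swap_banach[OF sT])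
  also have "\<dots> = (\<Sum>\<^sub>\<infinity>k. \<Sum>\<^sub>\<infinity>j. - Re (T k j))" by (intro infsum_cong anti)
  also have "\<dots> = - (\<Sum>\<^sub>\<infinity>k. \<Sum>\<^sub>\<infinity>j. Re (T k j))" by (simp only: infsum_uminus)
  finally have zero: "(\<Sum>\<^sub>\<infinity>k. \<Sum>\<^sub>\<infinity>j. Re (T k j)) = 0" by linarith
  have row: "((\<lambda>j. Re (T k j)) has_sum Re (cnj (x k) * adv x x k)) UNIV" for k
    unfolding T_def adv_def by (intro has_sum_Re has_sum_cmult_right has_sum_infsum adv_summable b)
  have "((\<lambda>(k, j). Re (T k j)) has_sum (\<Sum>\<^sub>\<infinity>k. \<Sum>\<^sub>\<infinity>j. Re (T k j))) (UNIV \<times> UNIV)"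
    unfolding infsum_Sigma'_banach[OF sT] by (rule has_sum_infsum[OF sT])
  from has_sum_SigmaD[OF this, of "\<lambda>k. Re (cnj (x k) * adv x x k)"] row
  show ?thesis unfolding zero by (simp only: prod.case)
qed

section \<open>Paths of coefficient families\<close>

text \<open>
  A sequence is needed wherever dominated convergence in time meets a sum over frequencies.
\<close>

lemma freq_exhaustion: "\<exists>F :: nat \<Rightarrow> freq set. filterlim F (finite_subsets_at_top UNIV) sequentially \<and> (\<forall>n. finite (F n))"
proof -
  define F where "F n = {k :: freq. to_nat k < n}" for n
  have fin: "finite (F n)" for n
    unfolding F_def by (rule finite_imageD[of to_nat]) (auto intro: finite_subset[of _ "{..<n}"] inj_on_subset[OF inj_to_nat])
  have "filterlim F (finite_subsets_at_top UNIV) sequentially"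
    unfolding filterlim_finite_subsets_at_top
  proof (intro allI impI)
    fix X :: "freq set" assume "finite X \<and> X \<subseteq> UNIV"
    then obtain N where N: "\<And>k. k \<in> X \<Longrightarrow> to_nat k < N"
      using finite_nat_set_iff_bounded[of "to_nat ` X"] by auto
    then have "finite (F n) \<and> X \<subseteq> F n \<and> F n \<subseteq> UNIV" if "n \<ge> N" for n
      using fin[of n] less_le_trans[OF N that] by (auto simp only: F_def mem_Collect_eq)
    then show "\<forall>\<^sub>F n in sequentially. finite (F n) \<and> X \<subseteq> F n \<and> F n \<subseteq> UNIV"
      unfolding eventually_sequentially by blast
  qed
  with fin show ?thesis by blast
qed

lemma has_sum_exhaustion:
  assumes "filterlim F (finite_subsets_at_top UNIV) sequentially" "(f has_sum S) UNIV"
  shows "(\<lambda>n. sum f (F n)) \<longlonglongrightarrow> S"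
  using filterlim_compose[OF assms(2)[unfolded has_sum_def] assms(1)] .

lemma borel_measurable_infsum_freq:
  fixes f :: "freq \<Rightarrow> real \<Rightarrow> complex"
  assumes "\<And>j. f j \<in> borel_measurable M" "\<And>s. (\<lambda>j. f j s) summable_on UNIV"
  shows "(\<lambda>s. \<Sum>\<^sub>\<infinity>j. f j s) \<in> borel_measurable M"
proof -
  obtain F :: "nat \<Rightarrow> freq set" where F: "filterlim F (finite_subsets_at_top UNIV) sequentially"
    using freq_exhaustion by blast
  show ?thesis
  proof (rule borel_measurable_LIMSEQ_metric)
    show "(\<lambda>s. \<Sum>j\<in>F n. f j s) \<in> borel_measurable M" for n
      by (intro borel_measurable_sum assms)
    show "(\<lambda>n. \<Sum>j\<in>F n. f j s) \<longlonglongrightarrow> (\<Sum>\<^sub>\<infinity>j. f j s)" for s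
      by (rule has_sum_exhaustion[OF F has_sum_infsum[OF assms(2)]])
  qed
qed

lemma infsum_tendsto_0:
  fixes f :: "'a \<Rightarrow> 'b \<Rightarrow> real"
  assumes m: "m summable_on UNIV" "\<And>k r. \<bar>f k r\<bar> \<le> m k" and lim: "\<And>k. ((\<lambda>r. f k r) \<longlongrightarrow> 0) L"
  shows "((\<lambda>r. \<Sum>\<^sub>\<infinity>k. f k r) \<longlongrightarrow> 0) L"
proof (rule tendstoI)
  fix e :: real assume e: "0 < e"
  have "uniform_limit UNIV (\<lambda>F r. \<Sum>k\<in>F. f k r) (\<lambda>r. \<Sum>\<^sub>\<infinity>k. f k r) (finite_subsets_at_top UNIV)"
    by (rule Weierstrass_m_test_general[OF _ m(1)]) (simp add: m(2))
  then have "\<forall>\<^sub>F F in finite_subsets_at_top UNIV. \<forall>r\<in>UNIV. dist (\<Sum>k\<in>F. f k r) (\<Sum>\<^sub>\<infinity>k. f k r) < e / 2"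
    by (rule uniform_limitD) (use e in simp)
  then obtain F where "\<forall>r\<in>UNIV. dist (\<Sum>k\<in>F. f k r) (\<Sum>\<^sub>\<infinity>k. f k r) < e / 2"
    unfolding eventually_finite_subsets_at_top by (meson order_refl)
  note F = bspec[OF this UNIV_I]
  have "((\<lambda>r. \<Sum>k\<in>F. f k r) \<longlongrightarrow> 0) L"
    using tendsto_sum[of F f "\<lambda>_. 0" L] lim by simp
  then have "\<forall>\<^sub>F r in L. dist (\<Sum>k\<in>F. f k r) 0 < e / 2"
    by (rule tendstoD) (use e in simp)
  then show "\<forall>\<^sub>F r in L. dist (\<Sum>\<^sub>\<infinity>k. f k r) 0 < e"
  proof eventually_elim
    case (elim r)
    then show ?case using F[of r] unfolding dist_real_def by linarith
  qed
qed

text \<open>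
  The coefficients of the paths in \<open>C0_Sobolev T s\<close>.
\<close>

definition hpath :: "real \<Rightarrow> real \<Rightarrow> (real \<Rightarrow> freq \<Rightarrow> complex) \<Rightarrow> bool" where
  "hpath T s Y \<longleftrightarrow> (\<forall>t. t \<notin> {0..T} \<longrightarrow> Y t = (\<lambda>k. 0)) \<and> (\<forall>t\<in>{0..T}. hs s (Y t)) \<and>
     (\<forall>t\<in>{0..T}. ((\<lambda>r. hnorm s (\<lambda>k. Y r k - Y t k)) \<longlongrightarrow> 0) (at t within {0..T}))"

lemma C0_Sobolev_hpath: "y \<in> C0_Sobolev T s \<longleftrightarrow> hpath T s (\<lambda>t. fourier (y t))"
proof -
  have "y t = 0 \<longleftrightarrow> fourier (y t) = (\<lambda>k. 0)" for t
    using fourier_inject[of "y t" 0] by (auto simp: fourier_zero fun_eq_iff)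
  moreover have "fourier (y r - y t) = (\<lambda>k. fourier (y r) k - fourier (y t) k)" for r t
    by (simp add: fourier_diff fun_eq_iff)
  ultimately show ?thesis
    by (simp add: C0_Sobolev_def hpath_def Sobolev_hs Sobolev_norm_hnorm)
qed

lemma hpath_hs: "hpath T s Y \<Longrightarrow> hs s (Y t)"
  unfolding hpath_def by (metis hs_zero)

lemma hpath_outside: "hpath T s Y \<Longrightarrow> t \<notin> {0..T} \<Longrightarrow> Y t = (\<lambda>k. 0)"
  unfolding hpath_def by blast

lemma hpath_tendsto:
  "hpath T s Y \<Longrightarrow> t \<in> {0..T} \<Longrightarrow> ((\<lambda>r. hnorm s (\<lambda>k. Y r k - Y t k)) \<longlongrightarrow> 0) (at t within {0..T})"
  unfolding hpath_def by blast

lemma cmod_le_hnorm: "hs s c \<Longrightarrow> cmod (c k) \<le> jap k powr (- s / 2) * hnorm s c"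
  using cmod_eq_wt[of c k s] wt_le_hnorm[of s c k] by (simp add: mult_left_mono)

lemma hpath_continuous_coeff:
  assumes Y: "hpath T s Y"
  shows "continuous_on {0..T} (\<lambda>t. Y t k)"
  unfolding continuous_on_def
proof
  fix t assume t: "t \<in> {0..T}"
  have "((\<lambda>r. Y r k - Y t k) \<longlongrightarrow> 0) (at t within {0..T})"
  proof (rule Lim_null_comparison)
    show "\<forall>\<^sub>F r in at t within {0..T}. norm (Y r k - Y t k) \<le> jap k powr (- s / 2) * hnorm s (\<lambda>k. Y r k - Y t k)"
      by (intro always_eventually allI cmod_le_hnorm hs_diff hpath_hs[OF Y])
    show "((\<lambda>r. jap k powr (- s / 2) * hnorm s (\<lambda>k. Y r k - Y t k)) \<longlongrightarrow> 0) (at t within {0..T})"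
      using tendsto_mult_right_zero[OF hpath_tendsto[OF Y t]] .
  qed
  then show "((\<lambda>r. Y r k) \<longlongrightarrow> Y t k) (at t within {0..T})" by (rule LIM_zero_cancel)
qed

lemma measurable_zero_outside:
  fixes f :: "real \<Rightarrow> 'a :: {real_normed_vector, second_countable_topology}"
  assumes "continuous_on {0..T} f" "\<And>t. t \<notin> {0..T} \<Longrightarrow> f t = 0"
  shows "f \<in> borel_measurable borel"
proof -
  have "(\<lambda>t. indicator {0..T} t *\<^sub>R f t) \<in> borel_measurable borel"
    by (rule borel_measurable_continuous_on_indicator[OF _ assms(1)]) simp
  moreover have "(\<lambda>t. indicator {0..T} t *\<^sub>R f t) = f"
    using assms(2) by (auto simp: indicator_def fun_eq_iff)
  ultimately show ?thesis by simp
qed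

lemma hpath_measurable_coeff: "hpath T s Y \<Longrightarrow> (\<lambda>t. Y t k) \<in> borel_measurable borel"
  by (rule measurable_zero_outside[OF hpath_continuous_coeff]) (auto simp: hpath_outside)

lemma hpath_continuous_hnorm:
  assumes Y: "hpath T s Y"
  shows "continuous_on {0..T} (\<lambda>t. hnorm s (Y t))"
  unfolding continuous_on_def
proof
  fix t assume t: "t \<in> {0..T}"
  have "((\<lambda>r. hnorm s (Y r) - hnorm s (Y t)) \<longlongrightarrow> 0) (at t within {0..T})"
    by (rule Lim_null_comparison[OF _ hpath_tendsto[OF Y t]])
      (simp add: always_eventually hnorm_diff_ge hpath_hs[OF Y])
  then show "((\<lambda>r. hnorm s (Y r)) \<longlongrightarrow> hnorm s (Y t)) (at t within {0..T})" by (rule LIM_zero_cancel)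
qed

lemma hpath_measurable_hnorm: "hpath T s Y \<Longrightarrow> (\<lambda>t. hnorm s (Y t)) \<in> borel_measurable borel"
  by (rule measurable_zero_outside[OF hpath_continuous_hnorm]) (auto simp: hpath_outside hnorm_zero)

lemma hpath_bounded:
  assumes Y: "hpath T s Y"
  shows "\<exists>R\<ge>0. \<forall>t. hnorm s (Y t) \<le> R"
proof -
  have "compact ((\<lambda>t. hnorm s (Y t)) ` {0..T})"
    by (intro compact_continuous_image hpath_continuous_hnorm[OF Y]) simp
  then obtain R where R: "\<forall>x\<in>(\<lambda>t. hnorm s (Y t)) ` {0..T}. norm x \<le> R" "0 < R"
    using compact_imp_bounded bounded_pos by metis
  have "hnorm s (Y t) \<le> R" for t
    using R hpath_outside[OF Y, of t] by (cases "t \<in> {0..T}") (auto simp: hnorm_zero dest: abs_le_D1)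
  with R(2) show ?thesis by (intro exI[of _ R]) auto
qed

lemma hpath_lincomb:
  assumes Y: "hpath T s Y" and W: "hpath T s W"
  shows "hpath T s (\<lambda>t k. a * Y t k + W t k)"
  unfolding hpath_def
proof (intro conjI ballI allI impI)
  show "(\<lambda>k. a * Y t k + W t k) = (\<lambda>k. 0)" if "t \<notin> {0..T}" for t
    using that by (simp add: hpath_outside[OF Y] hpath_outside[OF W])
  show "hs s (\<lambda>k. a * Y t k + W t k)" for t
    by (intro hs_add hs_scale hpath_hs[OF Y] hpath_hs[OF W])
  fix t assume t: "t \<in> {0..T}"
  show "((\<lambda>r. hnorm s (\<lambda>k. a * Y r k + W r k - (a * Y t k + W t k))) \<longlongrightarrow> 0) (at t within {0..T})"
  proof (rule Lim_null_comparison)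
    have "norm (hnorm s (\<lambda>k. a * Y r k + W r k - (a * Y t k + W t k)))
        \<le> cmod a * hnorm s (\<lambda>k. Y r k - Y t k) + hnorm s (\<lambda>k. W r k - W t k)" for r
    proof -
      have "(\<lambda>k. a * Y r k + W r k - (a * Y t k + W t k)) = (\<lambda>k. a * (Y r k - Y t k) + (W r k - W t k))"
        by (simp add: fun_eq_iff algebra_simps)
      then show ?thesis
        using hnorm_add[of s "\<lambda>k. a * (Y r k - Y t k)" "\<lambda>k. W r k - W t k"]
        by (simp add: hnorm_nonneg hs_scale hs_diff hpath_hs[OF Y] hpath_hs[OF W] hnorm_scale)
    qed
    then show "\<forall>\<^sub>F r in at t within {0..T}. norm (hnorm s (\<lambda>k. a * Y r k + W r k - (a * Y t k + W t k)))
        \<le> cmod a * hnorm s (\<lambda>k. Y r k - Y t k) + hnorm s (\<lambda>k. W r k - W t k)"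
      by (simp add: always_eventually)
    show "((\<lambda>r. cmod a * hnorm s (\<lambda>k. Y r k - Y t k) + hnorm s (\<lambda>k. W r k - W t k)) \<longlongrightarrow> 0) (at t within {0..T})"
      using tendsto_add[OF tendsto_mult_right_zero[OF hpath_tendsto[OF Y t], of "cmod a"] hpath_tendsto[OF W t]] by simp
  qed
qed

lemma hpath_zero: "hpath T s (\<lambda>t k. 0)"
  by (simp add: hpath_def hs_zero hnorm_zero)

lemma set_integrable_bounded:
  fixes f :: "real \<Rightarrow> 'a :: {banach, second_countable_topology}"
  assumes "f \<in> borel_measurable borel" "\<And>s. norm (f s) \<le> B"
  shows "set_integrable lborel {a..b} f"
  unfolding set_integrable_def
  by (rule integrableI_bounded_set_indicator[where B = B])
    (use assms emeasure_lborel_Icc_eq in \<open>auto simp: ennreal_less_top\<close>)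

text \<open>
  The choice \<open>\<eta> = 2 * x\<close> turns a family of Young inequalities into the inequality of Cauchy and Schwarz.
\<close>

lemma L2_duality_bound:
  fixes x Q :: real
  assumes "0 \<le> x" and le: "\<And>\<eta>. 0 < \<eta> \<Longrightarrow> x \<le> \<eta> / 4 + Q / (2 * \<eta>)" and "0 \<le> Q"
  shows "x\<^sup>2 \<le> Q"
proof (cases "x = 0")
  case False
  with assms(1) have x: "0 < x" by simp
  have "x \<le> x / 2 + Q / (4 * x)" using le[of "2 * x"] x by simp
  then have "x * x \<le> Q / 2" using x by (simp add: field_simps)
  with \<open>0 \<le> Q\<close> show ?thesis by (simp add: power2_eq_square)
qed (use \<open>0 \<le> Q\<close> in simp)

text \<open>
  The gain of one derivative by the heat semigroup, frequency by frequency: the square integral in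
  time of the heat kernel at frequency \<open>\<lambda>\<close> is at most \<open>1 / (2 * \<lambda>)\<close>.
\<close>

lemma heat_kernel_L2:
  fixes g :: "real \<Rightarrow> complex"
  assumes g: "g \<in> borel_measurable borel" "\<And>s. cmod (g s) \<le> B" and lam: "0 < lam" and t: "0 \<le> t"
  shows "(cmod (set_lebesgue_integral lborel {0..t} (\<lambda>s. of_real (exp (- (lam * (t - s)))) * g s)))\<^sup>2
    \<le> set_lebesgue_integral lborel {0..t} (\<lambda>s. (cmod (g s))\<^sup>2 / lam)"
proof -
  define e where "e s = exp (- (lam * (t - s)))" for s
  let ?I = "set_lebesgue_integral lborel {0..t}"
  let ?Q = "?I (\<lambda>s. (cmod (g s))\<^sup>2 / lam)"
  have B: "0 \<le> B" using g(2)[of 0] norm_ge_zero order_trans by blast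
  have e_meas: "e \<in> borel_measurable borel" unfolding e_def by measurable
  have gint: "set_integrable lborel {0..t} (\<lambda>s. (cmod (g s))\<^sup>2 / lam)"
  proof (rule set_integrable_bounded)
    show "(\<lambda>s. (cmod (g s))\<^sup>2 / lam) \<in> borel_measurable borel" using g(1) by measurable
    show "norm ((cmod (g s))\<^sup>2 / lam) \<le> B\<^sup>2 / lam" for s
      using g(2)[of s] lam by (simp add: divide_right_mono power_mono)
  qed
  have F: "DERIV (\<lambda>s. exp (- (2 * lam * (t - s))) / 2) s :> lam * (e s)\<^sup>2" for s
    unfolding e_def power2_eq_square exp_add[symmetric]
    by (rule derivative_eq_intros refl | simp)+
  have cont: "isCont (\<lambda>s. lam * (e s)\<^sup>2) s" for s
    unfolding e_def by (intro continuous_intros)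
  have "integrable lborel (\<lambda>s. (lam * (e s)\<^sup>2) * indicator {0..t} s)"
    "(\<integral>s. (lam * (e s)\<^sup>2) * indicator {0..t} s \<partial>lborel) = 1 / 2 - exp (- (2 * lam * t)) / 2"
    using has_bochner_integral_FTC_Icc_real[OF t F cont]
    by (auto simp: has_bochner_integral_iff)
  then have eint: "set_integrable lborel {0..t} (\<lambda>s. lam * (e s)\<^sup>2)" and eI: "?I (\<lambda>s. lam * (e s)\<^sup>2) \<le> 1 / 2"
    unfolding set_integrable_def set_lebesgue_integral_def by (simp_all add: mult.commute)
  have prod: "set_integrable lborel {0..t} (\<lambda>s. of_real (e s) * g s)"
  proof -
    have "set_integrable lborel {0..t} (\<lambda>s. of_real (min 1 (e s)) * g s)"
    proof (rule set_integrable_bounded)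
      show "(\<lambda>s. of_real (min 1 (e s)) * g s) \<in> borel_measurable borel" using g(1) e_meas by measurable
      have "0 \<le> e s" for s by (simp add: e_def)
      then show "norm (of_real (min 1 (e s)) * g s) \<le> 1 * B" for s
        unfolding norm_mult using g(2)[of s] B by (intro mult_mono) (auto simp: min_def)
    qed
    moreover have "e s \<le> 1" if "s \<in> {0..t}" for s
      using that lam by (simp add: e_def)
    ultimately show ?thesis
      by (subst (asm) set_integrable_cong[OF refl refl, of _ _ "\<lambda>s. of_real (e s) * g s"]) auto
  qed
  have "cmod (?I (\<lambda>s. of_real (e s) * g s)) \<le> \<eta> / 4 + ?Q / (2 * \<eta>)" if "0 < \<eta>" for \<eta>
  proof -
    have "cmod (?I (\<lambda>s. of_real (e s) * g s)) \<le> ?I (\<lambda>s. cmod (of_real (e s) * g s))"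
      by (rule set_integral_norm_bound[OF prod])
    also have "\<dots> \<le> ?I (\<lambda>s. (\<eta> / 2) * (lam * (e s)\<^sup>2) + (1 / (2 * \<eta>)) * ((cmod (g s))\<^sup>2 / lam))"
    proof (rule set_integral_mono)
      show "set_integrable lborel {0..t} (\<lambda>s. cmod (of_real (e s) * g s))"
        using prod by (rule set_integrable_norm)
      show "set_integrable lborel {0..t} (\<lambda>s. (\<eta> / 2) * (lam * (e s)\<^sup>2) + (1 / (2 * \<eta>)) * ((cmod (g s))\<^sup>2 / lam))"
        by (intro set_integral_add set_integrable_mult_right eint gint)
      fix s
      define a where "a = e s" define b where "b = cmod (g s)"
      have "0 \<le> (\<eta> * lam * a - b)\<^sup>2" by simp
      then have "2 * (\<eta> * lam) * (a * b) \<le> (\<eta> * lam)\<^sup>2 * a\<^sup>2 + b\<^sup>2"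
        by (simp add: power2_eq_square algebra_simps)
      then have "a * b \<le> (\<eta> / 2) * (lam * a\<^sup>2) + (1 / (2 * \<eta>)) * (b\<^sup>2 / lam)"
        using that lam by (simp add: field_simps power2_eq_square)
      moreover have "cmod (of_real (e s) * g s) = a * b"
        by (simp add: norm_mult a_def b_def e_def)
      ultimately show "cmod (of_real (e s) * g s) \<le> (\<eta> / 2) * (lam * (e s)\<^sup>2) + (1 / (2 * \<eta>)) * ((cmod (g s))\<^sup>2 / lam)"
        by (simp add: a_def b_def)
    qed
    also have "\<dots> = (\<eta> / 2) * ?I (\<lambda>s. lam * (e s)\<^sup>2) + (1 / (2 * \<eta>)) * ?Q"
      by (subst set_integral_add(2)) (use eint gint in \<open>auto intro!: set_integrable_mult_right simp del: times_divide_eq_left times_divide_eq_right\<close>)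
    also have "\<dots> \<le> (\<eta> / 2) * (1 / 2) + (1 / (2 * \<eta>)) * ?Q"
      using eI that by (intro add_right_mono mult_left_mono) auto
    finally show ?thesis by (simp add: mult_ac)
  qed
  moreover have "0 \<le> ?Q"
    unfolding set_lebesgue_integral_def using lam by (intro integral_nonneg_AE) auto
  ultimately show ?thesis
    using L2_duality_bound[of "cmod (?I (\<lambda>s. of_real (e s) * g s))" ?Q] by (simp add: e_def)
qed

section \<open>An exponential weight\<close>

lemma set_integrable_mult_bounded:
  fixes f g :: "'a :: euclidean_space \<Rightarrow> real"
  assumes "set_integrable lborel A f" "g \<in> borel_measurable borel" "\<And>x. x \<in> A \<Longrightarrow> \<bar>g x\<bar> \<le> M"
  shows "set_integrable lborel A (\<lambda>x. f x * g x)"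
  unfolding set_integrable_def
proof (rule Bochner_Integration.integrable_bound)
  let ?F = "\<lambda>x. indicat_real A x *\<^sub>R f x"
  show "integrable lborel (\<lambda>x. M * ?F x)"
    using assms(1) unfolding set_integrable_def by (rule integrable_mult_right)
  have "(\<lambda>x. ?F x * g x) \<in> borel_measurable lborel"
    using assms(1,2) unfolding set_integrable_def by (intro borel_measurable_times) auto
  then show "(\<lambda>x. indicator A x *\<^sub>R (f x * g x)) \<in> borel_measurable lborel"
    by (simp only: mult_scaleR_left)
  have "norm (indicator A x *\<^sub>R (f x * g x)) \<le> norm (M * ?F x)" for x
  proof (cases "x \<in> A")
    case True
    have "\<bar>f x\<bar> * \<bar>g x\<bar> \<le> \<bar>f x\<bar> * \<bar>M\<bar>"
      using assms(3)[OF True] by (intro mult_left_mono) auto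
    then show ?thesis using True by (simp add: abs_mult mult.commute)
  qed simp
  then show "AE x in lborel. norm (indicator A x *\<^sub>R (f x * g x)) \<le> norm (M * ?F x)"
    by (rule AE_I2)
qed

lemma set_integrable_Icc_subset:
  fixes a :: "real \<Rightarrow> 'a :: {banach, second_countable_topology}"
  shows "set_integrable lborel {0..T} a \<Longrightarrow> t \<le> T \<Longrightarrow> set_integrable lborel {0..t} a"
  by (rule set_integrable_subset) auto

text \<open>
  The weight \<open>exp (lam * A t)\<close> with \<open>A\<close> the primitive of \<open>a\<close>: formally \<open>a * exp (lam * A)\<close> is the
  derivative of \<open>exp (lam * A) / lam\<close>. As \<open>a\<close> is merely integrable, this is verified on a partition
  so fine that \<open>A\<close> grows by at most \<open>e\<close> on each piece.
\<close>

lemma exp_weight_integral: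
  fixes a :: "real \<Rightarrow> real"
  assumes a: "set_integrable lborel {0..T} a" "\<And>s. 0 \<le> a s" and lam: "0 < lam"
  defines "A \<equiv> \<lambda>t. set_lebesgue_integral lborel {0..t} a"
  defines "w \<equiv> \<lambda>s. if s \<in> {0..T} then exp (lam * A s) else 0"
  assumes t: "t \<in> {0..T}"
  shows "w \<in> borel_measurable borel" "\<And>s. \<bar>w s\<bar> \<le> exp (lam * A T)"
    "set_lebesgue_integral lborel {0..t} (\<lambda>s. a s * w s) \<le> w t / lam"
proof -
  have A_hk: "A s = integral {0..s} a" "a integrable_on {0..s}" if "s \<in> {0..T}" for s
    unfolding A_def using that
    by (intro set_borel_integral_eq_integral set_integrable_Icc_subset[OF a(1)]; simp)+
  have incr: "A s - A r = integral {r..s} a" if "r \<in> {0..T}" "s \<in> {0..T}" "r \<le> s" for r s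
  proof -
    have "integral {0..r} a + integral {r..s} a = integral {0..s} a"
      using that by (intro Henstock_Kurzweil_Integration.integral_combine A_hk(2)) auto
    then show ?thesis using that by (simp add: A_hk(1))
  qed
  have sub: "a integrable_on {r..s}" if "r \<in> {0..T}" "s \<in> {0..T}" for r s
    by (rule integrable_on_subinterval[OF A_hk(2)[of s]]) (use that in auto)
  have mono: "A r \<le> A s" if "r \<in> {0..T}" "s \<in> {0..T}" "r \<le> s" for r s
    using incr[OF that] integral_nonneg[OF sub[OF that(1,2)]] a(2) by simp
  have contA: "continuous_on {0..T} A"
  proof -
    have "continuous_on {0..T} (\<lambda>s. integral {0..s} a)"
      using t by (intro indefinite_integral_continuous_1 A_hk(2)) auto
    then show ?thesis by (simp add: A_hk(1) cong: continuous_on_cong_simp)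
  qed
  show w_meas: "w \<in> borel_measurable borel"
  proof (rule measurable_zero_outside)
    have "continuous_on {0..T} (\<lambda>s. exp (lam * A s))" by (intro continuous_intros contA)
    then show "continuous_on {0..T} w" by (simp add: w_def cong: continuous_on_cong_simp)
  qed (simp add: w_def)
  show w_le: "\<bar>w s\<bar> \<le> exp (lam * A T)" for s
    using mono[of s T] t lam by (auto simp: w_def)
  have aw: "set_integrable lborel {0..s} (\<lambda>r. a r * w r)" if "s \<in> {0..T}" for s
    by (rule set_integrable_Icc_subset[OF set_integrable_mult_bounded[OF a(1) w_meas w_le]]) (use that in auto)
  define J where "J s = integral {0..s} (\<lambda>r. a r * w r)" for s
  have J_int: "(\<lambda>r. a r * w r) integrable_on {0..s}" if "s \<in> {0..T}" for s
    using set_borel_integral_eq_integral(1)[OF aw[OF that]] .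
  have w_pos: "0 < w s" if "s \<in> {0..T}" for s using that by (simp add: w_def)
  have w_mono: "w r \<le> w s" if "r \<in> {0..T}" "s \<in> {0..T}" "r \<le> s" for r s
    using mono[OF that] lam that by (simp add: w_def)
  have step: "J s - J r \<le> (1 / lam + e) * (w s - w r)"
    if "r \<in> {0..T}" "s \<in> {0..T}" "r \<le> s" "A s - A r \<le> e" for r s e
  proof -
    have "integral {0..r} (\<lambda>r. a r * w r) + integral {r..s} (\<lambda>r. a r * w r) = J s"
      unfolding J_def using that by (intro Henstock_Kurzweil_Integration.integral_combine J_int) auto
    then have "J s - J r = integral {r..s} (\<lambda>r. a r * w r)" by (simp add: J_def)
    also have "\<dots> \<le> integral {r..s} (\<lambda>r. a r * w s)"
    proof (rule integral_le)
      show "(\<lambda>r. a r * w r) integrable_on {r..s}"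
        by (rule integrable_on_subinterval[OF J_int[of s]]) (use that in auto)
      show "(\<lambda>r. a r * w s) integrable_on {r..s}"
        using sub[OF that(1,2)] by (rule integrable_on_mult_left)
      show "a x * w x \<le> a x * w s" if "x \<in> {r..s}" for x
        using that \<open>r \<in> _\<close> \<open>s \<in> _\<close> by (intro mult_left_mono w_mono a) auto
    qed
    also have "\<dots> = (A s - A r) * w s" using incr[OF that(1-3)] by simp
    also have "\<dots> = (A s - A r) * w r + (A s - A r) * (w s - w r)" by (simp add: algebra_simps)
    also have "\<dots> \<le> (w s - w r) / lam + e * (w s - w r)"
    proof (intro add_mono mult_right_mono that(4))
      have "exp (lam * A r) * (1 + lam * (A s - A r)) \<le> exp (lam * A r) * exp (lam * (A s - A r))"
        by (intro mult_left_mono exp_ge_add_one_self) auto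
      also have "\<dots> = exp (lam * A s)" by (simp add: algebra_simps flip: exp_add)
      finally have "lam * ((A s - A r) * w r) \<le> w s - w r"
        using that by (simp add: w_def algebra_simps)
      then show "(A s - A r) * w r \<le> (w s - w r) / lam" using lam by (simp add: field_simps)
      show "0 \<le> w s - w r" using w_mono[OF that(1-3)] by simp
    qed
    finally show ?thesis by (simp add: algebra_simps diff_divide_distrib)
  qed
  \<comment> \<open>The error \<open>e * (w s - w r)\<close> of each step telescopes, so it is small for the whole interval.\<close>
  have J_le: "J t \<le> (1 / lam + e) * w t" if "0 < e" for e
  proof -
    have "uniformly_continuous_on {0..T} A" by (rule compact_uniformly_continuous[OF contA]) simp
    then obtain d where d: "0 < d" "\<And>r s. r \<in> {0..T} \<Longrightarrow> s \<in> {0..T} \<Longrightarrow> dist s r < d \<Longrightarrow> dist (A s) (A r) < e"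
      using \<open>0 < e\<close> unfolding uniformly_continuous_on_def by metis
    obtain n :: nat where "t / d < real n" using reals_Archimedean2 by blast
    then have n: "t / real (Suc n) < d"
      using d(1) t by (simp add: field_simps)
    define p where "p i = real i * (t / real (Suc n))" for i
    have pt: "p i \<in> {0..T}" if "i \<le> Suc n" for i
    proof -
      have "p i \<le> real (Suc n) * (t / real (Suc n))"
        unfolding p_def using that t by (intro mult_right_mono) auto
      then show ?thesis using t by (auto simp: p_def)
    qed
    have "J (p i) - J (p 0) \<le> (1 / lam + e) * (w (p i) - w (p 0))" if "i \<le> Suc n" for i
      using that
    proof (induction i)
      case (Suc i)
      have "p (Suc i) - p i = t / real (Suc n)" by (simp add: p_def algebra_simps add_divide_distrib)
      moreover have le: "p i \<le> p (Suc i)"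
        unfolding p_def using t by (intro mult_right_mono) auto
      ultimately have "dist (p (Suc i)) (p i) < d" using n by (simp add: dist_real_def)
      then have "A (p (Suc i)) - A (p i) \<le> e"
        using d(2)[of "p i" "p (Suc i)"] pt[of i] pt[of "Suc i"] Suc.prems by (simp add: dist_real_def)
      then have "J (p (Suc i)) - J (p i) \<le> (1 / lam + e) * (w (p (Suc i)) - w (p i))"
        using Suc.prems le by (intro step pt) auto
      with Suc show ?case by (simp add: algebra_simps)
    qed simp
    from this[of "Suc n"] have "J t - J 0 \<le> (1 / lam + e) * (w t - w 0)"
      by (simp add: p_def)
    moreover have "J 0 = 0" by (simp add: J_def)
    moreover have "0 \<le> w 0" using t by (simp add: w_def)
    moreover have "0 < 1 / lam + e" using lam that by (simp add: add_pos_pos)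
    ultimately have "(1 / lam + e) * (w t - w 0) \<le> (1 / lam + e) * w t"
      by (intro mult_left_mono) auto
    with \<open>J t - J 0 \<le> _\<close> \<open>J 0 = 0\<close> show ?thesis by linarith
  qed
  have "J t \<le> w t / lam"
  proof (rule field_le_epsilon)
    fix e :: real assume "0 < e"
    then have "J t \<le> (1 / lam + e / w t) * w t" using w_pos[OF t] by (intro J_le) simp
    also have "\<dots> = w t / lam + e" using w_pos[OF t] by (simp add: field_simps)
    finally show "J t \<le> w t / lam + e" .
  qed
  then show "set_lebesgue_integral lborel {0..t} (\<lambda>s. a s * w s) \<le> w t / lam"
    unfolding J_def using set_borel_integral_eq_integral(2)[OF aw[OF t]] by simp
qed

section \<open>The energy estimate for the vorticity\<close>

lemma sum_cmod_le_hnorm0: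
  assumes "hs 0 c" "finite F"
  shows "(\<Sum>k\<in>F. (cmod (c k))\<^sup>2) \<le> (hnorm 0 c)\<^sup>2"
  using hs_sum_le[OF assms] jap_pos by (simp add: wt_def less_imp_neq[symmetric])

text \<open>
  Testing the equation with the cosine and the sine at the frequency \<open>k\<close> gives the derivatives of the
  real and of the imaginary part of the coefficient.
\<close>

lemma vorticity_coeff_derivative:
  assumes sol: "vorticity_solution T \<xi>0 \<xi>" and t: "t \<in> {0..T}"
  defines "X \<equiv> \<lambda>t. fourier (\<xi> t)"
  shows "((\<lambda>r. (cmod (X r k))\<^sup>2) has_real_derivative
     - (2 * (4 * pi\<^sup>2 * freq_sq k)) * (cmod (X t k))\<^sup>2 - 2 * Re (cnj (X t k) * adv (X t) (X t) k))
     (at t within {0..T})"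
proof -
  have X: "hs 0 (X t)"
    using sol t unfolding vorticity_solution_def C0_Sobolev_def X_def by (auto simp: Sobolev_hs)
  let ?L = "laplacian (\<xi> t) - advect (biot_savart (\<xi> t)) (\<xi> t)"
  have L: "fourier ?L k = - of_real (4 * pi\<^sup>2 * freq_sq k) * X t k - adv (X t) (X t) k"
    using fourier_advect_L2_neg[of 0 "\<xi> t" "\<xi> t"] X
    by (simp add: fourier_diff fourier_laplacian X_def)
  have d: "((\<lambda>r. pairing (\<xi> r) \<phi>) has_real_derivative pairing ?L \<phi>) (at t within {0..T})" for \<phi>
    using sol t unfolding vorticity_solution_def by blast
  have re: "((\<lambda>r. Re (X r k)) has_real_derivative Re (fourier ?L k)) (at t within {0..T})"
    using d[of "cos_test k"] by (simp add: X_def fourier_tests)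
  have im: "((\<lambda>r. Im (X r k)) has_real_derivative Im (fourier ?L k)) (at t within {0..T})"
    using DERIV_minus[OF d[of "sin_test k"]] by (simp add: X_def fourier_tests)
  have "((\<lambda>r. (Re (X r k))\<^sup>2 + (Im (X r k))\<^sup>2) has_real_derivative
      2 * Re (X t k) * Re (fourier ?L k) + 2 * Im (X t k) * Im (fourier ?L k)) (at t within {0..T})"
    using DERIV_add[OF DERIV_power[OF re, of 2] DERIV_power[OF im, of 2]] by (simp add: mult_ac)
  moreover have "2 * Re z * Re (- of_real l * z - y) + 2 * Im z * Im (- of_real l * z - y)
      = - (2 * l) * (cmod z)\<^sup>2 - 2 * Re (cnj z * y)" for z y l
    unfolding cmod_power2 by (simp add: power2_eq_square algebra_simps)
  ultimately show ?thesis unfolding L by (simp only: cmod_power2)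
qed

lemma adv_self_measurable:
  assumes X: "hpath T 0 X"
  shows "(\<lambda>s. adv (X s) (X s) k) \<in> borel_measurable borel"
    "cmod (adv (X s) (X s) k) \<le> 4 * sqrt (freq_sq k) * jap k * (hnorm 0 (X s) * hnorm 0 (X s))"
proof -
  have b: "bterm (X s) (X s) k summable_on UNIV" "bconv (X s) (X s) k \<le> 2 * jap k * (hnorm 0 (X s) * hnorm 0 (X s))" for s
    using bconv_L2_neg[of 0 "X s" "X s" k] hpath_hs[OF X] by simp_all
  show "(\<lambda>s. adv (X s) (X s) k) \<in> borel_measurable borel"
    unfolding adv_def
    by (intro borel_measurable_infsum_freq adv_summable b borel_measurable_times borel_measurable_const
        hpath_measurable_coeff[OF X])
  show "cmod (adv (X s) (X s) k) \<le> 4 * sqrt (freq_sq k) * jap k * (hnorm 0 (X s) * hnorm 0 (X s))"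
    using adv_le[OF b(1)] mult_left_mono[OF b(2), of "2 * sqrt (freq_sq k)" s] freq_sq_nonneg[of k]
    by (simp add: mult.assoc) (smt (verit) mult.assoc mult.left_commute)
qed

lemma energy_balance:
  assumes sol: "vorticity_solution T \<xi>0 \<xi>" and t: "t \<in> {0..T}" and F: "finite F"
  defines "X \<equiv> \<lambda>t. fourier (\<xi> t)"
  shows "(\<Sum>k\<in>F. (cmod (X t k))\<^sup>2)
      + 2 * (\<Sum>k\<in>F. 4 * pi\<^sup>2 * freq_sq k * set_lebesgue_integral lborel {0..t} (\<lambda>s. (cmod (X s k))\<^sup>2))
    = (\<Sum>k\<in>F. (cmod (X 0 k))\<^sup>2)
      - 2 * set_lebesgue_integral lborel {0..t} (\<lambda>s. \<Sum>k\<in>F. Re (cnj (X s k) * adv (X s) (X s) k))"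
    and "\<And>k. set_integrable lborel {0..t} (\<lambda>s. (cmod (X s k))\<^sup>2)"
    and "set_integrable lborel {0..t} (\<lambda>s. \<Sum>k\<in>F. Re (cnj (X s k) * adv (X s) (X s) k))"
proof -
  have X: "hpath T 0 X"
    using sol unfolding vorticity_solution_def C0_Sobolev_hpath X_def by blast
  obtain R where R: "0 \<le> R" "\<And>t. hnorm 0 (X t) \<le> R" using hpath_bounded[OF X] by blast
  have c: "cmod (X s k) \<le> R" for s k
    using cmod_le_hnorm[OF hpath_hs[OF X], of s k] R(2)[of s] jap_pos[of k] by simp
  note meas = hpath_measurable_coeff[OF X] adv_self_measurable(1)[OF X]
  show sq: "set_integrable lborel {0..t} (\<lambda>s. (cmod (X s k))\<^sup>2)" for k
    by (rule set_integrable_bounded[where B = "R\<^sup>2"]) 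
      (auto intro!: power_mono c borel_measurable_power borel_measurable_continuous_on[OF continuous_on_norm_id] meas)
  have wk: "set_integrable lborel {0..t} (\<lambda>s. Re (cnj (X s k) * adv (X s) (X s) k))" for k
  proof (rule set_integrable_bounded)
    show "norm (Re (cnj (X s k) * adv (X s) (X s) k)) \<le> R * (4 * sqrt (freq_sq k) * jap k * (R * R))" for s
    proof -
      have "norm (Re (cnj (X s k) * adv (X s) (X s) k)) \<le> cmod (X s k) * cmod (adv (X s) (X s) k)"
        using abs_Re_le_cmod[of "cnj (X s k) * adv (X s) (X s) k"] by (simp add: norm_mult)
      also have "\<dots> \<le> R * (4 * sqrt (freq_sq k) * jap k * (hnorm 0 (X s) * hnorm 0 (X s)))"
        by (intro mult_mono c adv_self_measurable(2)[OF X] R(1)) auto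
      also have "\<dots> \<le> R * (4 * sqrt (freq_sq k) * jap k * (R * R))"
        using jap_pos[of k] freq_sq_nonneg[of k] by (intro mult_left_mono mult_mono R hnorm_nonneg) auto
      finally show ?thesis .
    qed
    have "(\<lambda>s. cnj (X s k) * adv (X s) (X s) k) \<in> borel_measurable borel"
      by (intro borel_measurable_times meas borel_measurable_continuous_on[OF continuous_on_cnj[OF continuous_on_id]])
    then show "(\<lambda>s. Re (cnj (X s k) * adv (X s) (X s) k)) \<in> borel_measurable borel"
      by (rule borel_measurable_continuous_on[OF continuous_on_Re[OF continuous_on_id]])
  qed
  then show "set_integrable lborel {0..t} (\<lambda>s. \<Sum>k\<in>F. Re (cnj (X s k) * adv (X s) (X s) k))"
    unfolding set_integrable_def scaleR_sum_right by (rule Bochner_Integration.integrable_sum)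
  have mode: "(cmod (X t k))\<^sup>2 + 2 * (4 * pi\<^sup>2 * freq_sq k * set_lebesgue_integral lborel {0..t} (\<lambda>s. (cmod (X s k))\<^sup>2))
    = (cmod (X 0 k))\<^sup>2 - 2 * set_lebesgue_integral lborel {0..t} (\<lambda>s. Re (cnj (X s k) * adv (X s) (X s) k))" for k
  proof -
    let ?l = "4 * pi\<^sup>2 * freq_sq k"
    let ?g = "\<lambda>s. - (2 * ?l) * (cmod (X s k))\<^sup>2 - 2 * Re (cnj (X s k) * adv (X s) (X s) k)"
    have "((\<lambda>r. (cmod (X r k))\<^sup>2) has_vector_derivative ?g s) (at s within {0..t})" if "s \<in> {0..t}" for s
      using vorticity_coeff_derivative[OF sol, of s k] that t unfolding X_def
      by (auto simp: has_real_derivative_iff_has_vector_derivative intro: has_vector_derivative_within_subset)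
    then have "(?g has_integral (cmod (X t k))\<^sup>2 - (cmod (X 0 k))\<^sup>2) {0..t}"
      using t by (intro fundamental_theorem_of_calculus) auto
    moreover have gi: "set_integrable lborel {0..t} ?g"
      by (intro set_integral_diff set_integrable_mult_right sq wk)
    ultimately have "set_lebesgue_integral lborel {0..t} ?g = (cmod (X t k))\<^sup>2 - (cmod (X 0 k))\<^sup>2"
      using set_borel_integral_eq_integral(2)[OF gi] by (simp add: integral_unique)
    moreover have "set_lebesgue_integral lborel {0..t} ?g =
        - (2 * ?l) * set_lebesgue_integral lborel {0..t} (\<lambda>s. (cmod (X s k))\<^sup>2)
        - 2 * set_lebesgue_integral lborel {0..t} (\<lambda>s. Re (cnj (X s k) * adv (X s) (X s) k))"
      by (subst set_integral_diff(2)) (auto intro!: set_integrable_mult_right sq wk simp only: set_integral_mult_right)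
    ultimately show ?thesis by simp
  qed
  have "set_lebesgue_integral lborel {0..t} (\<lambda>s. \<Sum>k\<in>F. Re (cnj (X s k) * adv (X s) (X s) k))
      = (\<Sum>k\<in>F. set_lebesgue_integral lborel {0..t} (\<lambda>s. Re (cnj (X s k) * adv (X s) (X s) k)))"
    using wk unfolding set_lebesgue_integral_def set_integrable_def scaleR_sum_right
    by (intro Bochner_Integration.integral_sum) auto
  moreover have "(\<Sum>k\<in>F. (cmod (X t k))\<^sup>2 + 2 * (4 * pi\<^sup>2 * freq_sq k * set_lebesgue_integral lborel {0..t} (\<lambda>s. (cmod (X s k))\<^sup>2)))
    = (\<Sum>k\<in>F. (cmod (X 0 k))\<^sup>2 - 2 * set_lebesgue_integral lborel {0..t} (\<lambda>s. Re (cnj (X s k) * adv (X s) (X s) k)))"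
    by (rule sum.cong[OF refl mode])
  ultimately show "(\<Sum>k\<in>F. (cmod (X t k))\<^sup>2)
      + 2 * (\<Sum>k\<in>F. 4 * pi\<^sup>2 * freq_sq k * set_lebesgue_integral lborel {0..t} (\<lambda>s. (cmod (X s k))\<^sup>2))
    = (\<Sum>k\<in>F. (cmod (X 0 k))\<^sup>2)
      - 2 * set_lebesgue_integral lborel {0..t} (\<lambda>s. \<Sum>k\<in>F. Re (cnj (X s k) * adv (X s) (X s) k))"
    by (simp only: sum.distrib sum_subtractf sum_distrib_left)
qed

lemma dominated_set_lebesgue_integral:
  fixes f :: "nat \<Rightarrow> real \<Rightarrow> real"
  assumes f: "\<And>n. set_integrable lborel A (f n)" and w: "set_integrable lborel A w" and g: "set_integrable lborel A g"
    and lim: "AE s in lborel. s \<in> A \<longrightarrow> (\<lambda>n. f n s) \<longlonglongrightarrow> g s"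
    and bound: "AE s in lborel. s \<in> A \<longrightarrow> (\<forall>n. \<bar>f n s\<bar> \<le> w s)"
  shows "(\<lambda>n. set_lebesgue_integral lborel A (f n)) \<longlonglongrightarrow> set_lebesgue_integral lborel A g"
  unfolding set_lebesgue_integral_def
proof (rule integral_dominated_convergence)
  show "(\<lambda>s. indicator A s *\<^sub>R g s) \<in> borel_measurable lborel"
    "\<And>n. (\<lambda>s. indicator A s *\<^sub>R f n s) \<in> borel_measurable lborel"
    "integrable lborel (\<lambda>s. indicator A s *\<^sub>R w s)"
    using f w g unfolding set_integrable_def by auto
  show "AE s in lborel. (\<lambda>n. indicator A s *\<^sub>R f n s) \<longlonglongrightarrow> indicator A s *\<^sub>R g s"
    using lim by eventually_elim (auto simp: indicator_def)
  show "AE s in lborel. norm (indicator A s *\<^sub>R f n s) \<le> indicator A s *\<^sub>R w s" for n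
    using bound by eventually_elim (auto simp: indicator_def)
qed

text \<open>
  In the limit of all frequencies the nonlinearity disappears from the energy balance, as it does
  no work at almost every time.
\<close>

lemma energy_inequality:
  assumes sol: "vorticity_solution T \<xi>0 \<xi>" and t: "t \<in> {0..T}" and G: "finite G"
  defines "X \<equiv> \<lambda>t. fourier (\<xi> t)"
  shows "(\<Sum>k\<in>G. (cmod (X t k))\<^sup>2)
      + 2 * (\<Sum>k\<in>G. 4 * pi\<^sup>2 * freq_sq k * set_lebesgue_integral lborel {0..t} (\<lambda>s. (cmod (X s k))\<^sup>2))
    \<le> (hnorm 0 (X 0))\<^sup>2"
proof -
  have X: "hpath T 0 X"
    using sol unfolding vorticity_solution_def C0_Sobolev_hpath X_def by blast
  have a: "set_integrable lborel {0..T} (\<lambda>t. (hnorm 1 (X t))\<^sup>2)"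
    using sol unfolding vorticity_solution_def Sobolev_norm_hnorm X_def by blast
  have reg: "AE s in lborel. s \<in> {0..T} \<longrightarrow> hs 1 (X s)"
    using sol unfolding vorticity_solution_def Sobolev_hs X_def by blast
  obtain R where R: "0 \<le> R" "\<And>t. hnorm 0 (X t) \<le> R" using hpath_bounded[OF X] by blast
  let ?I = "set_lebesgue_integral lborel {0..t}"
  define h where "h F s = (\<Sum>k\<in>F. Re (cnj (X s k) * adv (X s) (X s) k))" for F s
  define E where "E F = (\<Sum>k\<in>F. (cmod (X t k))\<^sup>2)
      + 2 * (\<Sum>k\<in>F. 4 * pi\<^sup>2 * freq_sq k * ?I (\<lambda>s. (cmod (X s k))\<^sup>2))" for F
  have "AE s in lborel. s \<in> {0..t} \<longrightarrow> hs 1 (X s)"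
    using reg t by auto
  obtain F :: "nat \<Rightarrow> freq set" where F: "filterlim F (finite_subsets_at_top UNIV) sequentially" "\<And>n. finite (F n)"
    using freq_exhaustion by blast
  have hint: "set_integrable lborel {0..t} (h (F n))" for n
    using energy_balance(3)[OF sol t F(2)] unfolding h_def X_def by simp
  have "(\<lambda>n. ?I (h (F n))) \<longlonglongrightarrow> ?I (\<lambda>s. 0)"
  proof (rule dominated_set_lebesgue_integral[OF hint])
    show "set_integrable lborel {0..t} (\<lambda>s. (2 * sqrt (kernel_const 0) * R) * (hnorm 1 (X s))\<^sup>2)"
      using t by (intro set_integrable_mult_right set_integrable_Icc_subset[OF a]) auto
    show "set_integrable lborel {0..t} (\<lambda>s. 0 :: real)" by (simp add: set_integrable_def)
    show "AE s in lborel. s \<in> {0..t} \<longrightarrow> (\<lambda>n. h (F n) s) \<longlonglongrightarrow> 0"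
      using \<open>AE s in lborel. s \<in> {0..t} \<longrightarrow> hs 1 (X s)\<close>
    proof eventually_elim
      case (elim s)
      show ?case
        unfolding h_def using elim adv_no_work[of "X s"] has_sum_exhaustion[OF F(1)] fourier_uminus
        by (auto simp: X_def)
    qed
    show "AE s in lborel. s \<in> {0..t} \<longrightarrow> (\<forall>n. \<bar>h (F n) s\<bar> \<le> (2 * sqrt (kernel_const 0) * R) * (hnorm 1 (X s))\<^sup>2)"
      using \<open>AE s in lborel. s \<in> {0..t} \<longrightarrow> hs 1 (X s)\<close>
    proof eventually_elim
      case (elim s)
      show ?case
      proof (intro impI allI)
        fix n assume "s \<in> {0..t}"
        with elim have hs1: "hs 1 (X s)" by simp
        have b: "bterm (X s) (X s) k summable_on UNIV" for k
          using bconv_L2_neg(1)[of 0 "X s" "X s" k] hpath_hs[OF X] by simp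
        have "\<bar>h (F n) s\<bar> \<le> (\<Sum>k\<in>F n. \<bar>Re (cnj (X s k) * adv (X s) (X s) k)\<bar>)"
          unfolding h_def by (rule sum_abs)
        also have "\<dots> \<le> (\<Sum>k\<in>F n. cmod (X s k) * (2 * sqrt (freq_sq k) * bconv (X s) (X s) k))"
        proof (intro sum_mono)
          fix k
          have "\<bar>Re (cnj (X s k) * adv (X s) (X s) k)\<bar> \<le> cmod (X s k) * cmod (adv (X s) (X s) k)"
            using abs_Re_le_cmod[of "cnj (X s k) * adv (X s) (X s) k"] by (simp add: norm_mult)
          also have "\<dots> \<le> cmod (X s k) * (2 * sqrt (freq_sq k) * bconv (X s) (X s) k)"
            by (intro mult_left_mono adv_le b) auto
          finally show "\<bar>Re (cnj (X s k) * adv (X s) (X s) k)\<bar> \<le> cmod (X s k) * (2 * sqrt (freq_sq k) * bconv (X s) (X s) k)" .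
        qed
        also have "\<dots> \<le> 2 * sqrt (kernel_const 0) * ((hnorm 1 (X s))\<^sup>2 * hnorm 0 (X s))"
          by (rule adv_work_bound[OF hs1 F(2)])
        also have "\<dots> \<le> 2 * sqrt (kernel_const 0) * ((hnorm 1 (X s))\<^sup>2 * R)"
          by (intro mult_left_mono R) (auto simp: kernel_const_nonneg)
        finally show "\<bar>h (F n) s\<bar> \<le> (2 * sqrt (kernel_const 0) * R) * (hnorm 1 (X s))\<^sup>2"
          by (simp add: mult_ac)
      qed
    qed
  qed
  then have lim: "(\<lambda>n. (hnorm 0 (X 0))\<^sup>2 - 2 * ?I (h (F n))) \<longlonglongrightarrow> (hnorm 0 (X 0))\<^sup>2 - 2 * 0"
    by (intro tendsto_intros) (simp add: set_lebesgue_integral_def)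
  have "E G \<le> (hnorm 0 (X 0))\<^sup>2 - 2 * 0"
  proof (rule tendsto_lowerbound[OF lim])
    have "\<forall>\<^sub>F n in sequentially. finite (F n) \<and> G \<subseteq> F n \<and> F n \<subseteq> UNIV"
      using F(1) G unfolding filterlim_finite_subsets_at_top by simp
    then show "\<forall>\<^sub>F n in sequentially. E G \<le> (hnorm 0 (X 0))\<^sup>2 - 2 * ?I (h (F n))"
    proof eventually_elim
      case (elim n)
      have "0 \<le> ?I (\<lambda>s. (cmod (X s k))\<^sup>2)" for k
        unfolding set_lebesgue_integral_def by (intro integral_nonneg_AE) auto
      then have "E G \<le> E (F n)"
        unfolding E_def using elim freq_sq_nonneg
        by (intro add_mono mult_left_mono sum_mono2) (auto intro!: mult_nonneg_nonneg)
      also have "E (F n) = (\<Sum>k\<in>F n. (cmod (X 0 k))\<^sup>2) - 2 * ?I (h (F n))"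
        using energy_balance(1)[OF sol t F(2)] unfolding E_def h_def X_def .
      also have "\<dots> \<le> (hnorm 0 (X 0))\<^sup>2 - 2 * ?I (h (F n))"
        by (intro diff_right_mono sum_cmod_le_hnorm0 hpath_hs[OF X] F)
      finally show ?case .
    qed
  qed simp
  then show ?thesis by (simp add: E_def)
qed

text \<open>
  The energy inequality bounds the integral of the gradient by the initial energy, and at each time
  the energy itself, whose integral contributes the factor \<open>T\<close>.
\<close>

lemma vorticity_H1_bound:
  assumes sol: "vorticity_solution T \<xi>0 \<xi>" and T: "0 \<le> T"
  defines "X \<equiv> \<lambda>t. fourier (\<xi> t)"
  shows "set_lebesgue_integral lborel {0..T} (\<lambda>t. (hnorm 1 (X t))\<^sup>2) \<le> (1 + T) * (hnorm 0 (X 0))\<^sup>2"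
proof -
  have X: "hpath T 0 X"
    using sol unfolding vorticity_solution_def C0_Sobolev_hpath X_def by blast
  have a: "set_integrable lborel {0..T} (\<lambda>t. (hnorm 1 (X t))\<^sup>2)"
    using sol unfolding vorticity_solution_def Sobolev_norm_hnorm X_def by blast
  have reg: "AE s in lborel. s \<in> {0..T} \<longrightarrow> hs 1 (X s)"
    using sol unfolding vorticity_solution_def Sobolev_hs X_def by blast
  let ?I = "set_lebesgue_integral lborel {0..T}"
  let ?S = "(hnorm 0 (X 0))\<^sup>2"
  have T_mem: "T \<in> {0..T}" using T by simp
  have sq: "set_integrable lborel {0..T} (\<lambda>s. (cmod (X s k))\<^sup>2)" for k
    using energy_balance(2)[OF sol T_mem finite.emptyI] unfolding X_def .
  have ei: "(\<Sum>k\<in>G. (cmod (X t k))\<^sup>2)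
      + 2 * (\<Sum>k\<in>G. 4 * pi\<^sup>2 * freq_sq k * set_lebesgue_integral lborel {0..t} (\<lambda>s. (cmod (X s k))\<^sup>2)) \<le> ?S"
    if "t \<in> {0..T}" "finite G" for t G
    using energy_inequality[OF sol that] unfolding X_def .
  have Inn: "0 \<le> ?I (\<lambda>s. (cmod (X s k))\<^sup>2)" for k
    unfolding set_lebesgue_integral_def by (intro integral_nonneg_AE) auto
  have wtint: "set_integrable lborel {0..T} (\<lambda>s. \<Sum>k\<in>F. (wt 1 (X s) k)\<^sup>2)" for F
    using sq unfolding wt_square set_integrable_def scaleR_sum_right
    by (intro Bochner_Integration.integrable_sum) (simp add: mult.left_commute)
  have bound: "?I (\<lambda>s. \<Sum>k\<in>F. (wt 1 (X s) k)\<^sup>2) \<le> (1 + T) * ?S" if F: "finite F" for F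
  proof -
    have c0: "?I (\<lambda>s. \<Sum>k\<in>F. (cmod (X s k))\<^sup>2) \<le> T * ?S"
    proof -
      have "?I (\<lambda>s. \<Sum>k\<in>F. (cmod (X s k))\<^sup>2) \<le> ?I (\<lambda>s. ?S)"
      proof (rule set_integral_mono)
        show "set_integrable lborel {0..T} (\<lambda>s. \<Sum>k\<in>F. (cmod (X s k))\<^sup>2)"
          using sq unfolding set_integrable_def scaleR_sum_right
          by (intro Bochner_Integration.integrable_sum) simp
        show "set_integrable lborel {0..T} (\<lambda>s. ?S)"
          by (rule set_integrable_bounded[where B = "?S"]) auto
        fix s assume s: "s \<in> {0..T}"
        have "0 \<le> set_lebesgue_integral lborel {0..s} (\<lambda>s. (cmod (X s k))\<^sup>2)" for k
          unfolding set_lebesgue_integral_def by (intro integral_nonneg_AE) auto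
        then have "0 \<le> (\<Sum>k\<in>F. 4 * pi\<^sup>2 * freq_sq k * set_lebesgue_integral lborel {0..s} (\<lambda>s. (cmod (X s k))\<^sup>2))"
          using freq_sq_nonneg by (intro sum_nonneg mult_nonneg_nonneg) auto
        with ei[OF s F]
        show "(\<Sum>k\<in>F. (cmod (X s k))\<^sup>2) \<le> ?S" by linarith
      qed
      also have "?I (\<lambda>s. ?S) = T * ?S"
        using T by (simp add: set_lebesgue_integral_def)
      finally show ?thesis .
    qed
    have c1: "(\<Sum>k\<in>F. freq_sq k * ?I (\<lambda>s. (cmod (X s k))\<^sup>2)) \<le> ?S"
    proof -
      have "(\<Sum>k\<in>F. freq_sq k * ?I (\<lambda>s. (cmod (X s k))\<^sup>2))
          \<le> (\<Sum>k\<in>F. 2 * (4 * pi\<^sup>2 * freq_sq k * ?I (\<lambda>s. (cmod (X s k))\<^sup>2)))"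
      proof (intro sum_mono)
        fix k
        have "1 \<le> 2 * (4 * pi\<^sup>2)" using pi_ge_two power_mono[of 2 pi 2] by simp
        then have "1 * (freq_sq k * ?I (\<lambda>s. (cmod (X s k))\<^sup>2)) \<le> 2 * (4 * pi\<^sup>2) * (freq_sq k * ?I (\<lambda>s. (cmod (X s k))\<^sup>2))"
          by (intro mult_right_mono mult_nonneg_nonneg freq_sq_nonneg Inn)
        then show "freq_sq k * ?I (\<lambda>s. (cmod (X s k))\<^sup>2) \<le> 2 * (4 * pi\<^sup>2 * freq_sq k * ?I (\<lambda>s. (cmod (X s k))\<^sup>2))"
          by (simp add: mult_ac)
      qed
      also have "\<dots> \<le> ?S"
        using ei[OF T_mem F] sum_nonneg[of F "\<lambda>k. (cmod (X T k))\<^sup>2"]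
        unfolding sum_distrib_left[symmetric] by simp
      finally show ?thesis .
    qed
    have "?I (\<lambda>s. \<Sum>k\<in>F. (wt 1 (X s) k)\<^sup>2) = (\<Sum>k\<in>F. ?I (\<lambda>s. (cmod (X s k))\<^sup>2) + freq_sq k * ?I (\<lambda>s. (cmod (X s k))\<^sup>2))"
    proof -
      have "?I (\<lambda>s. \<Sum>k\<in>F. (wt 1 (X s) k)\<^sup>2) = (\<Sum>k\<in>F. ?I (\<lambda>s. jap k * (cmod (X s k))\<^sup>2))"
        using sq jap_pos unfolding wt_square set_lebesgue_integral_def set_integrable_def scaleR_sum_right
        by (subst Bochner_Integration.integral_sum) (auto simp: mult.left_commute less_imp_le)
      then show ?thesis unfolding set_integral_mult_right by (simp add: jap_def algebra_simps)
    qed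
    also have "\<dots> = ?I (\<lambda>s. \<Sum>k\<in>F. (cmod (X s k))\<^sup>2) + (\<Sum>k\<in>F. freq_sq k * ?I (\<lambda>s. (cmod (X s k))\<^sup>2))"
      using sq unfolding set_lebesgue_integral_def set_integrable_def scaleR_sum_right sum.distrib
      by (subst Bochner_Integration.integral_sum) auto
    also have "\<dots> \<le> (1 + T) * ?S" using c0 c1 by (simp add: algebra_simps)
    finally show ?thesis .
  qed
  obtain F :: "nat \<Rightarrow> freq set" where F: "filterlim F (finite_subsets_at_top UNIV) sequentially" "\<And>n. finite (F n)"
    using freq_exhaustion by blast
  have "(\<lambda>n. ?I (\<lambda>s. \<Sum>k\<in>F n. (wt 1 (X s) k)\<^sup>2)) \<longlonglongrightarrow> ?I (\<lambda>t. (hnorm 1 (X t))\<^sup>2)"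
  proof (rule dominated_set_lebesgue_integral[OF wtint a a])
    show "AE s in lborel. s \<in> {0..T} \<longrightarrow> (\<lambda>n. \<Sum>k\<in>F n. (wt 1 (X s) k)\<^sup>2) \<longlonglongrightarrow> (hnorm 1 (X s))\<^sup>2"
      using reg by eventually_elim (auto simp: hs_wt hnorm_square intro!: has_sum_exhaustion[OF F(1)])
    show "AE s in lborel. s \<in> {0..T} \<longrightarrow> (\<forall>n. \<bar>\<Sum>k\<in>F n. (wt 1 (X s) k)\<^sup>2\<bar> \<le> (hnorm 1 (X s))\<^sup>2)"
      using reg by eventually_elim (auto simp: sum_nonneg intro!: hs_sum_le F(2))
  qed
  then show ?thesis
    by (rule tendsto_upperbound) (auto intro!: always_eventually bound F(2))
qed

subsection \<open>The initial datum\<close>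

lemma set_integrable_continuous_square:
  "continuous_on UNIV (f :: plane \<Rightarrow> real) \<Longrightarrow> set_integrable lborel unit_square f"
  unfolding set_integrable_def by (rule borel_integrable_compact) (auto intro: continuous_on_subset)

lemma set_integral_continuous_square:
  "continuous_on UNIV (f :: plane \<Rightarrow> real) \<Longrightarrow> set_lebesgue_integral lborel unit_square f = integral unit_square f"
  by (rule set_borel_integral_eq_integral(2)[OF set_integrable_continuous_square])

lemma L2_torus_set_integrable:
  assumes "L2_torus f"
  shows "set_integrable lborel unit_square f"
proof -
  have sq: "set_integrable lborel unit_square (\<lambda>x. 1 + (f x)\<^sup>2)"
    using assms unfolding L2_torus_def
    by (intro set_integral_add(1)[OF set_integrable_continuous_square[OF continuous_on_const]]) auto
  have "set_borel_measurable lborel unit_square f"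
    using assms unfolding L2_torus_def set_borel_measurable_def by auto
  moreover have "norm (f x) \<le> norm (1 + (f x)\<^sup>2)" for x
    using zero_le_power2[of "\<bar>f x\<bar> - 1"] by (simp add: power2_eq_square algebra_simps)
  ultimately show ?thesis
    by (intro set_integrable_bound[OF sq]) auto
qed

lemma pairing_distr_of_fun:
  assumes f: "L2_torus f"
  shows "pairing (distr_of_fun f) \<phi> = set_lebesgue_integral lborel unit_square (\<lambda>x. f x * test_eval \<phi> x)"
proof -
  let ?p = "\<lambda>\<phi>. set_lebesgue_integral lborel unit_square (\<lambda>x. f x * test_eval \<phi> x)"
  note fint = L2_torus_set_integrable[OF f]
  have int: "set_integrable lborel unit_square (\<lambda>x. f x * test_eval \<phi> x)" for \<phi>
    by (intro set_integrable_mult_bounded[OF fint, where M = "test_sup \<phi>"] borel_measurable_continuous_onI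
        eval_continuous le_test_sup)
  have "linear ?p"
  proof (rule linearI)
    show "?p (\<phi> + \<psi>) = ?p \<phi> + ?p \<psi>" for \<phi> \<psi>
      unfolding eval_add distrib_left by (rule set_integral_add(2)[OF int int])
    show "?p (c *\<^sub>R \<phi>) = c *\<^sub>R ?p \<phi>" for c \<phi>
      unfolding eval_scaleR by (simp add: mult.left_commute)
  qed
  moreover have "test_continuous ?p"
  proof -
    have "\<bar>?p \<phi>\<bar> \<le> set_lebesgue_integral lborel unit_square (\<lambda>x. \<bar>f x\<bar>) * test_norm 0 \<phi>" for \<phi>
    proof -
      have "\<bar>?p \<phi>\<bar> \<le> set_lebesgue_integral lborel unit_square (\<lambda>x. norm (f x * test_eval \<phi> x))"
        using set_integral_norm_bound[OF int] by simp
      also have "\<dots> \<le> set_lebesgue_integral lborel unit_square (\<lambda>x. \<bar>f x\<bar> * test_sup \<phi>)"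
      proof (rule set_integral_mono)
        show "norm (f x * test_eval \<phi> x) \<le> \<bar>f x\<bar> * test_sup \<phi>" if "x \<in> unit_square" for x
          using mult_left_mono[OF le_test_sup[OF that]] by (simp only: real_norm_def abs_mult abs_ge_zero)
        show "set_integrable lborel unit_square (\<lambda>x. norm (f x * test_eval \<phi> x))"
          by (rule set_integrable_norm[OF int])
        show "set_integrable lborel unit_square (\<lambda>x. \<bar>f x\<bar> * test_sup \<phi>)"
          using set_integrable_norm[OF fint] by (simp only: real_norm_def set_integrable_mult_left)
      qed
      finally show ?thesis by (simp add: test_norm_0)
    qed
    then show ?thesis unfolding test_continuous_def by blast
  qed
  ultimately show ?thesis
    unfolding distr_of_fun_def by (subst Abs_torus_distr_inverse) auto
qed

text \<open>
  Bessel's inequality, from \<open>(f - p)\<^sup>2 \<ge> 0\<close> with \<open>p\<close> a partial sum of the real form of the Fourier series. For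
  \<open>k \<noteq> 0\<close> the terms for \<open>k\<close> and \<open>- k\<close> are the same function, whose square integral is half of the square
  modulus of the coefficient; so the square integral of \<open>p\<close> is at most the sum of the square moduli, with
  equality if the set of frequencies is symmetric.
\<close>

lemma Bessel_L2_torus:
  assumes f: "L2_torus f"
  shows "hs 0 (fourier (distr_of_fun f))" "hnorm 0 (fourier (distr_of_fun f)) \<le> L2_torus_norm f"
proof -
  define c where "c = fourier (distr_of_fun f)"
  let ?I = "set_lebesgue_integral lborel unit_square"
  note fint = L2_torus_set_integrable[OF f]
  have f2: "set_integrable lborel unit_square (\<lambda>x. (f x)\<^sup>2)" using f unfolding L2_torus_def by blast
  have c: "Re (c k) = ?I (\<lambda>x. f x * cos (phase k x))" "Im (c k) = - ?I (\<lambda>x. f x * sin (phase k x))" for k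
    by (simp_all add: c_def fourier_tests pairing_distr_of_fun[OF f] eval_cos_test eval_sin_test)
  have bound: "(\<Sum>k\<in>F. (cmod (c k))\<^sup>2) \<le> ?I (\<lambda>x. (f x)\<^sup>2)" if F: "finite F" for F
  proof -
    define t where "t k x = Re (c k) * cos (phase k x) + (- Im (c k)) * sin (phase k x)" for k x
    define p where "p x = (\<Sum>k\<in>F. t k x)" for x
    have t_cont: "continuous_on S (t k)" for k S unfolding t_def by (intro continuous_intros)
    have p_cont: "continuous_on S p" for S unfolding p_def by (intro continuous_intros t_cont)
    have int: "set_integrable lborel unit_square (\<lambda>x. f x * g x)" if "continuous_on UNIV g" "\<And>x. \<bar>g x\<bar> \<le> M" for g M
      by (intro set_integrable_mult_bounded[OF fint, where M = M] borel_measurable_continuous_onI that)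
    have t_le: "\<bar>t k x\<bar> \<le> \<bar>Re (c k)\<bar> + \<bar>Im (c k)\<bar>" for k x
    proof -
      have "\<bar>t k x\<bar> \<le> \<bar>Re (c k)\<bar> * \<bar>cos (phase k x)\<bar> + \<bar>Im (c k)\<bar> * \<bar>sin (phase k x)\<bar>"
        unfolding t_def using abs_triangle_ineq[of "Re (c k) * cos (phase k x)" "- Im (c k) * sin (phase k x)"]
        by (simp add: abs_mult)
      also have "\<dots> \<le> \<bar>Re (c k)\<bar> * 1 + \<bar>Im (c k)\<bar> * 1" by (intro add_mono mult_left_mono) auto
      finally show ?thesis by simp
    qed
    have p_le: "\<bar>p x\<bar> \<le> (\<Sum>k\<in>F. \<bar>Re (c k)\<bar> + \<bar>Im (c k)\<bar>)" for x
      unfolding p_def by (rule order_trans[OF sum_abs sum_mono[OF t_le]])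
    have ft: "?I (\<lambda>x. f x * t k x) = (cmod (c k))\<^sup>2" for k
    proof -
      have "?I (\<lambda>x. f x * t k x) = ?I (\<lambda>x. Re (c k) * (f x * cos (phase k x)) + (- Im (c k)) * (f x * sin (phase k x)))"
        by (simp add: t_def algebra_simps)
      also have "\<dots> = Re (c k) * Re (c k) + (- Im (c k)) * (- Im (c k))"
      proof -
        have i: "set_integrable lborel unit_square (\<lambda>x. f x * cos (phase k x))"
          "set_integrable lborel unit_square (\<lambda>x. f x * sin (phase k x))"
          by (rule int[OF _ abs_cos_le_one] int[OF _ abs_sin_le_one], intro continuous_intros)+
        show ?thesis
          by (simp only: set_integral_add(2)[OF set_integrable_mult_right set_integrable_mult_right] i
              set_integral_mult_right c minus_minus)
      qed
      finally show ?thesis unfolding cmod_power2 by (simp add: power2_eq_square)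
    qed
    have fp: "?I (\<lambda>x. f x * p x) = (\<Sum>k\<in>F. (cmod (c k))\<^sup>2)"
    proof -
      have "?I (\<lambda>x. f x * p x) = (\<Sum>k\<in>F. ?I (\<lambda>x. f x * t k x))"
        using int[OF t_cont t_le]
        unfolding p_def sum_distrib_left set_lebesgue_integral_def set_integrable_def scaleR_sum_right
        by (intro Bochner_Integration.integral_sum)
      then show ?thesis by (simp only: ft)
    qed
    have tt: "integral unit_square (\<lambda>x. t k x * t m x)
        = Re (c k) * Re (c m) * ((kdelta (k - m) + kdelta (k + m)) / 2)
        + Im (c k) * Im (c m) * ((kdelta (k - m) - kdelta (k + m)) / 2)" for k m
    proof -
      let ?A = "\<lambda>x. Re (c k) * Re (c m) * (cos (phase k x) * cos (phase m x)) + (- Re (c k) * Im (c m)) * (cos (phase k x) * sin (phase m x))"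
      let ?B = "\<lambda>x. (- Im (c k) * Re (c m)) * (sin (phase k x) * cos (phase m x)) + Im (c k) * Im (c m) * (sin (phase k x) * sin (phase m x))"
      have "integral unit_square (\<lambda>x. t k x * t m x) = integral unit_square (\<lambda>x. 1 * ?A x + 1 * ?B x)"
        by (simp add: t_def algebra_simps)
      also have "\<dots> = 1 * integral unit_square ?A + 1 * integral unit_square ?B"
        by (rule integral_lincomb) (intro continuous_intros)+
      also have "integral unit_square ?A = Re (c k) * Re (c m) * ((kdelta (k - m) + kdelta (k + m)) / 2)"
        by (subst integral_lincomb) (auto intro!: continuous_intros simp: trig_orthogonality)
      also have "integral unit_square ?B = Im (c k) * Im (c m) * ((kdelta (k - m) - kdelta (k + m)) / 2)"
        by (subst integral_lincomb) (auto intro!: continuous_intros simp: trig_orthogonality)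
      finally show ?thesis by simp
    qed
    have row: "(\<Sum>m\<in>F. integral unit_square (\<lambda>x. t k x * t m x)) \<le> (cmod (c k))\<^sup>2" for k
    proof -
      have sym: "c (- k) = cnj (c k)" by (simp add: c_def fourier_uminus)
      have cm: "(cmod (c k))\<^sup>2 = Re (c k) * Re (c k) + Im (c k) * Im (c k)"
        unfolding cmod_power2 by (simp add: power2_eq_square)
      let ?g = "\<lambda>m. (Re (c k) * Re (c m) + Im (c k) * Im (c m)) / 2 * kdelta (k - m)"
      let ?h = "\<lambda>m. (Re (c k) * Re (c m) - Im (c k) * Im (c m)) / 2 * kdelta (k + m)"
      have "(\<Sum>m\<in>F. ?g m) = (\<Sum>m\<in>F. if m = k then (cmod (c k))\<^sup>2 / 2 else 0)"
        by (intro sum.cong) (auto simp: kdelta_def cm)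
      moreover have "(\<Sum>m\<in>F. ?h m) = (\<Sum>m\<in>F. if m = - k then (cmod (c k))\<^sup>2 / 2 else 0)"
        using sym by (intro sum.cong) (auto simp: kdelta_def cm add_eq_0_iff)
      moreover have "(\<Sum>m\<in>F. integral unit_square (\<lambda>x. t k x * t m x)) = (\<Sum>m\<in>F. ?g m) + (\<Sum>m\<in>F. ?h m)"
        unfolding tt sum.distrib[symmetric] by (intro sum.cong) (auto simp: field_simps)
      ultimately show ?thesis using F by simp
    qed
    have pp: "?I (\<lambda>x. p x * p x) \<le> (\<Sum>k\<in>F. (cmod (c k))\<^sup>2)"
    proof -
      have "?I (\<lambda>x. p x * p x) = integral unit_square (\<lambda>x. \<Sum>k\<in>F. \<Sum>m\<in>F. t k x * t m x)"
        by (subst set_integral_continuous_square) (intro continuous_intros p_cont, simp only: p_def sum_product)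
      also have "\<dots> = (\<Sum>k\<in>F. \<Sum>m\<in>F. integral unit_square (\<lambda>x. t k x * t m x))"
        using F by (simp add: integral_sum continuous_integrable_square continuous_intros t_cont integrable_sum)
      also have "\<dots> \<le> (\<Sum>k\<in>F. (cmod (c k))\<^sup>2)" by (intro sum_mono row)
      finally show ?thesis .
    qed
    have "0 \<le> ?I (\<lambda>x. (f x - p x)\<^sup>2)"
      unfolding set_lebesgue_integral_def by (intro integral_nonneg_AE) auto
    also have "?I (\<lambda>x. (f x - p x)\<^sup>2) = ?I (\<lambda>x. (f x)\<^sup>2 - (2 * (f x * p x) - p x * p x))"
      by (simp add: power2_eq_square algebra_simps)
    also have "\<dots> = ?I (\<lambda>x. (f x)\<^sup>2) - (2 * ?I (\<lambda>x. f x * p x) - ?I (\<lambda>x. p x * p x))"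
    proof -
      have ipp: "set_integrable lborel unit_square (\<lambda>x. p x * p x)"
        by (intro set_integrable_continuous_square continuous_intros p_cont)
      have ifp: "set_integrable lborel unit_square (\<lambda>x. 2 * (f x * p x))"
        by (intro set_integrable_mult_right int[OF p_cont p_le])
      show ?thesis
        by (simp only: set_integral_diff(2)[OF f2 set_integral_diff(1)[OF ifp ipp]] set_integral_diff(2)[OF ifp ipp] set_integral_mult_right)
    qed
    finally show ?thesis using fp pp by simp
  qed
  have wt0: "(wt 0 c k)\<^sup>2 = (cmod (c k))\<^sup>2" for k
    using jap_pos[of k] by (simp add: wt_def)
  have nn: "0 \<le> ?I (\<lambda>x. (f x)\<^sup>2)"
    unfolding set_lebesgue_integral_def by (intro integral_nonneg_AE) auto
  have "hs 0 c" "(hnorm 0 c)\<^sup>2 \<le> ?I (\<lambda>x. (f x)\<^sup>2)"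
    using hs_boundI[OF nn, of 0 c] bound by (simp_all only: wt0)
  then show "hs 0 (fourier (distr_of_fun f))" "hnorm 0 (fourier (distr_of_fun f)) \<le> L2_torus_norm f"
    unfolding L2_torus_norm_def c_def by (auto intro: real_le_rsqrt)
qed

section \<open>The linearised equation in Fourier variables\<close>

text \<open>
  The coefficients \<open>X\<close> of a path in \<open>C L\<^sup>2 \<inter> L\<^sup>2 H\<^sup>1\<close>, which takes the role of \<open>\<xi>\<close>: the vorticity equation
  enters only through the energy estimate.
\<close>

locale transport =
  fixes T \<sigma> :: real and X :: "real \<Rightarrow> freq \<Rightarrow> complex"
  assumes T_pos: "0 < T" and \<sigma>: "- 1 < \<sigma>" "\<sigma> \<le> 0"
    and X: "hpath T 0 X" and X_sym: "\<And>t k. X t (- k) = cnj (X t k)"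
    and X_reg: "AE s in lborel. s \<in> {0..T} \<longrightarrow> hs 1 (X s)"
    and X_int: "set_integrable lborel {0..T} (\<lambda>s. (hnorm 1 (X s))\<^sup>2)"
begin

abbreviation "time_int t f \<equiv> set_lebesgue_integral lborel {0..t} f"

text \<open>
  The terms of the mild equation: \<open>lin Y\<close> is the linearisation of the transport term at \<open>X\<close>, and
  \<open>duhamel Y\<close> its integral against the heat semigroup.
\<close>

definition h1_sq :: "real \<Rightarrow> real" where "h1_sq s = (hnorm 1 (X s))\<^sup>2"

definition bil_const :: real where "bil_const = 4 * kernel_const \<sigma> + 1"

definition lin :: "(real \<Rightarrow> freq \<Rightarrow> complex) \<Rightarrow> real \<Rightarrow> freq \<Rightarrow> complex" where
  "lin Y s k = adv (Y s) (X s) k + adv (X s) (Y s) k"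

definition lam :: "freq \<Rightarrow> real" where "lam k = 4 * pi\<^sup>2 * freq_sq k"

definition duhamel :: "(real \<Rightarrow> freq \<Rightarrow> complex) \<Rightarrow> real \<Rightarrow> freq \<Rightarrow> complex" where
  "duhamel Y t k = (if t \<in> {0..T} then time_int t (\<lambda>s. of_real (exp (- (lam k * (t - s)))) * lin Y s k) else 0)"

lemma bil_const_pos: "0 < bil_const"
  using kernel_const_nonneg[of \<sigma>] by (simp add: bil_const_def)

lemma lam_nonneg: "0 \<le> lam k"
  by (simp add: lam_def freq_sq_nonneg)

lemma h1_sq_nonneg: "0 \<le> h1_sq s" by (simp add: h1_sq_def)

lemma h1_sq_int: "set_integrable lborel {0..T} h1_sq"
  using X_int by (simp add: h1_sq_def[abs_def])

lemma lin_summable: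
  assumes Y: "hpath T \<sigma> Y"
  shows "bterm (Y s) (X s) k summable_on UNIV" "bterm (X s) (Y s) k summable_on UNIV"
  using bconv_neg_L2(1)[of \<sigma> "Y s" "X s" k] bconv_L2_neg(1)[of \<sigma> "X s" "Y s" k] \<sigma> hpath_hs[OF X] hpath_hs[OF Y]
  by simp_all

lemma sqrt_freq_sq_le: "sqrt (freq_sq k) \<le> jap k"
proof -
  have "freq_sq k \<le> (jap k)\<^sup>2"
    using freq_sq_nonneg[of k] by (simp add: jap_def power2_eq_square algebra_simps)
  then show ?thesis using jap_pos[of k] by (intro real_le_lsqrt) auto
qed

text \<open>
  A bound at all times, uniform but of one power too many in the frequency; it serves for measurability
  and for the exchange of sums and integrals.
\<close>

lemma lin_bound:
  assumes Y: "hpath T \<sigma> Y"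
  shows "\<exists>C\<ge>0. \<forall>s k. cmod (lin Y s k) \<le> C * (jap k)\<^sup>2"
proof -
  obtain R where R: "0 \<le> R" "\<And>t. hnorm 0 (X t) \<le> R" using hpath_bounded[OF X] by blast
  obtain Q where Q: "0 \<le> Q" "\<And>t. hnorm \<sigma> (Y t) \<le> Q" using hpath_bounded[OF Y] by blast
  have "cmod (lin Y s k) \<le> (6 * (R * Q)) * (jap k)\<^sup>2" for s k
  proof -
    note b = lin_summable[OF Y, of s k]
    have "bconv (Y s) (X s) k \<le> hnorm \<sigma> (Y s) * hnorm 0 (X s)"
      using bconv_neg_L2(2)[of \<sigma> "Y s" "X s" k] \<sigma> hpath_hs[OF X] hpath_hs[OF Y] by simp
    also have "\<dots> \<le> Q * R" by (intro mult_mono R Q hnorm_nonneg)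
    also have "\<dots> \<le> jap k * (R * Q)"
      using mult_right_mono[OF jap_ge1[of k], of "R * Q"] R Q by (simp add: mult.commute)
    finally have 1: "bconv (Y s) (X s) k \<le> jap k * (R * Q)" .
    have "bconv (X s) (Y s) k \<le> 2 * jap k * (hnorm 0 (X s) * hnorm \<sigma> (Y s))"
      using bconv_L2_neg(2)[of \<sigma> "X s" "Y s" k] \<sigma> hpath_hs[OF X] hpath_hs[OF Y] by simp
    also have "\<dots> \<le> 2 * jap k * (R * Q)"
      using jap_pos[of k] by (intro mult_left_mono mult_mono R Q hnorm_nonneg) auto
    finally have 2: "bconv (X s) (Y s) k \<le> 2 * jap k * (R * Q)" .
    have "cmod (lin Y s k) \<le> cmod (adv (Y s) (X s) k) + cmod (adv (X s) (Y s) k)"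
      unfolding lin_def by (rule norm_triangle_ineq)
    also have "\<dots> \<le> 2 * sqrt (freq_sq k) * bconv (Y s) (X s) k + 2 * sqrt (freq_sq k) * bconv (X s) (Y s) k"
      by (intro add_mono adv_le b)
    also have "\<dots> \<le> 2 * jap k * (jap k * (R * Q)) + 2 * jap k * (2 * jap k * (R * Q))"
      using jap_pos[of k] freq_sq_nonneg[of k]
      by (intro add_mono mult_mono 1 2 sqrt_freq_sq_le bconv_nonneg) auto
    finally show ?thesis by (simp add: power2_eq_square algebra_simps)
  qed
  then show ?thesis using R Q by (intro exI[of _ "6 * (R * Q)"]) auto
qed

lemma lin_measurable:
  assumes Y: "hpath T \<sigma> Y"
  shows "(\<lambda>s. lin Y s k) \<in> borel_measurable borel"
  unfolding lin_def adv_def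
  by (intro borel_measurable_add borel_measurable_infsum_freq adv_summable lin_summable[OF Y]
      borel_measurable_times borel_measurable_const hpath_measurable_coeff[OF X] hpath_measurable_coeff[OF Y])

lemma lin_zero_freq: "lin Y s 0 = 0"
  by (simp add: lin_def adv_zero_freq)

lemma adv_lincomb_left:
  assumes "bterm x y k summable_on UNIV" "bterm x' y k summable_on UNIV"
  shows "adv (\<lambda>k. a * x k + x' k) y k = a * adv x y k + adv x' y k"
  unfolding adv_def infsum_cmult_right[OF adv_summable[OF assms(1)], symmetric]
    infsum_add[OF summable_on_cmult_right[OF adv_summable[OF assms(1)]] adv_summable[OF assms(2)], symmetric]
  by (rule infsum_cong) (simp add: algebra_simps)

lemma adv_lincomb_right:
  assumes "bterm y x k summable_on UNIV" "bterm y x' k summable_on UNIV"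
  shows "adv y (\<lambda>k. a * x k + x' k) k = a * adv y x k + adv y x' k"
  unfolding adv_def infsum_cmult_right[OF adv_summable[OF assms(1)], symmetric]
    infsum_add[OF summable_on_cmult_right[OF adv_summable[OF assms(1)]] adv_summable[OF assms(2)], symmetric]
  by (rule infsum_cong) (simp add: algebra_simps)

lemma lin_lincomb:
  assumes Y: "hpath T \<sigma> Y" and W: "hpath T \<sigma> W"
  shows "lin (\<lambda>t k. a * Y t k + W t k) s k = a * lin Y s k + lin W s k"
  unfolding lin_def adv_lincomb_left[OF lin_summable(1)[OF Y] lin_summable(1)[OF W]]
    adv_lincomb_right[OF lin_summable(2)[OF Y] lin_summable(2)[OF W]]
  by (simp add: algebra_simps)

lemma adv_square_le:
  assumes "bterm x y k summable_on UNIV"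
  shows "(cmod (adv x y k))\<^sup>2 \<le> lam k * (bconv x y k)\<^sup>2"
proof -
  have "(cmod (adv x y k))\<^sup>2 \<le> (2 * sqrt (freq_sq k) * bconv x y k)\<^sup>2"
    by (intro power_mono adv_le assms) simp
  also have "\<dots> = 4 * freq_sq k * (bconv x y k)\<^sup>2"
    using freq_sq_nonneg[of k] by (simp add: power_mult_distrib)
  also have "\<dots> \<le> lam k * (bconv x y k)\<^sup>2"
  proof (rule mult_right_mono)
    have "1 \<le> pi\<^sup>2" using pi_ge_two by simp
    then show "4 * freq_sq k \<le> lam k"
      using mult_right_mono[of 1 "pi\<^sup>2" "freq_sq k"] freq_sq_nonneg[of k] by (simp add: lam_def)
  qed simp
  finally show ?thesis .
qed

text \<open>
  The bilinear estimates for the sharp order, valid at almost every time: dividing by \<open>lam k\<close> removes the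
  square of the derivative in \<open>lin\<close>.
\<close>

lemma lin_square_sum:
  assumes Y: "hpath T \<sigma> Y" and s: "hs 1 (X s)" and F: "finite F"
  shows "(\<Sum>k\<in>F. jap k powr \<sigma> * ((cmod (lin Y s k))\<^sup>2 / lam k)) \<le> bil_const * (h1_sq s * (hnorm \<sigma> (Y s))\<^sup>2)"
proof -
  have "jap k powr \<sigma> * ((cmod (lin Y s k))\<^sup>2 / lam k)
      \<le> 2 * (jap k powr (\<sigma> / 2) * bconv (Y s) (X s) k)\<^sup>2 + 2 * (jap k powr (\<sigma> / 2) * bconv (X s) (Y s) k)\<^sup>2" for k
  proof -
    let ?b = "bconv (Y s) (X s) k" and ?c = "bconv (X s) (Y s) k"
    have "(cmod (lin Y s k))\<^sup>2 \<le> (cmod (adv (Y s) (X s) k) + cmod (adv (X s) (Y s) k))\<^sup>2"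
      unfolding lin_def by (intro power_mono norm_triangle_ineq) simp
    also have "\<dots> \<le> 2 * (cmod (adv (Y s) (X s) k))\<^sup>2 + 2 * (cmod (adv (X s) (Y s) k))\<^sup>2"
      using zero_le_power2[of "cmod (adv (Y s) (X s) k) - cmod (adv (X s) (Y s) k)"]
      by (simp add: power2_eq_square algebra_simps)
    also have "\<dots> \<le> 2 * (lam k * ?b\<^sup>2) + 2 * (lam k * ?c\<^sup>2)"
      by (intro add_mono mult_left_mono adv_square_le lin_summable[OF Y]) auto
    finally have "(cmod (lin Y s k))\<^sup>2 / lam k \<le> 2 * ?b\<^sup>2 + 2 * ?c\<^sup>2"
      using lam_nonneg[of k] by (cases "lam k = 0") (simp_all add: divide_le_eq algebra_simps)
    then have "jap k powr \<sigma> * ((cmod (lin Y s k))\<^sup>2 / lam k) \<le> jap k powr \<sigma> * (2 * ?b\<^sup>2 + 2 * ?c\<^sup>2)"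
      by (rule mult_left_mono) simp
    then show ?thesis by (simp add: power_mult_distrib jap_powr_square algebra_simps)
  qed
  then have "(\<Sum>k\<in>F. jap k powr \<sigma> * ((cmod (lin Y s k))\<^sup>2 / lam k))
      \<le> 2 * (\<Sum>k\<in>F. (jap k powr (\<sigma> / 2) * bconv (Y s) (X s) k)\<^sup>2) + 2 * (\<Sum>k\<in>F. (jap k powr (\<sigma> / 2) * bconv (X s) (Y s) k)\<^sup>2)"
    unfolding sum_distrib_left sum.distrib[symmetric] by (rule sum_mono)
  also have "\<dots> \<le> 2 * (kernel_const \<sigma> * ((hnorm \<sigma> (Y s))\<^sup>2 * (hnorm 1 (X s))\<^sup>2))
      + 2 * (kernel_const \<sigma> * ((hnorm 1 (X s))\<^sup>2 * (hnorm \<sigma> (Y s))\<^sup>2))"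
    by (intro add_mono mult_left_mono bconv_neg_H1(2) bconv_H1_neg(2) \<sigma> hpath_hs[OF Y] s F) auto
  also have "\<dots> = (4 * kernel_const \<sigma>) * (h1_sq s * (hnorm \<sigma> (Y s))\<^sup>2)"
    by (simp add: h1_sq_def)
  also have "\<dots> \<le> bil_const * (h1_sq s * (hnorm \<sigma> (Y s))\<^sup>2)"
    by (intro mult_right_mono mult_nonneg_nonneg h1_sq_nonneg) (auto simp: bil_const_def)
  finally show ?thesis .
qed

lemma lin_square_int:
  assumes Y: "hpath T \<sigma> Y"
  shows "set_integrable lborel {0..t} (\<lambda>s. (cmod (lin Y s k))\<^sup>2 / lam k)"
proof -
  obtain C where C: "0 \<le> C" "\<And>s k. cmod (lin Y s k) \<le> C * (jap k)\<^sup>2" using lin_bound[OF Y] by blast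
  show ?thesis
  proof (rule set_integrable_bounded)
    have "(\<lambda>s. cmod (lin Y s k)) \<in> borel_measurable borel"
      by (rule borel_measurable_continuous_on[OF continuous_on_norm_id lin_measurable[OF Y]])
    then show "(\<lambda>s. (cmod (lin Y s k))\<^sup>2 / lam k) \<in> borel_measurable borel" by simp
    show "norm ((cmod (lin Y s k))\<^sup>2 / lam k) \<le> (C * (jap k)\<^sup>2)\<^sup>2 / lam k" for s
      using lam_nonneg[of k] C(2)[of s k] by (simp add: divide_right_mono power_mono)
  qed
qed

lemma duhamel_square:
  assumes Y: "hpath T \<sigma> Y" and t: "t \<in> {0..T}"
  shows "(cmod (duhamel Y t k))\<^sup>2 \<le> time_int t (\<lambda>s. (cmod (lin Y s k))\<^sup>2 / lam k)"
proof (cases "lam k = 0")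
  case True
  then have "k = 0"
    by (simp add: lam_def freq_sq_def prod_eq_iff sum_power2_eq_zero_iff)
  then show ?thesis by (simp add: duhamel_def lin_zero_freq)
next
  case False
  with lam_nonneg[of k] have "0 < lam k" by simp
  obtain C where C: "0 \<le> C" "\<And>s k. cmod (lin Y s k) \<le> C * (jap k)\<^sup>2" using lin_bound[OF Y] by blast
  show ?thesis
    unfolding duhamel_def using t
    by (simp only: if_True) (rule heat_kernel_L2[OF lin_measurable[OF Y] C(2) \<open>0 < lam k\<close>], simp)
qed

lemma energy_density_int:
  assumes Y: "hpath T \<sigma> Y" and t: "t \<le> T"
  shows "set_integrable lborel {0..t} (\<lambda>s. h1_sq s * (hnorm \<sigma> (Y s))\<^sup>2)"
proof -
  obtain Q where Q: "0 \<le> Q" "\<And>t. hnorm \<sigma> (Y t) \<le> Q" using hpath_bounded[OF Y] by blast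
  have "(\<lambda>s. (hnorm \<sigma> (Y s))\<^sup>2) \<in> borel_measurable borel"
    using hpath_measurable_hnorm[OF Y] by simp
  moreover have "\<bar>(hnorm \<sigma> (Y s))\<^sup>2\<bar> \<le> Q\<^sup>2" for s
    using Q(2)[of s] by (simp add: power_mono hnorm_nonneg)
  ultimately show ?thesis
    by (intro set_integrable_Icc_subset[OF _ t] set_integrable_mult_bounded[OF h1_sq_int])
qed

lemma duhamel_mode_sum:
  assumes Y: "hpath T \<sigma> Y" and t: "t \<in> {0..T}" and F: "finite F"
  shows "(\<Sum>k\<in>F. jap k powr \<sigma> * time_int t (\<lambda>s. (cmod (lin Y s k))\<^sup>2 / lam k))
    \<le> bil_const * time_int t (\<lambda>s. h1_sq s * (hnorm \<sigma> (Y s))\<^sup>2)"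
proof -
  have int: "set_integrable lborel {0..t} (\<lambda>s. jap k powr \<sigma> * ((cmod (lin Y s k))\<^sup>2 / lam k))" for k
    by (rule set_integrable_mult_right) (rule lin_square_int[OF Y])
  have "(\<Sum>k\<in>F. jap k powr \<sigma> * time_int t (\<lambda>s. (cmod (lin Y s k))\<^sup>2 / lam k))
      = time_int t (\<lambda>s. \<Sum>k\<in>F. jap k powr \<sigma> * ((cmod (lin Y s k))\<^sup>2 / lam k))"
    unfolding set_integral_mult_right[symmetric]
    using int unfolding set_lebesgue_integral_def set_integrable_def scaleR_sum_right
    by (intro Bochner_Integration.integral_sum[symmetric])
  also have "\<dots> \<le> time_int t (\<lambda>s. bil_const * (h1_sq s * (hnorm \<sigma> (Y s))\<^sup>2))"
  proof (rule set_integral_mono_AE)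
    show "set_integrable lborel {0..t} (\<lambda>s. \<Sum>k\<in>F. jap k powr \<sigma> * ((cmod (lin Y s k))\<^sup>2 / lam k))"
      using int unfolding set_integrable_def scaleR_sum_right by (intro Bochner_Integration.integrable_sum)
    show "set_integrable lborel {0..t} (\<lambda>s. bil_const * (h1_sq s * (hnorm \<sigma> (Y s))\<^sup>2))"
      using t by (intro set_integrable_mult_right energy_density_int[OF Y]) auto
    show "AE s \<in> {0..t} in lborel. (\<Sum>k\<in>F. jap k powr \<sigma> * ((cmod (lin Y s k))\<^sup>2 / lam k)) \<le> bil_const * (h1_sq s * (hnorm \<sigma> (Y s))\<^sup>2)"
      using X_reg
    proof eventually_elim
      case (elim s)
      then show ?case using lin_square_sum[OF Y _ F, of s] t by auto
    qed
  qed
  finally show ?thesis by simp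
qed

text \<open>
  The estimate on which everything rests. The square norm of the Duhamel term is bounded by an integral
  over the past without a singular kernel, because the semigroup is used in the square mean in time.
\<close>

lemma duhamel_hs:
  assumes Y: "hpath T \<sigma> Y" and t: "t \<in> {0..T}"
  shows "hs \<sigma> (duhamel Y t)" "(hnorm \<sigma> (duhamel Y t))\<^sup>2 \<le> bil_const * time_int t (\<lambda>s. h1_sq s * (hnorm \<sigma> (Y s))\<^sup>2)"
proof -
  have nn: "0 \<le> bil_const * time_int t (\<lambda>s. h1_sq s * (hnorm \<sigma> (Y s))\<^sup>2)"
    unfolding set_lebesgue_integral_def using bil_const_pos h1_sq_nonneg
    by (intro mult_nonneg_nonneg integral_nonneg_AE) auto
  have "(\<Sum>k\<in>F. (wt \<sigma> (duhamel Y t) k)\<^sup>2) \<le> bil_const * time_int t (\<lambda>s. h1_sq s * (hnorm \<sigma> (Y s))\<^sup>2)" if "finite F" for F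
    unfolding wt_square
    by (rule order_trans[OF sum_mono[OF mult_left_mono[OF duhamel_square[OF Y t]]] duhamel_mode_sum[OF Y t that]]) simp
  then show "hs \<sigma> (duhamel Y t)" "(hnorm \<sigma> (duhamel Y t))\<^sup>2 \<le> bil_const * time_int t (\<lambda>s. h1_sq s * (hnorm \<sigma> (Y s))\<^sup>2)"
    using hs_boundI[OF nn, of \<sigma> "duhamel Y t"] by blast+
qed

lemma duhamel_integrable:
  assumes Y: "hpath T \<sigma> Y" and t: "t \<le> T"
  shows "set_integrable lborel {0..t} (\<lambda>s. of_real (exp (lam k * s)) * lin Y s k)"
proof -
  obtain C where C: "0 \<le> C" "\<And>s k. cmod (lin Y s k) \<le> C * (jap k)\<^sup>2" using lin_bound[OF Y] by blast
  have "set_integrable lborel {0..t} (\<lambda>s. of_real (exp (lam k * min s T)) * lin Y s k)"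
  proof (rule set_integrable_bounded)
    have "(\<lambda>s. complex_of_real (exp (lam k * min s T))) \<in> borel_measurable borel"
      by (intro borel_measurable_continuous_onI continuous_intros)
    then show "(\<lambda>s. of_real (exp (lam k * min s T)) * lin Y s k) \<in> borel_measurable borel"
      by (rule borel_measurable_times[OF _ lin_measurable[OF Y]])
    show "norm (of_real (exp (lam k * min s T)) * lin Y s k) \<le> exp (lam k * T) * (C * (jap k)\<^sup>2)" for s
      unfolding norm_mult using C lam_nonneg[of k] by (intro mult_mono) (auto intro: mult_left_mono)
  qed
  moreover have "min s T = s" if "s \<in> {0..t}" for s using that t by simp
  ultimately show ?thesis
    by (subst (asm) set_integrable_cong[OF refl refl, of _ _ "\<lambda>s. of_real (exp (lam k * s)) * lin Y s k"]) auto
qed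

text \<open>
  The variable \<open>t\<close> is taken out of the integrand, so that continuity in \<open>t\<close> is that of an indefinite integral.
\<close>

lemma duhamel_factor:
  assumes "t \<in> {0..T}"
  shows "duhamel Y t k = of_real (exp (- (lam k * t))) * time_int t (\<lambda>s. of_real (exp (lam k * s)) * lin Y s k)"
proof -
  have "exp (- (lam k * (t - s))) = exp (- (lam k * t)) * exp (lam k * s)" for s
    by (simp add: algebra_simps flip: exp_add)
  then show ?thesis
    using assms unfolding duhamel_def by (simp add: mult.assoc del: set_integral_mult_right flip: set_integral_mult_right)
qed

lemma duhamel_kernel_integrable:
  assumes Y: "hpath T \<sigma> Y" and t: "t \<le> T"
  shows "set_integrable lborel {0..t} (\<lambda>s. of_real (exp (- (lam k * (t - s)))) * lin Y s k)"
proof -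
  have "of_real (exp (- (lam k * (t - s)))) * lin Y s k
      = of_real (exp (- (lam k * t))) * (of_real (exp (lam k * s)) * lin Y s k)" for s
  proof -
    have "exp (- (lam k * (t - s))) = exp (- (lam k * t)) * exp (lam k * s)"
      by (simp add: algebra_simps flip: exp_add)
    then show ?thesis by simp
  qed
  then show ?thesis by (simp only:) (intro set_integrable_mult_right duhamel_integrable[OF Y t])
qed

lemma duhamel_continuous_coeff:
  assumes Y: "hpath T \<sigma> Y"
  shows "continuous_on {0..T} (\<lambda>t. duhamel Y t k)"
proof -
  let ?g = "\<lambda>s. of_real (exp (lam k * s)) * lin Y s k"
  have hk: "?g integrable_on {0..T}"
    by (rule set_borel_integral_eq_integral(1)[OF duhamel_integrable[OF Y order_refl]])
  have "continuous_on {0..T} (\<lambda>t. of_real (exp (- (lam k * t))) * integral {0..t} ?g)"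
    by (intro continuous_intros indefinite_integral_continuous_1 hk)
  moreover have "duhamel Y t k = of_real (exp (- (lam k * t))) * integral {0..t} ?g" if "t \<in> {0..T}" for t
    unfolding duhamel_factor[OF that]
    using that by (subst set_borel_integral_eq_integral(2)[OF duhamel_integrable[OF Y]]) auto
  ultimately show ?thesis by (simp cong: continuous_on_cong_simp)
qed

text \<open>
  Each frequency is continuous in time, and the frequencies beyond a large finite set contribute
  little, uniformly in time: their contribution is a tail of the convergent sum of the integrals up to
  the final time \<open>T\<close>.
\<close>

lemma duhamel_hpath:
  assumes Y: "hpath T \<sigma> Y"
  shows "hpath T \<sigma> (duhamel Y)"
  unfolding hpath_def
proof (intro conjI ballI allI impI)
  show "duhamel Y t = (\<lambda>k. 0)" if "t \<notin> {0..T}" for t by (rule ext) (simp only: duhamel_def if_not_P[OF that])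
  show "hs \<sigma> (duhamel Y t)" if "t \<in> {0..T}" for t by (rule duhamel_hs[OF Y that])
  fix t assume t: "t \<in> {0..T}"
  define m where "m k = jap k powr \<sigma> * time_int T (\<lambda>s. (cmod (lin Y s k))\<^sup>2 / lam k)" for k
  have T_mem: "T \<in> {0..T}" using T_pos by simp
  have m_sum: "m summable_on UNIV"
  proof (rule nonneg_bdd_above_summable_on)
    show "0 \<le> m k" for k
      unfolding m_def set_lebesgue_integral_def using lam_nonneg
      by (intro mult_nonneg_nonneg integral_nonneg_AE) auto
    show "bdd_above (sum m ` {F. F \<subseteq> UNIV \<and> finite F})"
      by (rule bdd_aboveI2, unfold m_def, rule duhamel_mode_sum[OF Y T_mem]) auto
  qed
  have le_m: "(wt \<sigma> (duhamel Y r) k)\<^sup>2 \<le> m k" if r: "r \<in> {0..T}" for r k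
  proof -
    have "(wt \<sigma> (duhamel Y r) k)\<^sup>2 \<le> jap k powr \<sigma> * time_int r (\<lambda>s. (cmod (lin Y s k))\<^sup>2 / lam k)"
      unfolding wt_square by (intro mult_left_mono duhamel_square[OF Y r]) simp
    also have "time_int r (\<lambda>s. (cmod (lin Y s k))\<^sup>2 / lam k) \<le> time_int T (\<lambda>s. (cmod (lin Y s k))\<^sup>2 / lam k)"
      unfolding set_lebesgue_integral_def
    proof (rule integral_mono)
      show "indicator {0..r} s *\<^sub>R ((cmod (lin Y s k))\<^sup>2 / lam k) \<le> indicator {0..T} s *\<^sub>R ((cmod (lin Y s k))\<^sup>2 / lam k)" for s
        using r lam_nonneg[of k] by (auto simp: indicator_def)
    qed (use lin_square_int[OF Y] in \<open>auto simp: set_integrable_def\<close>)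
    finally show ?thesis by (simp add: m_def mult_left_mono)
  qed
  \<comment> \<open>Set to \<open>0\<close> outside the time interval, so that one summable majorant serves for all \<open>r\<close>.\<close>
  define f where "f k r = (if r \<in> {0..T} then (wt \<sigma> (\<lambda>k. duhamel Y r k - duhamel Y t k) k)\<^sup>2 else 0)" for k r
  have "((\<lambda>r. \<Sum>\<^sub>\<infinity>k. f k r) \<longlongrightarrow> 0) (at t within {0..T})"
  proof (rule infsum_tendsto_0)
    show "(\<lambda>k. 4 * m k) summable_on UNIV" by (rule summable_on_cmult_right[OF m_sum])
    show "\<bar>f k r\<bar> \<le> 4 * m k" for k r
    proof (cases "r \<in> {0..T}")
      case True
      have "wt \<sigma> (\<lambda>k. duhamel Y r k - duhamel Y t k) k \<le> wt \<sigma> (duhamel Y r) k + wt \<sigma> (duhamel Y t) k"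
        unfolding wt_def distrib_left[symmetric] by (intro mult_left_mono norm_triangle_ineq4) simp
      then have "(wt \<sigma> (\<lambda>k. duhamel Y r k - duhamel Y t k) k)\<^sup>2 \<le> (wt \<sigma> (duhamel Y r) k + wt \<sigma> (duhamel Y t) k)\<^sup>2"
        by (rule power_mono) (rule wt_nonneg)
      also have "\<dots> \<le> 2 * (wt \<sigma> (duhamel Y r) k)\<^sup>2 + 2 * (wt \<sigma> (duhamel Y t) k)\<^sup>2"
        using zero_le_power2[of "wt \<sigma> (duhamel Y r) k - wt \<sigma> (duhamel Y t) k"]
        by (simp add: power2_eq_square algebra_simps)
      also have "\<dots> \<le> 4 * m k" using le_m[OF True, of k] le_m[OF t, of k] by simp
      finally show ?thesis using True by (simp add: f_def)
    next
      case False
      have "0 \<le> m k" by (rule order_trans[OF zero_le_power2 le_m[OF t]])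
      then show ?thesis by (simp add: f_def if_not_P[OF False] del: atLeastAtMost_iff)
    qed
    show "((\<lambda>r. f k r) \<longlongrightarrow> 0) (at t within {0..T})" for k
    proof -
      have "((\<lambda>r. duhamel Y r k) \<longlongrightarrow> duhamel Y t k) (at t within {0..T})"
        using duhamel_continuous_coeff[OF Y, of k] t unfolding continuous_on_def by blast
      then have "((\<lambda>r. (jap k powr (\<sigma> / 2) * cmod (duhamel Y r k - duhamel Y t k))\<^sup>2) \<longlongrightarrow>
          (jap k powr (\<sigma> / 2) * cmod (duhamel Y t k - duhamel Y t k))\<^sup>2) (at t within {0..T})"
        by (intro tendsto_intros)
      then have "((\<lambda>r. (jap k powr (\<sigma> / 2) * cmod (duhamel Y r k - duhamel Y t k))\<^sup>2) \<longlongrightarrow> 0) (at t within {0..T})"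
        by simp
      then show ?thesis
        by (rule Lim_transform_eventually) (simp add: f_def wt_def eventually_at_filter)
    qed
  qed
  then have "((\<lambda>r. sqrt (\<Sum>\<^sub>\<infinity>k. f k r)) \<longlongrightarrow> 0) (at t within {0..T})"
    using tendsto_real_sqrt by fastforce
  moreover have "\<forall>\<^sub>F r in at t within {0..T}. sqrt (\<Sum>\<^sub>\<infinity>k. f k r) = hnorm \<sigma> (\<lambda>k. duhamel Y r k - duhamel Y t k)"
    unfolding eventually_at_filter by (rule always_eventually) (simp add: f_def hnorm_wt)
  ultimately show "((\<lambda>r. hnorm \<sigma> (\<lambda>k. duhamel Y r k - duhamel Y t k)) \<longlongrightarrow> 0) (at t within {0..T})"
    by (rule Lim_transform_eventually)
qed

lemma duhamel_lincomb:
  assumes Y: "hpath T \<sigma> Y" and W: "hpath T \<sigma> W"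
  shows "duhamel (\<lambda>t k. a * Y t k + W t k) t k = a * duhamel Y t k + duhamel W t k"
proof (cases "t \<in> {0..T}")
  case True
  then have t: "t \<le> T" by simp
  have "time_int t (\<lambda>s. of_real (exp (- (lam k * (t - s)))) * lin (\<lambda>t k. a * Y t k + W t k) s k)
      = time_int t (\<lambda>s. a * (of_real (exp (- (lam k * (t - s)))) * lin Y s k) + of_real (exp (- (lam k * (t - s)))) * lin W s k)"
  proof -
    have "e * (a * l + m) = a * (e * l) + e * m" for e l m :: complex by (simp add: algebra_simps)
    then show ?thesis by (simp only: lin_lincomb[OF Y W])
  qed
  also have "\<dots> = a * time_int t (\<lambda>s. of_real (exp (- (lam k * (t - s)))) * lin Y s k)
      + time_int t (\<lambda>s. of_real (exp (- (lam k * (t - s)))) * lin W s k)"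
    by (subst set_integral_add(2)[OF set_integrable_mult_right[OF duhamel_kernel_integrable[OF Y t]] duhamel_kernel_integrable[OF W t]])
      (simp only: set_integral_mult_right)
  finally show ?thesis using True by (simp add: duhamel_def)
qed (auto simp: duhamel_def)

lemma duhamel_sym:
  assumes "\<And>t k. Y t (- k) = cnj (Y t k)"
  shows "duhamel Y t (- k) = cnj (duhamel Y t k)"
proof -
  have "lin Y s (- k) = cnj (lin Y s k)" for s
    unfolding lin_def by (simp add: adv_uminus assms X_sym)
  moreover have "lam (- k) = lam k" by (simp add: lam_def freq_sq_uminus)
  ultimately have "time_int t (\<lambda>s. of_real (exp (- (lam (- k) * (t - s)))) * lin Y s (- k))
      = time_int t (\<lambda>s. cnj (of_real (exp (- (lam k * (t - s)))) * lin Y s k))"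
    by (simp only: complex_cnj_mult complex_cnj_complex_of_real)
  also have "\<dots> = cnj (time_int t (\<lambda>s. of_real (exp (- (lam k * (t - s)))) * lin Y s k))"
    unfolding set_lebesgue_integral_def complex_cnj_scaleR[symmetric] by (rule Bochner_Integration.integral_cnj)
  finally show ?thesis by (simp only: duhamel_def complex_cnj_zero if_distrib[of cnj])
qed

end

context transport
begin

definition total_h1_sq :: real where "total_h1_sq = time_int T h1_sq"

definition weight :: "real \<Rightarrow> real" where
  "weight s = (if s \<in> {0..T} then exp (4 * bil_const * time_int s h1_sq) else 0)"

lemma weight_props:
  shows weight_measurable: "weight \<in> borel_measurable borel"
    and weight_abs_le: "\<bar>weight s\<bar> \<le> exp (4 * bil_const * total_h1_sq)"
    and weight_integral: "t \<in> {0..T} \<Longrightarrow> time_int t (\<lambda>s. h1_sq s * weight s) \<le> weight t / (4 * bil_const)"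
    and weight_ge1: "t \<in> {0..T} \<Longrightarrow> 1 \<le> weight t"
proof -
  have rate_pos: "0 < 4 * bil_const" using bil_const_pos by simp
  have T_mem: "T \<in> {0..T}" using T_pos by simp
  have weight_eq: "weight = (\<lambda>s. if s \<in> {0..T} then exp (4 * bil_const * time_int s h1_sq) else 0)"
    by (rule ext) (rule weight_def)
  show "weight \<in> borel_measurable borel"
    unfolding weight_eq by (rule exp_weight_integral(1)[OF h1_sq_int h1_sq_nonneg rate_pos T_mem])
  show "\<bar>weight s\<bar> \<le> exp (4 * bil_const * total_h1_sq)"
    unfolding weight_eq total_h1_sq_def by (rule exp_weight_integral(2)[OF h1_sq_int h1_sq_nonneg rate_pos T_mem])
  show "time_int t (\<lambda>s. h1_sq s * weight s) \<le> weight t / (4 * bil_const)" if "t \<in> {0..T}"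
    unfolding weight_eq by (rule exp_weight_integral(3)[OF h1_sq_int h1_sq_nonneg rate_pos that])
  show "1 \<le> weight t" if "t \<in> {0..T}"
  proof -
    have "0 \<le> time_int t h1_sq"
      unfolding set_lebesgue_integral_def by (intro integral_nonneg_AE) (auto simp: h1_sq_nonneg)
    then show ?thesis using that bil_const_pos by (simp add: weight_def)
  qed
qed

text \<open>
  The weight has been chosen with the rate \<open>4 * bil_const\<close> so that its integral against \<open>h1_sq\<close> is at most the
  fraction \<open>1 / (4 * bil_const)\<close> of its final value.
\<close>

lemma duhamel_weighted:
  assumes Y: "hpath T \<sigma> Y" and U: "\<And>s. s \<in> {0..T} \<Longrightarrow> (hnorm \<sigma> (Y s))\<^sup>2 \<le> U * weight s"
    and t: "t \<in> {0..T}"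
  shows "(hnorm \<sigma> (duhamel Y t))\<^sup>2 \<le> U / 4 * weight t"
proof -
  have "0 \<le> U * weight t" by (rule order_trans[OF zero_le_power2 U[OF t]])
  then have U0: "0 \<le> U" using weight_ge1[OF t] by (simp add: zero_le_mult_iff)
  have wint: "set_integrable lborel {0..t} (\<lambda>s. h1_sq s * weight s)"
    by (rule set_integrable_Icc_subset[OF set_integrable_mult_bounded[OF h1_sq_int weight_measurable weight_abs_le]])
      (use t in simp)
  have "(hnorm \<sigma> (duhamel Y t))\<^sup>2 \<le> bil_const * time_int t (\<lambda>s. h1_sq s * (hnorm \<sigma> (Y s))\<^sup>2)"
    by (rule duhamel_hs(2)[OF Y t])
  also have "\<dots> \<le> bil_const * time_int t (\<lambda>s. U * (h1_sq s * weight s))"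
  proof (intro mult_left_mono set_integral_mono)
    show "set_integrable lborel {0..t} (\<lambda>s. h1_sq s * (hnorm \<sigma> (Y s))\<^sup>2)"
      using t by (intro energy_density_int[OF Y]) simp
    show "set_integrable lborel {0..t} (\<lambda>s. U * (h1_sq s * weight s))"
      by (intro set_integrable_mult_right wint)
    show "h1_sq s * (hnorm \<sigma> (Y s))\<^sup>2 \<le> U * (h1_sq s * weight s)" if "s \<in> {0..t}" for s
      using mult_left_mono[OF U h1_sq_nonneg, of s s] that t by (simp add: mult_ac)
  qed (use bil_const_pos in simp)
  also have "\<dots> = bil_const * (U * time_int t (\<lambda>s. h1_sq s * weight s))" by simp
  also have "\<dots> \<le> bil_const * (U * (weight t / (4 * bil_const)))"
    using bil_const_pos by (intro mult_left_mono weight_integral[OF t] U0) auto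
  also have "\<dots> = U / 4 * weight t" using bil_const_pos by simp
  finally show ?thesis .
qed

definition solves :: "(real \<Rightarrow> freq \<Rightarrow> complex) \<Rightarrow> (real \<Rightarrow> freq \<Rightarrow> complex) \<Rightarrow> bool" where
  "solves Z Y \<longleftrightarrow> (\<forall>t\<in>{0..T}. \<forall>k. Y t k = Z t k - duhamel Y t k)"

lemma weight_sqrt: "t \<in> {0..T} \<Longrightarrow> weight t \<le> (exp (2 * bil_const * total_h1_sq))\<^sup>2"
  using abs_le_D1[OF weight_abs_le[of t]] exp_double[of "2 * bil_const * total_h1_sq"] by (simp add: mult_ac)

text \<open>
  Gronwall's inequality, by iteration: a bound of the weighted square norm by \<open>4 * b\<^sup>2 + U\<close> improves to one
  by \<open>4 * b\<^sup>2 + U / 2\<close>, and some bound holds to begin with.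
\<close>

lemma apriori_bound:
  assumes Y: "hpath T \<sigma> Y" and Z: "\<And>t. t \<in> {0..T} \<Longrightarrow> hs \<sigma> (Z t)" and eq: "solves Z Y"
    and b: "\<And>t. t \<in> {0..T} \<Longrightarrow> hnorm \<sigma> (Z t) \<le> b" and t: "t \<in> {0..T}"
  shows "hnorm \<sigma> (Y t) \<le> 2 * b * exp (2 * bil_const * total_h1_sq)"
proof -
  obtain R where R: "0 \<le> R" "\<And>t. hnorm \<sigma> (Y t) \<le> R" using hpath_bounded[OF Y] by blast
  \<comment> \<open>From \<open>Y = Z - duhamel Y\<close> and the factor \<open>1 / 4\<close>: a bound \<open>U\<close> becomes \<open>2 * b\<^sup>2 + 2 * (U / 4)\<close>, with fixed point \<open>4 * b\<^sup>2\<close>.\<close>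
  have iter: "(hnorm \<sigma> (Y s))\<^sup>2 \<le> (4 * b\<^sup>2 + R\<^sup>2 * (1 / 2) ^ n) * weight s" if "s \<in> {0..T}" for n s
    using that
  proof (induction n arbitrary: s)
    case 0
    have "(hnorm \<sigma> (Y s))\<^sup>2 \<le> R\<^sup>2" by (intro power_mono R hnorm_nonneg)
    also have "\<dots> \<le> (4 * b\<^sup>2 + R\<^sup>2) * 1" by simp
    also have "\<dots> \<le> (4 * b\<^sup>2 + R\<^sup>2) * weight s" by (intro mult_left_mono weight_ge1[OF 0]) simp
    finally show ?case by simp
  next
    case (Suc n)
    define U where "U = 4 * b\<^sup>2 + R\<^sup>2 * (1 / 2) ^ n"
    have d: "(hnorm \<sigma> (duhamel Y s))\<^sup>2 \<le> U / 4 * weight s"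
      using Suc by (intro duhamel_weighted[OF Y]) (auto simp: U_def)
    have "Y s = (\<lambda>k. Z s k - duhamel Y s k)"
      using eq Suc.prems unfolding solves_def by (intro ext) blast
    then have "hnorm \<sigma> (Y s) \<le> hnorm \<sigma> (Z s) + hnorm \<sigma> (duhamel Y s)"
      using hnorm_diff[OF Z[OF Suc.prems] duhamel_hs(1)[OF Y Suc.prems]] by simp
    then have "(hnorm \<sigma> (Y s))\<^sup>2 \<le> (hnorm \<sigma> (Z s) + hnorm \<sigma> (duhamel Y s))\<^sup>2"
      by (intro power_mono hnorm_nonneg)
    also have "\<dots> \<le> 2 * (hnorm \<sigma> (Z s))\<^sup>2 + 2 * (hnorm \<sigma> (duhamel Y s))\<^sup>2"
      using zero_le_power2[of "hnorm \<sigma> (Z s) - hnorm \<sigma> (duhamel Y s)"] by (simp add: power2_eq_square algebra_simps)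
    also have "\<dots> \<le> 2 * (b\<^sup>2 * weight s) + 2 * (U / 4 * weight s)"
    proof (intro add_mono mult_left_mono d)
      have "(hnorm \<sigma> (Z s))\<^sup>2 \<le> b\<^sup>2 * 1" using b[OF Suc.prems] by (simp add: power_mono hnorm_nonneg)
      also have "\<dots> \<le> b\<^sup>2 * weight s" by (intro mult_left_mono weight_ge1[OF Suc.prems]) simp
      finally show "(hnorm \<sigma> (Z s))\<^sup>2 \<le> b\<^sup>2 * weight s" .
    qed auto
    also have "\<dots> = (4 * b\<^sup>2 + R\<^sup>2 * (1 / 2) ^ Suc n) * weight s" by (simp add: U_def algebra_simps)
    finally show ?case .
  qed
  have "(\<lambda>n. (4 * b\<^sup>2 + R\<^sup>2 * (1 / 2) ^ n) * weight t) \<longlonglongrightarrow> (4 * b\<^sup>2 + R\<^sup>2 * 0) * weight t"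
    by (intro tendsto_intros LIMSEQ_power_zero) simp
  then have "(hnorm \<sigma> (Y t))\<^sup>2 \<le> (4 * b\<^sup>2 + R\<^sup>2 * 0) * weight t"
    by (rule tendsto_lowerbound) (auto intro!: always_eventually iter[OF t])
  also have "\<dots> \<le> (4 * b\<^sup>2 + R\<^sup>2 * 0) * (exp (2 * bil_const * total_h1_sq))\<^sup>2"
    by (intro mult_left_mono weight_sqrt[OF t]) simp
  finally have "(hnorm \<sigma> (Y t))\<^sup>2 \<le> (2 * b * exp (2 * bil_const * total_h1_sq))\<^sup>2"
    by (simp add: power_mult_distrib)
  moreover have "0 \<le> b" by (rule order_trans[OF hnorm_nonneg b[OF t]])
  ultimately show ?thesis by - (rule power2_le_imp_le, auto)
qed

text \<open>
  The difference of two solutions solves the equation with datum \<open>0\<close>.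
\<close>

lemma solves_unique:
  assumes "hpath T \<sigma> Y" "hpath T \<sigma> W" "solves Z Y" "solves Z W"
  shows "Y = W"
proof -
  let ?V = "\<lambda>t k. (- 1) * W t k + Y t k"
  have V: "hpath T \<sigma> ?V" by (rule hpath_lincomb) fact+
  have "solves (\<lambda>t k. 0) ?V"
    using assms(3,4) unfolding solves_def duhamel_lincomb[OF assms(2,1)] by simp
  then have "hnorm \<sigma> (?V t) \<le> 0" if "t \<in> {0..T}" for t
    using apriori_bound[OF V _ _ _ that, of "\<lambda>t k. 0" 0] by (simp add: hs_zero hnorm_zero)
  then have "hnorm \<sigma> (?V t) = 0" if "t \<in> {0..T}" for t
    using that hnorm_nonneg[of \<sigma> "?V t"] by (intro antisym) auto
  then have "cmod (?V t k) \<le> 0" if "t \<in> {0..T}" for t k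
    using cmod_le_hnorm[OF hpath_hs[OF V], of t k] that by (simp only: mult_zero_right)
  then have "Y t k = W t k" for t k
    using hpath_outside[OF assms(1), of t] hpath_outside[OF assms(2), of t]
    by (cases "t \<in> {0..T}") auto
  then show ?thesis by (intro ext)
qed

lemma L2_wt_limit:
  assumes "\<And>k. (\<lambda>n. c n k) \<longlonglongrightarrow> d k" "\<And>n. L2_set (wt s (c n)) F \<le> r"
  shows "L2_set (wt s d) F \<le> r"
proof (rule tendsto_upperbound)
  show "(\<lambda>n. L2_set (wt s (c n)) F) \<longlonglongrightarrow> L2_set (wt s d) F"
    unfolding L2_set_def wt_def by (intro tendsto_intros assms(1))
qed (simp_all add: assms(2))

text \<open>
  The Neumann series. In the weighted norm each application of the Duhamel operator halves the norm,
  so the partial sums converge uniformly in time, and so do their images.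
\<close>

lemma solves_exists:
  assumes Z: "hpath T \<sigma> Z" and Z_sym: "\<And>t k. Z t (- k) = cnj (Z t k)"
  shows "\<exists>Y. hpath T \<sigma> Y \<and> solves Z Y \<and> (\<forall>t k. Y t (- k) = cnj (Y t k))"
proof -
  \<comment> \<open>The terms of the series; the summand \<open>0\<close> gives them the form of a linear combination of paths.\<close>
  define e where "e = rec_nat Z (\<lambda>_ Y t k. (- 1) * duhamel Y t k + 0)"
  have e0: "e 0 = Z" and eS: "e (Suc n) = (\<lambda>t k. (- 1) * duhamel (e n) t k + 0)" for n by (simp_all add: e_def)
  have e_path: "hpath T \<sigma> (e n)" for n
  proof (induction n)
    case (Suc n)
    show ?case unfolding eS by (rule hpath_lincomb[OF duhamel_hpath[OF Suc] hpath_zero])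
  qed (simp add: e0 Z)
  have e_sym: "e n t (- k) = cnj (e n t k)" for n t k
  proof (induction n arbitrary: t k)
    case (Suc n)
    then show ?case using duhamel_sym[of "e n"] by (simp add: eS)
  qed (simp add: e0 Z_sym)
  obtain R where R: "0 \<le> R" "\<And>t. hnorm \<sigma> (Z t) \<le> R" using hpath_bounded[OF Z] by blast
  define V where "V = exp (2 * bil_const * total_h1_sq)"
  have V: "0 < V" by (simp add: V_def)
  have e_weighted: "(hnorm \<sigma> (e n t))\<^sup>2 \<le> R\<^sup>2 * (1 / 4) ^ n * weight t" if "t \<in> {0..T}" for n t
    using that
  proof (induction n arbitrary: t)
    case 0
    have "(hnorm \<sigma> (Z t))\<^sup>2 \<le> R\<^sup>2 * 1" using R by (simp add: power_mono hnorm_nonneg)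
    also have "\<dots> \<le> R\<^sup>2 * weight t" by (intro mult_left_mono weight_ge1[OF 0]) simp
    finally show ?case by (simp add: e0)
  next
    case (Suc n)
    have "(hnorm \<sigma> (duhamel (e n) t))\<^sup>2 \<le> R\<^sup>2 * (1 / 4) ^ n / 4 * weight t"
      by (rule duhamel_weighted[OF e_path Suc.IH Suc.prems])
    then show ?case by (simp add: eS hnorm_uminus)
  qed
  have e_le: "hnorm \<sigma> (e n t) \<le> R * V * (1 / 2) ^ n" for n t
  proof (cases "t \<in> {0..T}")
    case True
    have "(hnorm \<sigma> (e n t))\<^sup>2 \<le> R\<^sup>2 * (1 / 4) ^ n * V\<^sup>2"
      by (rule order_trans[OF e_weighted[OF True]]) (use weight_sqrt[OF True] in \<open>auto simp: V_def intro: mult_left_mono\<close>)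
    also have "\<dots> = (R * V * (1 / 2) ^ n)\<^sup>2"
    proof -
      have "(1 / 4 :: real) ^ n = ((1 / 2) ^ n)\<^sup>2"
        by (simp add: power2_eq_square flip: power_mult_distrib)
      then show ?thesis by (simp only: power_mult_distrib) simp
    qed
    finally show ?thesis using R V by - (rule power2_le_imp_le, auto)
  next
    case False
    then show ?thesis using hpath_outside[OF e_path] R V by (simp add: hnorm_zero)
  qed
  define S where "S N t k = (\<Sum>n<N. e n t k)" for N t k
  define Y where "Y t k = (\<Sum>n. e n t k)" for t k
  have S_Suc: "S (Suc N) = (\<lambda>t k. 1 * S N t k + e N t k)" for N by (simp add: S_def fun_eq_iff)
  have S0: "S 0 = (\<lambda>t k. 0)" by (simp add: S_def fun_eq_iff)
  have S_path: "hpath T \<sigma> (S N)" for N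
  proof (induction N)
    case (Suc N)
    show ?case unfolding S_Suc by (rule hpath_lincomb[OF Suc e_path])
  qed (simp only: S0 hpath_zero)
  have e_sums: "(\<lambda>n. e n t k) sums Y t k" for t k
  proof -
    have "summable (\<lambda>n. e n t k)"
    proof (rule summable_comparison_test')
      show "summable (\<lambda>n. jap k powr (- \<sigma> / 2) * (R * V * (1 / 2) ^ n))"
        by (intro summable_mult summable_geometric) simp
      show "norm (e n t k) \<le> jap k powr (- \<sigma> / 2) * (R * V * (1 / 2) ^ n)" if "0 \<le> n" for n
        by (rule order_trans[OF cmod_le_hnorm[OF hpath_hs[OF e_path]] mult_left_mono[OF e_le]]) simp
    qed
    then show ?thesis unfolding Y_def by (rule summable_sums)
  qed
  have S_lim: "(\<lambda>N. S N t k) \<longlonglongrightarrow> Y t k" for t k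
    using e_sums unfolding sums_def S_def .
  have S_diff: "L2_set (wt \<sigma> (\<lambda>k. S (N + m) t k - S N t k)) F \<le> 2 * R * V * (1 / 2) ^ N * (1 - (1 / 2) ^ m)"
    if "finite F" for N m t F
  proof (induction m)
    case (Suc m)
    have "(\<lambda>k. S (N + Suc m) t k - S N t k) = (\<lambda>k. (S (N + m) t k - S N t k) + e (N + m) t k)"
      by (simp add: S_def fun_eq_iff)
    then have "L2_set (wt \<sigma> (\<lambda>k. S (N + Suc m) t k - S N t k)) F
        \<le> L2_set (wt \<sigma> (\<lambda>k. S (N + m) t k - S N t k)) F + L2_set (wt \<sigma> (e (N + m) t)) F"
      using L2_wt_add[of \<sigma> "\<lambda>k. S (N + m) t k - S N t k" "e (N + m) t" F] by simp
    also have "\<dots> \<le> 2 * R * V * (1 / 2) ^ N * (1 - (1 / 2) ^ m) + R * V * (1 / 2) ^ (N + m)"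
      by (intro add_mono Suc order_trans[OF hs_L2_set_le[OF hpath_hs[OF e_path] that] e_le])
    also have "\<dots> = 2 * R * V * (1 / 2) ^ N * (1 - (1 / 2) ^ Suc m)"
      by (simp add: power_add algebra_simps)
    finally show ?case .
  qed (simp add: wt_def L2_set_def)
  have rem: "hs \<sigma> (\<lambda>k. Y t k - S N t k)" "hnorm \<sigma> (\<lambda>k. Y t k - S N t k) \<le> 2 * R * V * (1 / 2) ^ N" for t N
  proof -
    have le: "L2_set (wt \<sigma> (\<lambda>k. Y t k - S N t k)) F \<le> 2 * R * V * (1 / 2) ^ N" if F: "finite F" for F
    proof (rule L2_wt_limit)
      show "(\<lambda>m. S (N + m) t k - S N t k) \<longlonglongrightarrow> Y t k - S N t k" for k
      proof (intro tendsto_diff tendsto_const)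
        have "(\<lambda>m. S (m + N) t k) \<longlonglongrightarrow> Y t k" by (rule LIMSEQ_ignore_initial_segment[OF S_lim])
        then show "(\<lambda>m. S (N + m) t k) \<longlonglongrightarrow> Y t k" by (simp only: add.commute)
      qed
      show "L2_set (wt \<sigma> (\<lambda>k. S (N + m) t k - S N t k)) F \<le> 2 * R * V * (1 / 2) ^ N" for m
      proof -
        have "2 * R * V * (1 / 2) ^ N * (1 - (1 / 2) ^ m) \<le> 2 * R * V * (1 / 2) ^ N * 1"
          using R V by (intro mult_left_mono) auto
        with S_diff[OF F, of N m t] show ?thesis by simp
      qed
    qed
    have nn: "0 \<le> 2 * R * V * (1 / 2) ^ N" using R V by simp
    show "hs \<sigma> (\<lambda>k. Y t k - S N t k)" "hnorm \<sigma> (\<lambda>k. Y t k - S N t k) \<le> 2 * R * V * (1 / 2) ^ N"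
      by (rule hs_L2_setI[OF nn le], assumption)+
  qed
  have geo: "(\<lambda>N. c * (1 / 2) ^ N) \<longlonglongrightarrow> (0 :: real)" for c
    using tendsto_mult_right_zero[OF LIMSEQ_power_zero[of "1 / 2 :: real"], of c] by simp
  have Y_path: "hpath T \<sigma> Y"
    unfolding hpath_def
  proof (intro conjI ballI allI impI)
    show "Y t = (\<lambda>k. 0)" if "t \<notin> {0..T}" for t
      using that hpath_outside[OF e_path] by (simp add: Y_def fun_eq_iff)
    show Yhs: "hs \<sigma> (Y t)" for t
      using hs_add[OF rem(1)[of t 0] hpath_hs[OF S_path, of 0 t]] by simp
    fix t assume t: "t \<in> {0..T}"
    show "((\<lambda>r. hnorm \<sigma> (\<lambda>k. Y r k - Y t k)) \<longlongrightarrow> 0) (at t within {0..T})"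
    proof (rule tendstoI)
      fix \<epsilon> :: real assume \<epsilon>: "0 < \<epsilon>"
      have "\<forall>\<^sub>F N in sequentially. 2 * R * V * (1 / 2) ^ N < \<epsilon> / 4"
        by (rule order_tendstoD(2)[OF geo]) (use \<epsilon> in simp)
      then obtain N where N: "2 * R * V * (1 / 2) ^ N < \<epsilon> / 4"
        unfolding eventually_sequentially by blast
      have "\<forall>\<^sub>F r in at t within {0..T}. dist (hnorm \<sigma> (\<lambda>k. S N r k - S N t k)) 0 < \<epsilon> / 2"
        using hpath_tendsto[OF S_path t] by (rule tendstoD) (use \<epsilon> in simp)
      then show "\<forall>\<^sub>F r in at t within {0..T}. dist (hnorm \<sigma> (\<lambda>k. Y r k - Y t k)) 0 < \<epsilon>"
      proof eventually_elim
        case (elim r)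
        let ?a = "\<lambda>k. Y r k - S N r k" and ?b = "\<lambda>k. S N r k - S N t k" and ?c = "\<lambda>k. Y t k - S N t k"
        have b: "hs \<sigma> ?b" by (intro hs_diff hpath_hs[OF S_path])
        have split: "(\<lambda>k. Y r k - Y t k) = (\<lambda>k. (?a k + ?b k) - ?c k)" by (simp add: fun_eq_iff)
        have "hnorm \<sigma> (\<lambda>k. Y r k - Y t k) \<le> hnorm \<sigma> (\<lambda>k. ?a k + ?b k) + hnorm \<sigma> ?c"
          unfolding split by (rule hnorm_diff[OF hs_add[OF rem(1) b] rem(1)])
        also have "\<dots> \<le> (hnorm \<sigma> ?a + hnorm \<sigma> ?b) + hnorm \<sigma> ?c"
          by (intro add_right_mono hnorm_add rem(1) b)
        finally have "hnorm \<sigma> (\<lambda>k. Y r k - Y t k) < \<epsilon>"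
          using elim rem(2)[of r N] rem(2)[of t N] N by (simp add: dist_real_def hnorm_nonneg)
        then show ?case by (simp add: dist_real_def hnorm_nonneg)
      qed
    qed
  qed
  have S_eq: "S (Suc N) t k = Z t k - duhamel (S N) t k" for N t k
  proof (induction N)
    case 0
    have "duhamel (\<lambda>t k. 0) t k = 0"
      using duhamel_lincomb[OF hpath_zero hpath_zero, of 1 t k] by simp
    then show ?case by (simp only: S0) (simp add: S_def e0)
  next
    case (Suc N)
    have "S (Suc (Suc N)) t k = S (Suc N) t k + e (Suc N) t k" by (simp add: S_def)
    also have "\<dots> = Z t k - (1 * duhamel (S N) t k + duhamel (e N) t k)" unfolding Suc by (simp add: eS)
    also have "\<dots> = Z t k - duhamel (S (Suc N)) t k"
      unfolding S_Suc duhamel_lincomb[OF S_path e_path] ..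
    finally show ?case .
  qed
  have "solves Z Y"
    unfolding solves_def
  proof (intro ballI allI)
    fix t k assume t: "t \<in> {0..T}"
    let ?r = "\<lambda>N t k. (- 1) * S N t k + Y t k"
    have r_path: "hpath T \<sigma> (?r N)" for N by (rule hpath_lincomb[OF S_path Y_path])
    have r_eq: "?r N s = (\<lambda>k. Y s k - S N s k)" for N s by (simp add: fun_eq_iff)
    have "hnorm \<sigma> (duhamel (?r N) t) \<le> 2 * R * V * V * (1 / 2) ^ N" for N
    proof -
      let ?q = "2 * R * V * (1 / 2) ^ N"
      have "(hnorm \<sigma> (?r N s))\<^sup>2 \<le> ?q\<^sup>2 * weight s" if "s \<in> {0..T}" for s
      proof -
        have "(hnorm \<sigma> (?r N s))\<^sup>2 \<le> ?q\<^sup>2 * 1"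
          unfolding r_eq using rem(2) by (simp only: mult_1_right) (intro power_mono hnorm_nonneg)
        also have "\<dots> \<le> ?q\<^sup>2 * weight s" by (intro mult_left_mono weight_ge1[OF that]) simp
        finally show ?thesis .
      qed
      then have "(hnorm \<sigma> (duhamel (?r N) t))\<^sup>2 \<le> ?q\<^sup>2 / 4 * weight t"
        by (rule duhamel_weighted[OF r_path _ t])
      also have "\<dots> \<le> ?q\<^sup>2 * V\<^sup>2"
        using weight_sqrt[OF t] weight_ge1[OF t] by (intro mult_mono) (auto simp: V_def)
      also have "\<dots> = (?q * V)\<^sup>2" by (simp add: power_mult_distrib)
      finally have "hnorm \<sigma> (duhamel (?r N) t) \<le> ?q * V" using R V by - (rule power2_le_imp_le, auto)
      then show ?thesis by (simp add: mult_ac)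
    qed
    then have "cmod (duhamel (?r N) t k) \<le> (jap k powr (- \<sigma> / 2) * (2 * R * V * V)) * (1 / 2) ^ N" for N
      using order_trans[OF cmod_le_hnorm[OF duhamel_hs(1)[OF r_path t]] mult_left_mono] by (simp add: mult.assoc)
    then have "(\<lambda>N. duhamel (?r N) t k) \<longlonglongrightarrow> 0"
      by (intro Lim_null_comparison[OF _ geo[of "jap k powr (- \<sigma> / 2) * (2 * R * V * V)"]] always_eventually allI)
    then have "(\<lambda>N. duhamel Y t k - duhamel (?r N) t k) \<longlonglongrightarrow> duhamel Y t k - 0" by (intro tendsto_intros)
    moreover have "duhamel (?r N) t k = - duhamel (S N) t k + duhamel Y t k" for N
      by (simp only: duhamel_lincomb[OF S_path Y_path]) simp
    ultimately have "(\<lambda>N. duhamel (S N) t k) \<longlonglongrightarrow> duhamel Y t k" by simp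
    then have "(\<lambda>N. S (Suc N) t k) \<longlonglongrightarrow> Z t k - duhamel Y t k"
      unfolding S_eq by (intro tendsto_intros)
    moreover have "(\<lambda>N. S (Suc N) t k) \<longlonglongrightarrow> Y t k" using S_lim by (rule LIMSEQ_Suc)
    ultimately show "Y t k = Z t k - duhamel Y t k" by (rule LIMSEQ_unique[rotated])
  qed
  moreover have "Y t (- k) = cnj (Y t k)" for t k
    using sums_unique2[OF e_sums[of t "- k"]] e_sums[of t k, THEN sums_cnj[THEN iffD2]] by (simp add: e_sym)
  ultimately show ?thesis using Y_path by blast
qed

end

section \<open>Mild solutions as distributions\<close>

text \<open>
  Dominated convergence along an exhausting sequence of finite sets of frequencies.
\<close>

lemma set_integral_infsum_freq:
  fixes f :: "freq \<Rightarrow> real \<Rightarrow> real"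
  assumes f: "\<And>k. set_integrable lborel {0..t} (f k)" and m: "m summable_on UNIV"
    and le: "\<And>k s. s \<in> {0..t} \<Longrightarrow> \<bar>f k s\<bar> \<le> m k"
    and J: "((\<lambda>k. set_lebesgue_integral lborel {0..t} (f k)) has_sum J) UNIV"
  shows "set_integrable lborel {0..t} (\<lambda>s. \<Sum>\<^sub>\<infinity>k. f k s)"
    "set_lebesgue_integral lborel {0..t} (\<lambda>s. \<Sum>\<^sub>\<infinity>k. f k s) = J"
proof -
  obtain F :: "nat \<Rightarrow> freq set" where F: "filterlim F (finite_subsets_at_top UNIV) sequentially" "\<And>n. finite (F n)"
    using freq_exhaustion by blast
  define g where "g s = (\<Sum>\<^sub>\<infinity>k. f k s)" for s
  have abs: "(\<lambda>k. norm (f k s)) summable_on UNIV" if "s \<in> {0..t}" for s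
    by (rule summable_on_comparison_test[OF m]) (simp_all add: le[OF that])
  have lim: "(\<lambda>n. \<Sum>k\<in>F n. f k s) \<longlonglongrightarrow> g s" if "s \<in> {0..t}" for s
    unfolding g_def
    by (rule has_sum_exhaustion[OF F(1)]) (rule has_sum_infsum[OF abs_summable_summable[OF abs[OF that]]])
  have m0: "0 \<le> m k" if "s \<in> {0..t}" for s k using le[OF that, of k] by linarith
  have part: "\<bar>\<Sum>k\<in>F n. f k s\<bar> \<le> infsum m UNIV" if s: "s \<in> {0..t}" for n s
  proof -
    have "\<bar>\<Sum>k\<in>F n. f k s\<bar> \<le> (\<Sum>k\<in>F n. m k)"
      by (rule order_trans[OF sum_abs sum_mono[OF le[OF s]]])
    also have "\<dots> \<le> infsum m UNIV" by (rule finite_sum_le_infsum[OF m F(2)]) (use m0[OF s] in auto)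
    finally show ?thesis .
  qed
  have Fint: "set_integrable lborel {0..t} (\<lambda>s. \<Sum>k\<in>F n. f k s)" for n
    using f unfolding set_integrable_def scaleR_sum_right by (intro Bochner_Integration.integrable_sum)
  have const: "set_integrable lborel {0..t} (\<lambda>s. infsum m UNIV)"
    by (rule set_integrable_bounded[where B = "\<bar>infsum m UNIV\<bar>"]) auto
  have g_int: "set_integrable lborel {0..t} g"
    unfolding set_integrable_def
  proof (rule Bochner_Integration.integrable_bound[OF const[unfolded set_integrable_def]])
    show "(\<lambda>s. indicator {0..t} s *\<^sub>R g s) \<in> borel_measurable lborel"
    proof (rule borel_measurable_LIMSEQ_real)
      show "(\<lambda>s. indicator {0..t} s *\<^sub>R (\<Sum>k\<in>F n. f k s)) \<in> borel_measurable lborel" for n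
        using Fint[of n] unfolding set_integrable_def by auto
      show "(\<lambda>n. indicator {0..t} s *\<^sub>R (\<Sum>k\<in>F n. f k s)) \<longlonglongrightarrow> indicator {0..t} s *\<^sub>R g s" for s
        using lim[of s] by (cases "s \<in> {0..t}") (auto simp: indicator_def)
    qed
    have "\<bar>g s\<bar> \<le> infsum m UNIV" if "s \<in> {0..t}" for s
      by (rule tendsto_upperbound[OF tendsto_rabs[OF lim[OF that]]]) (simp_all add: part[OF that])
    then show "AE s in lborel. norm (indicator {0..t} s *\<^sub>R g s) \<le> norm (indicator {0..t} s *\<^sub>R infsum m UNIV)"
      by (intro AE_I2) (force simp: indicator_def)
  qed
  have "(\<lambda>n. set_lebesgue_integral lborel {0..t} (\<lambda>s. \<Sum>k\<in>F n. f k s)) \<longlonglongrightarrow> set_lebesgue_integral lborel {0..t} g"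
    by (rule dominated_set_lebesgue_integral[OF Fint const g_int]; intro AE_I2 impI allI lim part)
  moreover have "set_lebesgue_integral lborel {0..t} (\<lambda>s. \<Sum>k\<in>F n. f k s)
      = (\<Sum>k\<in>F n. set_lebesgue_integral lborel {0..t} (f k))" for n
    using f unfolding set_lebesgue_integral_def set_integrable_def scaleR_sum_right
    by (intro Bochner_Integration.integral_sum)
  ultimately have "(\<lambda>n. \<Sum>k\<in>F n. set_lebesgue_integral lborel {0..t} (f k)) \<longlonglongrightarrow> set_lebesgue_integral lborel {0..t} g"
    by simp
  with has_sum_exhaustion[OF F(1) J] have "set_lebesgue_integral lborel {0..t} g = J"
    by (rule LIMSEQ_unique[rotated])
  with g_int show "set_integrable lborel {0..t} (\<lambda>s. \<Sum>\<^sub>\<infinity>k. f k s)"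
    "set_lebesgue_integral lborel {0..t} (\<lambda>s. \<Sum>\<^sub>\<infinity>k. f k s) = J"
    by (simp_all add: g_def[abs_def])
qed

lemma set_integral_Re_mult:
  fixes f :: "real \<Rightarrow> complex"
  assumes "set_integrable lborel A f"
  shows "set_integrable lborel A (\<lambda>s. Re (f s * c))"
    "set_lebesgue_integral lborel A (\<lambda>s. Re (f s * c)) = Re (set_lebesgue_integral lborel A f * c)"
proof -
  have bl: "bounded_linear (\<lambda>z. Re (z * c))"
    by (rule bounded_linear_compose[OF bounded_linear_Re bounded_linear_mult_left])
  have scale: "indicator A s *\<^sub>R Re (f s * c) = Re ((indicator A s *\<^sub>R f s) * c)" for s by simp
  show "set_integrable lborel A (\<lambda>s. Re (f s * c))"
    "set_lebesgue_integral lborel A (\<lambda>s. Re (f s * c)) = Re (set_lebesgue_integral lborel A f * c)"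
    using assms unfolding set_integrable_def set_lebesgue_integral_def scale
    by (rule integrable_bounded_linear[OF bl] integral_bounded_linear[OF bl])+
qed

lemma tempered_hs:
  assumes "hs s c" "\<And>k. c (- k) = cnj (c k)" "- 2 \<le> s"
  shows "tempered c"
  unfolding tempered_def
proof (intro conjI allI assms(2) exI)
  fix k
  have "cmod (c k) \<le> jap k powr (- s / 2) * hnorm s c" by (rule cmod_le_hnorm[OF assms(1)])
  also have "\<dots> \<le> jap k powr 1 * hnorm s c"
    using assms(3) jap_ge1 by (intro mult_right_mono powr_mono hnorm_nonneg) auto
  finally show "cmod (c k) \<le> hnorm s c * jap k ^ 1" using jap_pos[of k] by (simp add: mult.commute)
qed

context transport
begin

lemma mild_integrand_coeff:
  assumes Y: "hpath T \<sigma> (\<lambda>t. fourier (y t))" and \<xi>: "X = (\<lambda>t. fourier (\<xi> t))" and s: "s \<in> {0..t}"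
  shows "fourier (heat (t - s) (advect (biot_savart (y s)) (\<xi> s) + advect (biot_savart (\<xi> s)) (y s))) k
    = of_real (exp (- (lam k * (t - s)))) * lin (\<lambda>t. fourier (y t)) s k"
proof -
  have \<xi>s: "fourier (\<xi> s) = X s" by (simp add: \<xi>)
  show ?thesis
    using s \<sigma> hpath_hs[OF Y, of s] hpath_hs[OF X, of s]
    by (simp add: fourier_heat fourier_add fourier_advect_neg_L2[of \<sigma>] fourier_advect_L2_neg[of \<sigma>] lin_def lam_def \<xi>s)
qed

text \<open>
  The integral in the sense of distributions is taken frequency by frequency; conversely the integrals
  at the single frequencies add up, because the coefficients of a test function decay faster than the
  integrand grows.
\<close>

lemma has_distr_integral_duhamel:
  assumes Y: "hpath T \<sigma> (\<lambda>t. fourier (y t))" and \<xi>: "X = (\<lambda>t. fourier (\<xi> t))" and t: "t \<in> {0..T}"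
  defines "g \<equiv> \<lambda>s. heat (t - s) (advect (biot_savart (y s)) (\<xi> s) + advect (biot_savart (\<xi> s)) (y s))"
  shows "has_distr_integral g I {0..t} \<longleftrightarrow> fourier I = duhamel (\<lambda>t. fourier (y t)) t"
proof -
  let ?Y = "\<lambda>t. fourier (y t)"
  let ?f = "\<lambda>k s. of_real (exp (- (lam k * (t - s)))) * lin ?Y s k"
  have t': "t \<le> T" using t by simp
  note f_int = duhamel_kernel_integrable[OF Y t']
  have duhamel: "duhamel ?Y t k = time_int t (?f k)" for k using t by (simp add: duhamel_def del: atLeastAtMost_iff)
  have g: "fourier (g s) k = ?f k s" if "s \<in> {0..t}" for s k
    unfolding g_def by (rule mild_integrand_coeff[OF Y \<xi> that])
  show ?thesis
  proof
    assume int: "has_distr_integral g I {0..t}"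
    have "pairing I (cos_test k) = Re (duhamel ?Y t k * 1)" for k
    proof -
      have "pairing I (cos_test k) = time_int t (\<lambda>s. pairing (g s) (cos_test k))"
        using int unfolding has_distr_integral_def by simp
      also have "\<dots> = time_int t (\<lambda>s. Re (?f k s * 1))"
      proof (rule set_lebesgue_integral_cong)
        show "\<forall>s. s \<in> {0..t} \<longrightarrow> pairing (g s) (cos_test k) = Re (?f k s * 1)"
          using g fourier_tests by (metis complex.sel(1) mult.right_neutral)
      qed simp
      also have "\<dots> = Re (duhamel ?Y t k * 1)" unfolding duhamel by (rule set_integral_Re_mult(2)[OF f_int])
      finally show ?thesis .
    qed
    moreover have "pairing I (sin_test k) = Re (duhamel ?Y t k * \<i>)" for k
    proof -
      have "pairing I (sin_test k) = time_int t (\<lambda>s. pairing (g s) (sin_test k))"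
        using int unfolding has_distr_integral_def by simp
      also have "\<dots> = time_int t (\<lambda>s. Re (?f k s * \<i>))"
      proof (rule set_lebesgue_integral_cong)
        have "pairing (g s) (sin_test k) = Re (fourier (g s) k * \<i>)" for s by (simp add: fourier_tests)
        then show "\<forall>s. s \<in> {0..t} \<longrightarrow> pairing (g s) (sin_test k) = Re (?f k s * \<i>)"
          using g by simp
      qed simp
      also have "\<dots> = Re (duhamel ?Y t k * \<i>)" unfolding duhamel by (rule set_integral_Re_mult(2)[OF f_int])
      finally show ?thesis .
    qed
    ultimately show "fourier I = duhamel ?Y t"
      by (intro ext) (simp add: fourier_tests complex_eq_iff)
  next
    assume I: "fourier I = duhamel ?Y t"
    obtain C where C: "0 \<le> C" "\<And>s k. cmod (lin ?Y s k) \<le> C * (jap k)\<^sup>2" using lin_bound[OF Y] by blast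
    show "has_distr_integral g I {0..t}"
      unfolding has_distr_integral_def
    proof
      fix \<phi>
      let ?h = "\<lambda>k s. Re (?f k s * cnj (test_coeff \<phi> k))"
      have h_int: "set_integrable lborel {0..t} (?h k)" for k by (rule set_integral_Re_mult(1)[OF f_int])
      have h_le: "\<bar>?h k s\<bar> \<le> C * ((jap k)\<^sup>2 * cmod (test_coeff \<phi> k))" if "s \<in> {0..t}" for k s
      proof -
        have "\<bar>?h k s\<bar> \<le> exp (- (lam k * (t - s))) * (cmod (lin ?Y s k) * cmod (test_coeff \<phi> k))"
          using abs_Re_le_cmod[of "?f k s * cnj (test_coeff \<phi> k)"] by (simp add: norm_mult mult.assoc)
        also have "\<dots> \<le> 1 * ((C * (jap k)\<^sup>2) * cmod (test_coeff \<phi> k))"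
          using that lam_nonneg[of k] C by (intro mult_mono mult_right_mono) auto
        finally show ?thesis by (simp add: mult.assoc)
      qed
      have J: "((\<lambda>k. time_int t (?h k)) has_sum pairing I \<phi>) UNIV"
        using pairing_has_sum[of I \<phi>] unfolding I duhamel set_integral_Re_mult(2)[OF f_int] .
      note sum = set_integral_infsum_freq[OF h_int summable_on_cmult_right[OF summable_test_coeff] h_le J]
      have p: "pairing (g s) \<phi> = (\<Sum>\<^sub>\<infinity>k. ?h k s)" if "s \<in> {0..t}" for s
        using infsumI[OF pairing_has_sum[of "g s" \<phi>]] g[OF that] by simp
      show "set_integrable lborel {0..t} (\<lambda>s. pairing (g s) \<phi>) \<and>
          set_lebesgue_integral lborel {0..t} (\<lambda>s. pairing (g s) \<phi>) = pairing I \<phi>"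
      proof
        show "set_integrable lborel {0..t} (\<lambda>s. pairing (g s) \<phi>)"
          using sum(1) by (subst set_integrable_cong[OF refl refl p]) auto
        show "set_lebesgue_integral lborel {0..t} (\<lambda>s. pairing (g s) \<phi>) = pairing I \<phi>"
          using sum(2) by (subst set_lebesgue_integral_cong[where g = "\<lambda>s. \<Sum>\<^sub>\<infinity>k. ?h k s"]) (auto simp: p simp del: atLeastAtMost_iff)
      qed
    qed
  qed
qed

lemma mild_solution_solves:
  assumes Y: "y \<in> C0_Sobolev T \<sigma>" and \<xi>: "X = (\<lambda>t. fourier (\<xi> t))"
  shows "mild_solution T \<xi> z y \<longleftrightarrow> solves (\<lambda>t. fourier (z t)) (\<lambda>t. fourier (y t))"
proof -
  let ?Y = "\<lambda>t. fourier (y t)"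
  have Yp: "hpath T \<sigma> ?Y" using Y by (simp only: C0_Sobolev_hpath)
  have "(\<exists>I. fourier I = duhamel ?Y t \<and> y t = - I + z t) \<longleftrightarrow> (\<forall>k. fourier (y t) k = fourier (z t) k - duhamel ?Y t k)"
    if t: "t \<in> {0..T}" for t
  proof
    assume "\<exists>I. fourier I = duhamel ?Y t \<and> y t = - I + z t"
    then obtain I where I: "fourier I = duhamel ?Y t" "y t = - I + z t" by blast
    show "\<forall>k. fourier (y t) k = fourier (z t) k - duhamel ?Y t k"
      unfolding I(2) fourier_add fourier_uminus_distr I(1) by simp
  next
    assume eq: "\<forall>k. fourier (y t) k = fourier (z t) k - duhamel ?Y t k"
    have "fourier (z t - y t) = duhamel ?Y t" by (rule ext) (simp only: fourier_diff spec[OF eq] diff_diff_eq2 add_diff_cancel_left')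
    moreover have "y t = - (z t - y t) + z t" by simp
    ultimately show "\<exists>I. fourier I = duhamel ?Y t \<and> y t = - I + z t" by blast
  qed
  then show ?thesis
    unfolding mild_solution_def solves_def using has_distr_integral_duhamel[OF Yp \<xi>] by simp
qed

text \<open>
  The coefficients of the solution are those of a real distribution, because the symmetry of the datum
  passes through the Neumann series.
\<close>

lemma mild_solution_unique_exists:
  assumes z: "z \<in> C0_Sobolev T \<sigma>" and \<xi>: "X = (\<lambda>t. fourier (\<xi> t))"
  shows "\<exists>!y. y \<in> C0_Sobolev T \<sigma> \<and> mild_solution T \<xi> z y"
proof -
  have Zp: "hpath T \<sigma> (\<lambda>t. fourier (z t))" using z by (simp only: C0_Sobolev_hpath)
  obtain Y where Y: "hpath T \<sigma> Y" "solves (\<lambda>t. fourier (z t)) Y" "\<And>t k. Y t (- k) = cnj (Y t k)"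
    using solves_exists[OF Zp] fourier_uminus by blast
  define y where "y t = distr_of_coeffs (Y t)" for t
  have "tempered (Y t)" for t
    by (rule tempered_hs[OF hpath_hs[OF Y(1)] Y(3)]) (use \<sigma> in simp)
  then have fy: "(\<lambda>t. fourier (y t)) = Y"
    by (intro ext) (simp add: y_def fourier_distr_of_coeffs)
  show ?thesis
  proof (rule ex1I[of _ y])
    have "y \<in> C0_Sobolev T \<sigma>" unfolding C0_Sobolev_hpath fy by (rule Y(1))
    then show "y \<in> C0_Sobolev T \<sigma> \<and> mild_solution T \<xi> z y"
      using Y(2) by (simp add: mild_solution_solves[OF _ \<xi>] fy)
    fix w assume w: "w \<in> C0_Sobolev T \<sigma> \<and> mild_solution T \<xi> z w"
    then have "hpath T \<sigma> (\<lambda>t. fourier (w t))" "solves (\<lambda>t. fourier (z t)) (\<lambda>t. fourier (w t))"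
      using mild_solution_solves[OF _ \<xi>] C0_Sobolev_hpath by blast+
    then have "(\<lambda>t. fourier (w t)) = Y" by (rule solves_unique[OF _ Y(1) _ Y(2)])
    then have "fourier (w t) = fourier (y t)" for t unfolding fy[symmetric] by metis
    then have "w t = y t" for t by (rule fourier_inject)
    then show "w = y" by (rule ext)
  qed
qed

lemma solution_map_props:
  assumes z: "z \<in> C0_Sobolev T \<sigma>" and \<xi>: "X = (\<lambda>t. fourier (\<xi> t))"
  shows "solution_map T \<sigma> \<xi> z \<in> C0_Sobolev T \<sigma>" "mild_solution T \<xi> z (solution_map T \<sigma> \<xi> z)"
  using theI'[OF mild_solution_unique_exists[OF z \<xi>]] unfolding solution_map_def by blast+

lemma solution_map_eqI:
  assumes "z \<in> C0_Sobolev T \<sigma>" "X = (\<lambda>t. fourier (\<xi> t))" "y \<in> C0_Sobolev T \<sigma>" "mild_solution T \<xi> z y"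
  shows "solution_map T \<sigma> \<xi> z = y"
  using mild_solution_unique_exists[OF assms(1,2)] solution_map_props[OF assms(1,2)] assms(3,4) by blast

lemma C0_Sobolev_lincomb:
  assumes "y \<in> C0_Sobolev T s" "w \<in> C0_Sobolev T s"
  shows "(\<lambda>t. a *\<^sub>R y t + w t) \<in> C0_Sobolev T s"
proof -
  have "(\<lambda>t. fourier (a *\<^sub>R y t + w t)) = (\<lambda>t k. of_real a * fourier (y t) k + fourier (w t) k)"
    by (intro ext) (simp only: fourier_add fourier_scaleR)
  then show ?thesis
    using hpath_lincomb[of T s "\<lambda>t. fourier (y t)" "\<lambda>t. fourier (w t)" "of_real a"] assms
    by (simp only: C0_Sobolev_hpath)
qed

lemma solution_map_lincomb:
  assumes z: "z \<in> C0_Sobolev T \<sigma>" and w: "w \<in> C0_Sobolev T \<sigma>" and \<xi>: "X = (\<lambda>t. fourier (\<xi> t))"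
  shows "solution_map T \<sigma> \<xi> (\<lambda>t. a *\<^sub>R z t + w t) = (\<lambda>t. a *\<^sub>R solution_map T \<sigma> \<xi> z t + solution_map T \<sigma> \<xi> w t)"
proof (rule solution_map_eqI[OF C0_Sobolev_lincomb[OF z w] \<xi> C0_Sobolev_lincomb])
  let ?S = "solution_map T \<sigma> \<xi>"
  note Sz = solution_map_props[OF z \<xi>] and Sw = solution_map_props[OF w \<xi>]
  show "?S z \<in> C0_Sobolev T \<sigma>" "?S w \<in> C0_Sobolev T \<sigma>" by fact+
  have p: "hpath T \<sigma> (\<lambda>t. fourier (?S z t))" "hpath T \<sigma> (\<lambda>t. fourier (?S w t))"
    using Sz(1) Sw(1) by (simp_all only: C0_Sobolev_hpath)
  have lin: "fourier (a *\<^sub>R u + v) = (\<lambda>k. of_real a * fourier u k + fourier v k)" for u v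
    by (rule ext) (simp add: fourier_add fourier_scaleR)
  have z': "fourier (?S z t) k = fourier (z t) k - duhamel (\<lambda>t. fourier (?S z t)) t k"
    and w': "fourier (?S w t) k = fourier (w t) k - duhamel (\<lambda>t. fourier (?S w t)) t k" if "t \<in> {0..T}" for t k
    using that Sz(2)[unfolded mild_solution_solves[OF Sz(1) \<xi>] solves_def]
      Sw(2)[unfolded mild_solution_solves[OF Sw(1) \<xi>] solves_def] by blast+
  show "mild_solution T \<xi> (\<lambda>t. a *\<^sub>R z t + w t) (\<lambda>t. a *\<^sub>R ?S z t + ?S w t)"
    unfolding mild_solution_solves[OF C0_Sobolev_lincomb[OF Sz(1) Sw(1)] \<xi>] solves_def lin duhamel_lincomb[OF p]
  proof (intro ballI allI)
    fix t k assume t: "t \<in> {0..T}"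
    show "of_real a * fourier (?S z t) k + fourier (?S w t) k = of_real a * fourier (z t) k + fourier (w t) k
        - (of_real a * duhamel (\<lambda>t. fourier (?S z t)) t k + duhamel (\<lambda>t. fourier (?S w t)) t k)"
      unfolding z'[OF t, of k] w'[OF t, of k] by (simp add: algebra_simps)
  qed
qed

lemma C0_norm_upper:
  assumes "z \<in> C0_Sobolev T s" "t \<in> {0..T}"
  shows "hnorm s (fourier (z t)) \<le> C0_norm T s z"
proof -
  obtain R where "\<And>t. hnorm s (fourier (z t)) \<le> R"
    using hpath_bounded assms(1) unfolding C0_Sobolev_hpath by blast
  then have "bdd_above ((\<lambda>t. hnorm s (fourier (z t))) ` {0..T})" by (intro bdd_aboveI2)
  then show ?thesis unfolding C0_norm_def Sobolev_norm_hnorm by (rule cSUP_upper[OF assms(2)])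
qed

lemma solution_map_bound:
  assumes z: "z \<in> C0_Sobolev T \<sigma>" and \<xi>: "X = (\<lambda>t. fourier (\<xi> t))"
  shows "C0_norm T \<sigma> (solution_map T \<sigma> \<xi> z) \<le> 2 * exp (2 * bil_const * total_h1_sq) * C0_norm T \<sigma> z"
  unfolding C0_norm_def[of T \<sigma> "solution_map T \<sigma> \<xi> z"] Sobolev_norm_hnorm
proof (rule cSUP_least)
  note S = solution_map_props[OF z \<xi>]
  fix t assume t: "t \<in> {0..T}"
  have "hnorm \<sigma> (fourier (solution_map T \<sigma> \<xi> z t)) \<le> 2 * C0_norm T \<sigma> z * exp (2 * bil_const * total_h1_sq)"
  proof (rule apriori_bound[where Y = "\<lambda>t. fourier (solution_map T \<sigma> \<xi> z t)" and Z = "\<lambda>t. fourier (z t)"])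
    show "hpath T \<sigma> (\<lambda>t. fourier (solution_map T \<sigma> \<xi> z t))" using S(1) by (simp only: C0_Sobolev_hpath)
    show "solves (\<lambda>t. fourier (z t)) (\<lambda>t. fourier (solution_map T \<sigma> \<xi> z t))"
      using S(2) mild_solution_solves[OF S(1) \<xi>] by blast
    show "hs \<sigma> (fourier (z t))" for t using z hpath_hs unfolding C0_Sobolev_hpath by blast
    show "hnorm \<sigma> (fourier (z t)) \<le> C0_norm T \<sigma> z" if "t \<in> {0..T}" for t by (rule C0_norm_upper[OF z that])
  qed (rule t)
  then show "hnorm \<sigma> (fourier (solution_map T \<sigma> \<xi> z t)) \<le> 2 * exp (2 * bil_const * total_h1_sq) * C0_norm T \<sigma> z"
    by (simp add: mult_ac)
qed (use T_pos in simp)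

end

theorem proposition3p9:
  fixes \<alpha> \<beta> :: real
  assumes "0 < \<alpha>" and "\<alpha> < 1" and "0 < \<beta>" and "\<beta> < \<alpha>"
  shows "\<exists>C>0. \<forall>T>0. \<exists>M>0. \<forall>\<xi>0 \<xi>.
    L2_torus \<xi>0 \<and> set_lebesgue_integral lborel unit_square \<xi>0 = 0 \<and> vorticity_solution T \<xi>0 \<xi> \<longrightarrow>
      (\<forall>z\<in>C0_Sobolev T (\<beta> - 1). \<exists>!y. y \<in> C0_Sobolev T (\<beta> - 1) \<and> mild_solution T \<xi> z y) \<and>
      bounded_linear_C0 T (\<beta> - 1) (solution_map T (\<beta> - 1) \<xi>) \<and>
      (\<forall>z\<in>C0_Sobolev T (\<beta> - 1).
        C0_norm T (\<beta> - 1) (solution_map T (\<beta> - 1) \<xi> z)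
          \<le> M * exp (C * (1 + T) * (L2_torus_norm \<xi>0)\<^sup>2) * C0_norm T (\<beta> - 1) z)"
proof -
  define C where "C = 2 * (4 * kernel_const (\<beta> - 1) + 1)"
  have "0 < C" using kernel_const_nonneg[of "\<beta> - 1"] by (simp add: C_def)
  have main: "(\<forall>z\<in>C0_Sobolev T (\<beta> - 1). \<exists>!y. y \<in> C0_Sobolev T (\<beta> - 1) \<and> mild_solution T \<xi> z y) \<and>
      bounded_linear_C0 T (\<beta> - 1) (solution_map T (\<beta> - 1) \<xi>) \<and>
      (\<forall>z\<in>C0_Sobolev T (\<beta> - 1).
        C0_norm T (\<beta> - 1) (solution_map T (\<beta> - 1) \<xi> z)
          \<le> 2 * exp (C * (1 + T) * (L2_torus_norm \<xi>0)\<^sup>2) * C0_norm T (\<beta> - 1) z)"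
    if "0 < T" and \<xi>0: "L2_torus \<xi>0" and sol: "vorticity_solution T \<xi>0 \<xi>" for T \<xi>0 \<xi>
  proof -
    let ?X = "\<lambda>t. fourier (\<xi> t)"
    interpret transport T "\<beta> - 1" ?X
    proof
      show "0 < T" by fact
      show "- 1 < \<beta> - 1" "\<beta> - 1 \<le> 0" using assms by auto
      show "hpath T 0 ?X" using sol unfolding vorticity_solution_def C0_Sobolev_hpath by blast
      show "fourier (\<xi> t) (- k) = cnj (fourier (\<xi> t) k)" for t k by (rule fourier_uminus)
      show "AE s in lborel. s \<in> {0..T} \<longrightarrow> hs 1 (fourier (\<xi> s))"
        using sol unfolding vorticity_solution_def Sobolev_hs by blast
      show "set_integrable lborel {0..T} (\<lambda>s. (hnorm 1 (fourier (\<xi> s)))\<^sup>2)"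
        using sol unfolding vorticity_solution_def Sobolev_norm_hnorm by blast
    qed
    let ?S = "solution_map T (\<beta> - 1) \<xi>" and ?H = "C0_Sobolev T (\<beta> - 1)"
    let ?B = "2 * exp (C * (1 + T) * (L2_torus_norm \<xi>0)\<^sup>2)"
    have "total_h1_sq \<le> (1 + T) * (hnorm 0 (fourier (\<xi> 0)))\<^sup>2"
      using vorticity_H1_bound[OF sol] \<open>0 < T\<close> by (simp add: total_h1_sq_def h1_sq_def[abs_def])
    also have "\<dots> \<le> (1 + T) * (L2_torus_norm \<xi>0)\<^sup>2"
    proof (intro mult_left_mono power_mono hnorm_nonneg)
      have "\<xi> 0 = distr_of_fun \<xi>0" using sol unfolding vorticity_solution_def by blast
      then show "hnorm 0 (fourier (\<xi> 0)) \<le> L2_torus_norm \<xi>0" using Bessel_L2_torus(2)[OF \<xi>0] by simp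
    qed (use \<open>0 < T\<close> in simp)
    finally have "2 * bil_const * total_h1_sq \<le> 2 * bil_const * ((1 + T) * (L2_torus_norm \<xi>0)\<^sup>2)"
      using bil_const_pos by (intro mult_left_mono) auto
    then have exp_le: "2 * exp (2 * bil_const * total_h1_sq) \<le> ?B"
      by (simp add: C_def bil_const_def mult.assoc)
    have bound: "C0_norm T (\<beta> - 1) (?S z) \<le> ?B * C0_norm T (\<beta> - 1) z" if z: "z \<in> ?H" for z
    proof -
      have "0 \<le> C0_norm T (\<beta> - 1) z"
        using order_trans[OF hnorm_nonneg C0_norm_upper[OF z, of 0]] \<open>0 < T\<close> by simp
      then show ?thesis
        by (rule order_trans[OF solution_map_bound[OF z refl] mult_right_mono[OF exp_le]])
    qed
    have lincomb: "?S (\<lambda>t. a *\<^sub>R z t + w t) = (\<lambda>t. a *\<^sub>R ?S z t + ?S w t)" if "z \<in> ?H" "w \<in> ?H" for a z w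
      by (rule solution_map_lincomb[OF that refl])
    have zero: "(\<lambda>t. 0) \<in> ?H" unfolding C0_Sobolev_hpath by (simp add: fourier_zero[abs_def] hpath_zero)
    have S0: "?S (\<lambda>t. 0) = (\<lambda>t. 0)"
      using lincomb[OF zero zero, of "- 1"] by simp
    have "bounded_linear_C0 T (\<beta> - 1) ?S"
      unfolding bounded_linear_C0_def
    proof (intro conjI ballI allI)
      show "?S z \<in> ?H" if "z \<in> ?H" for z by (rule solution_map_props[OF that refl])
      show "?S (\<lambda>t. z t + w t) = (\<lambda>t. ?S z t + ?S w t)" if "z \<in> ?H" "w \<in> ?H" for z w
        using lincomb[OF that, of 1] by simp
      show "?S (\<lambda>t. c *\<^sub>R z t) = (\<lambda>t. c *\<^sub>R ?S z t)" if "z \<in> ?H" for c z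
        using lincomb[OF that zero, of c] by (simp add: S0)
      show "\<exists>B. \<forall>z\<in>?H. C0_norm T (\<beta> - 1) (?S z) \<le> B * C0_norm T (\<beta> - 1) z"
        using bound by blast
    qed
    then show ?thesis
      using mild_solution_unique_exists[OF _ refl] bound by blast
  qed
  show ?thesis
    by (rule exI[of _ C], intro conjI allI impI \<open>0 < C\<close>, rule exI[of _ 2], intro conjI zero_less_numeral)
      (use main in blast)
qed

end
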